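(* Let $(\pi,\mathcal{L})$ be a submersion between the spray manifolds $(\overline{M},\overline{\mathbf{G}})$ and $(M,\mathbf{G})$. Let $c(t)$ be a smooth curve on $M$ with nowhere-vanishing $\dot{c}(t)$, $X(t)$ a smooth vector field along $c(t)$, $\overline{c}(t)$ a lifting of $c(t)$ tangent to $\mathcal{L}$, and $\overline{X}(t)$ the lifting of $X(t)$ along $\overline{c}(t)$ in $\mathcal{L}$. Then $$\Phi^{\mathcal{L}}_{TM}\left(\Phi^{T\overline{M}}_{\mathcal{L}}(\overline{D}_{\dot{\overline{c}}(t)}\overline{X}(t))\right)=D_{\dot{c}(t)}X(t),$$ in which $D$ and $\overline{D}$ are the linearly covariant derivatives for $(M,\mathbf{G})$ and $(\overline{M},\overline{\mathbf{G}})$. That means, for the smooth vector field $D_{\dot{c}(t)}X(t)$ along $c(t)$, $\Phi^{T\overline{M}}_{\mathcal{L}}(\overline{D}_{\dot{\overline{c}}(t)}\overline{X}(t))$ is its lifting along $\overline{c}(t)$ in $\mathcal{L}$. In particular, $X(t)$ is linearly parallel along $c(t)$ if and only if $\Phi^{T\overline{M}}_{\mathcal{L}}(\overline{D}_{\dot{\overline{c}}(t)}\overline{X}(t))=0$.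
   Context: A spray structure on a smooth manifold $M$ is a smooth tangent vector field $\mathbf{G}$ on the slit tangent bundle $TM\backslash 0$ which, in every standard local coordinate $(x^i,y^j)$ (i.e. $x=(x^i)\in M$, $y=y^j\partial_{x^j}\in T_xM$), has the form $\mathbf{G}=y^i\partial_{x^i}-2\mathbf{G}^i\partial_{y^i}$, where $\mathbf{G}^i(x,\lambda y)=\lambda^2\mathbf{G}^i(x,y)$ for all $\lambda>0$. Put $\mathbf{N}^i_j=\frac{\partial}{\partial y^j}\mathbf{G}^i$. A geodesic is a smooth curve $c(t)$ with nowhere-vanishing $\dot c(t)$ such that $(c(t),\dot c(t))$ is an integral curve of $\mathbf{G}$. For such velocity-nonvanishing smooth curves $c(t)$ and a smooth vector field $X(t)=X^i(t)\partial_{x^i}|_{c(t)}$ along $c(t)$, the linearly covariant derivative is $D_{\dot c(t)}X(t)=(\frac{\mathrm{d}}{\mathrm{d}t}X^i(t)+\mathbf{N}^i_j(c(t),\dot c(t))X^j(t))\partial_{x^i}|_{c(t)}$; $X(t)$ is linearly parallel if $D_{\dot c(t)}X(t)=0$. Submersion between spray structures: $\pi:\overline{M}\to M$ is a smooth submersion of manifolds, $\overline{\mathbf{G}}$, $\mathbf{G}$ are spray structures on $\overline{M}$, $M$, and $\mathcal{L}\subset T\overline{M}$ is a distribution (smooth linear subbundle) each of whose fibers $\mathcal{L}_{\overline{p}}$ is a linear complement of $\ker(\pi_*|_{\overline{p}})$ in $T_{\overline{p}}\overline{M}$. The pair $(\pi,\mathcal{L})$ is a submersion between $\overline{\mathbf{G}}$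 and $\mathbf{G}$ if (1) $\overline{\mathbf{G}}|_{\mathcal{L}\backslash0}$ is tangent to $\mathcal{L}\backslash0$ everywhere; (2) for any geodesic $\overline{c}(t)$ of $\overline{\mathbf{G}}$ with $(\overline{c}(t),\dot{\overline{c}}(t))\in\mathcal{L}\backslash0$, $\pi(\overline{c}(t))$ is a geodesic of $\mathbf{G}$. Bundle maps: $\Phi^{T\overline{M}}_{\mathcal{L}}:T\overline{M}\to\mathcal{L}$ is, fiberwise, the linear projection onto $\mathcal{L}_{\overline{p}}$ with kernel $\ker(\pi_*|_{\overline{p}})$, and $\Phi^{\mathcal{L}}_{TM}=\pi_*|_{\mathcal{L}}:\mathcal{L}\to TM$. Liftings: $\overline{c}(t)$ is a lifting of $c(t)$ tangent to $\mathcal{L}$ if $\pi(\overline{c}(t))=c(t)$ and $\dot{\overline{c}}(t)\in\mathcal{L}_{\overline{c}(t)}$ for all $t$. The lifting of $X(t)$ along $\overline{c}(t)$ in $\mathcal{L}$ is the vector field $\overline{X}(t)$ along $\overline{c}(t)$ with $\overline{X}(t)\in\mathcal{L}_{\overline{c}(t)}$ and $\pi_*(\overline{X}(t))=X(t)$ for all $t$. *)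

theory Defs
  imports "HOL-Analysis.Analysis"
begin

section \<open>Smooth maps between open subsets of Euclidean spaces\<close>

text \<open>Meant for open \<open>S\<close>. The derivatives of order \<open>k\<close> are the iterated directional derivatives,
  so for a Euclidean domain this is the usual class \<open>C\<^sup>k\<close>.\<close>

primrec Ck_on :: "nat \<Rightarrow> 'a::real_normed_vector set \<Rightarrow> ('a \<Rightarrow> 'b::real_normed_vector) \<Rightarrow> bool" where
  "Ck_on 0 S f \<longleftrightarrow> continuous_on S f"
| "Ck_on (Suc k) S f \<longleftrightarrow>
     (\<forall>x\<in>S. f differentiable (at x)) \<and> (\<forall>v. Ck_on k S (\<lambda>x. frechet_derivative f (at x) v))"

definition smooth_on :: "'a::real_normed_vector set \<Rightarrow> ('a \<Rightarrow> 'b::real_normed_vector) \<Rightarrow> bool" where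
  "smooth_on S f \<longleftrightarrow> (\<forall>k. Ck_on k S f)"


section \<open>Smooth manifolds\<close>

text \<open>A chart is a pair \<open>(U, \<phi>)\<close>; only the values of \<open>\<phi>\<close> on \<open>U\<close> matter. A manifold is given by an
  atlas, not necessarily maximal: the atlas determines the underlying set and the topology (the one
  that makes every chart a homeomorphism from an open set to an open set).\<close>

type_synonym ('p, 'e) chart = "'p set \<times> ('p \<Rightarrow> 'e)"

definition pts :: "('p, 'e) chart set \<Rightarrow> 'p set" where
  "pts A = (\<Union>\<kappa>\<in>A. fst \<kappa>)"

definition chart_inv :: "('p, 'e) chart \<Rightarrow> 'e \<Rightarrow> 'p" where
  "chart_inv \<kappa> = inv_into (fst \<kappa>) (snd \<kappa>)"

definition smooth_atlas :: "('p, 'e::euclidean_space) chart set \<Rightarrow> bool" where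
  "smooth_atlas A \<longleftrightarrow>
     (\<forall>\<kappa>\<in>A. inj_on (snd \<kappa>) (fst \<kappa>)) \<and>
     (\<forall>\<kappa>\<in>A. \<forall>\<kappa>'\<in>A. open (snd \<kappa> ` (fst \<kappa> \<inter> fst \<kappa>')) \<and>
        smooth_on (snd \<kappa> ` (fst \<kappa> \<inter> fst \<kappa>')) (snd \<kappa>' \<circ> chart_inv \<kappa>))"

definition atlas_open :: "('p, 'e::euclidean_space) chart set \<Rightarrow> 'p set \<Rightarrow> bool" where
  "atlas_open A V \<longleftrightarrow> V \<subseteq> pts A \<and> (\<forall>\<kappa>\<in>A. open (snd \<kappa> ` (fst \<kappa> \<inter> V)))"

definition atlas_topology :: "('p, 'e::euclidean_space) chart set \<Rightarrow> 'p topology" where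
  "atlas_topology A = topology (atlas_open A)"

definition smooth_manifold :: "('p, 'e::euclidean_space) chart set \<Rightarrow> bool" where
  "smooth_manifold A \<longleftrightarrow>
     smooth_atlas A \<and> Hausdorff_space (atlas_topology A) \<and> second_countable (atlas_topology A)"

lemma istopology_atlas_open:
  assumes "smooth_atlas A"
  shows "istopology (atlas_open A)"
  unfolding istopology_def
proof (intro conjI allI impI)
  fix S T assume S: "atlas_open A S" and T: "atlas_open A T"
  have "snd \<kappa> ` (fst \<kappa> \<inter> (S \<inter> T)) = snd \<kappa> ` (fst \<kappa> \<inter> S) \<inter> snd \<kappa> ` (fst \<kappa> \<inter> T)" if "\<kappa> \<in> A" for \<kappa>
    using assms that unfolding smooth_atlas_def inj_on_def by blast
  then show "atlas_open A (S \<inter> T)"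
    using S T unfolding atlas_open_def by auto
next
  fix \<K> assume K: "\<forall>K\<in>\<K>. atlas_open A K"
  have "snd \<kappa> ` (fst \<kappa> \<inter> \<Union>\<K>) = (\<Union>K\<in>\<K>. snd \<kappa> ` (fst \<kappa> \<inter> K))" for \<kappa> :: "('a, 'b) chart"
    by blast
  then show "atlas_open A (\<Union>\<K>)"
    using K unfolding atlas_open_def by (auto intro!: open_UN)
qed

lemma openin_atlas_topology:
  assumes "smooth_atlas A"
  shows "openin (atlas_topology A) = atlas_open A"
  unfolding atlas_topology_def by (rule topology_inverse'[OF istopology_atlas_open[OF assms]])

lemma topspace_atlas_topology:
  assumes "smooth_atlas A"
  shows "topspace (atlas_topology A) = pts A"
proof -
  have "open (snd \<kappa> ` (fst \<kappa> \<inter> pts A))" if "\<kappa> \<in> A" for \<kappa>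
  proof -
    have "fst \<kappa> \<inter> pts A = fst \<kappa> \<inter> fst \<kappa>"
      using that unfolding pts_def by blast
    then show ?thesis
      using assms that unfolding smooth_atlas_def by metis
  qed
  then have "atlas_open A (pts A)"
    unfolding atlas_open_def by simp
  then show ?thesis
    unfolding topspace_def openin_atlas_topology[OF assms] by (auto simp: atlas_open_def)
qed

text \<open>Continuity is contained in the requirement that the coordinate expressions have open domain.\<close>

definition smooth_map ::
  "('p, 'e::euclidean_space) chart set \<Rightarrow> ('q, 'f::euclidean_space) chart set \<Rightarrow> ('p \<Rightarrow> 'q) \<Rightarrow> bool" where
  "smooth_map A B f \<longleftrightarrow>
     f ` pts A \<subseteq> pts B \<and>
     (\<forall>\<kappa>\<in>A. \<forall>\<mu>\<in>B. open (snd \<kappa> ` (fst \<kappa> \<inter> f -` fst \<mu>)) \<and>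
        smooth_on (snd \<kappa> ` (fst \<kappa> \<inter> f -` fst \<mu>)) (snd \<mu> \<circ> f \<circ> chart_inv \<kappa>))"


section \<open>Tangent vectors and the tangent bundle\<close>

text \<open>A tangent vector at \<open>p\<close> is the family of its coordinate vectors in the charts around \<open>p\<close>,
  related by the Jacobians of the coordinate changes. It is set to \<open>0\<close> at all other charts, so
  that equality of functions is equality of tangent vectors.\<close>

type_synonym ('p, 'e) tvec = "('p, 'e) chart \<Rightarrow> 'e"

definition tangent_space :: "('p, 'e::euclidean_space) chart set \<Rightarrow> 'p \<Rightarrow> ('p, 'e) tvec set" where
  "tangent_space A p =
     {v. (\<forall>\<kappa>. \<kappa> \<notin> A \<or> p \<notin> fst \<kappa> \<longrightarrow> v \<kappa> = 0) \<and>
         (\<forall>\<kappa>\<in>A. \<forall>\<kappa>'\<in>A. p \<in> fst \<kappa> \<and> p \<in> fst \<kappa>' \<longrightarrow>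
            v \<kappa>' = frechet_derivative (snd \<kappa>' \<circ> chart_inv \<kappa>) (at (snd \<kappa> p)) (v \<kappa>))}"

definition tv_zero :: "('p, 'e::euclidean_space) tvec" where
  "tv_zero = (\<lambda>\<kappa>. 0)"

definition tv_add :: "('p, 'e::euclidean_space) tvec \<Rightarrow> ('p, 'e) tvec \<Rightarrow> ('p, 'e) tvec" where
  "tv_add v w = (\<lambda>\<kappa>. v \<kappa> + w \<kappa>)"

text \<open>The choice of the chart around \<open>p\<close> is immaterial by the transformation law of \<open>v\<close>.\<close>

definition tangent_map ::
  "('p, 'e::euclidean_space) chart set \<Rightarrow> ('q, 'f::euclidean_space) chart set \<Rightarrow> ('p \<Rightarrow> 'q) \<Rightarrow>
   'p \<Rightarrow> ('p, 'e) tvec \<Rightarrow> ('q, 'f) tvec" where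
  "tangent_map A B f p v =
     (let \<kappa> = (SOME \<kappa>. \<kappa> \<in> A \<and> p \<in> fst \<kappa>)
      in (\<lambda>\<mu>. if \<mu> \<in> B \<and> f p \<in> fst \<mu>
              then frechet_derivative (snd \<mu> \<circ> f \<circ> chart_inv \<kappa>) (at (snd \<kappa> p)) (v \<kappa>)
              else 0))"

text \<open>The standard local coordinates \<open>(x, y)\<close> on the tangent bundle, one for each chart.\<close>

definition tchart ::
  "('p, 'e::euclidean_space) chart set \<Rightarrow> ('p, 'e) chart \<Rightarrow> ('p \<times> ('p, 'e) tvec, 'e \<times> 'e) chart" where
  "tchart A \<kappa> = (SIGMA p : fst \<kappa>. tangent_space A p, \<lambda>(p, v). (snd \<kappa> p, v \<kappa>))"

definition tangent_atlas ::
  "('p, 'e::euclidean_space) chart set \<Rightarrow> ('p \<times> ('p, 'e) tvec, 'e \<times> 'e) chart set" where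
  "tangent_atlas A = tchart A ` A"

definition slit_bundle :: "('p, 'e::euclidean_space) chart set \<Rightarrow> ('p \<times> ('p, 'e) tvec) set" where
  "slit_bundle A = (SIGMA p : pts A. tangent_space A p - {tv_zero})"

definition smooth_vector_field_on ::
  "('p, 'e::euclidean_space) chart set \<Rightarrow> 'p set \<Rightarrow> ('p \<Rightarrow> ('p, 'e) tvec) \<Rightarrow> bool" where
  "smooth_vector_field_on A S V \<longleftrightarrow>
     (\<forall>p\<in>S. V p \<in> tangent_space A p) \<and>
     (\<forall>\<kappa>\<in>A. smooth_on (snd \<kappa> ` (fst \<kappa> \<inter> S)) (\<lambda>x. V (chart_inv \<kappa> x) \<kappa>))"


section \<open>Curves\<close>

definition smooth_curve ::
  "('p, 'e::euclidean_space) chart set \<Rightarrow> real set \<Rightarrow> (real \<Rightarrow> 'p) \<Rightarrow> bool" where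
  "smooth_curve A I c \<longleftrightarrow>
     open I \<and> is_interval I \<and> I \<noteq> {} \<and> c ` I \<subseteq> pts A \<and>
     (\<forall>\<kappa>\<in>A. open (I \<inter> c -` fst \<kappa>) \<and> smooth_on (I \<inter> c -` fst \<kappa>) (snd \<kappa> \<circ> c))"

definition velocity ::
  "('p, 'e::euclidean_space) chart set \<Rightarrow> (real \<Rightarrow> 'p) \<Rightarrow> real \<Rightarrow> ('p, 'e) tvec" where
  "velocity A c t =
     (\<lambda>\<kappa>. if \<kappa> \<in> A \<and> c t \<in> fst \<kappa> then vector_derivative (snd \<kappa> \<circ> c) (at t) else 0)"

definition velocity_lift ::
  "('p, 'e::euclidean_space) chart set \<Rightarrow> (real \<Rightarrow> 'p) \<Rightarrow> real \<Rightarrow> 'p \<times> ('p, 'e) tvec" where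
  "velocity_lift A c t = (c t, velocity A c t)"

definition regular_curve ::
  "('p, 'e::euclidean_space) chart set \<Rightarrow> real set \<Rightarrow> (real \<Rightarrow> 'p) \<Rightarrow> bool" where
  "regular_curve A I c \<longleftrightarrow> smooth_curve A I c \<and> (\<forall>t\<in>I. velocity A c t \<noteq> tv_zero)"

definition smooth_field_along ::
  "('p, 'e::euclidean_space) chart set \<Rightarrow> real set \<Rightarrow> (real \<Rightarrow> 'p) \<Rightarrow> (real \<Rightarrow> ('p, 'e) tvec) \<Rightarrow> bool" where
  "smooth_field_along A I c X \<longleftrightarrow>
     (\<forall>t\<in>I. X t \<in> tangent_space A (c t)) \<and>
     (\<forall>\<kappa>\<in>A. smooth_on (I \<inter> c -` fst \<kappa>) (\<lambda>t. X t \<kappa>))"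

definition integral_curve ::
  "('p, 'e::euclidean_space) chart set \<Rightarrow> 'p set \<Rightarrow> ('p \<Rightarrow> ('p, 'e) tvec) \<Rightarrow> real set \<Rightarrow>
   (real \<Rightarrow> 'p) \<Rightarrow> bool" where
  "integral_curve A S V I \<gamma> \<longleftrightarrow>
     smooth_curve A I \<gamma> \<and> \<gamma> ` I \<subseteq> S \<and> (\<forall>t\<in>I. velocity A \<gamma> t = V (\<gamma> t))"

text \<open>For an embedded submanifold \<open>S\<close>, these are the elements of the tangent space of \<open>S\<close> at \<open>u\<close>.\<close>

definition tangent_to ::
  "('p, 'e::euclidean_space) chart set \<Rightarrow> 'p set \<Rightarrow> 'p \<Rightarrow> ('p, 'e) tvec \<Rightarrow> bool" where
  "tangent_to A S u w \<longleftrightarrow>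
     (\<exists>\<epsilon>>0. \<exists>\<gamma>. smooth_curve A {-\<epsilon><..<\<epsilon>} \<gamma> \<and> \<gamma> ` {-\<epsilon><..<\<epsilon>} \<subseteq> S \<and> \<gamma> 0 = u \<and> velocity A \<gamma> 0 = w)"


section \<open>Spray structures\<close>

type_synonym ('p, 'e) spray_field =
  "'p \<times> ('p, 'e) tvec \<Rightarrow> ('p \<times> ('p, 'e) tvec, 'e \<times> 'e) tvec"

definition spray :: "('p, 'e::euclidean_space) chart set \<Rightarrow> ('p, 'e) spray_field \<Rightarrow> bool" where
  "spray A G \<longleftrightarrow>
     smooth_vector_field_on (tangent_atlas A) (slit_bundle A) G \<and>
     (\<forall>\<kappa>\<in>A. \<exists>g.
        (\<forall>(p, v)\<in>slit_bundle A. p \<in> fst \<kappa> \<longrightarrow>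
           G (p, v) (tchart A \<kappa>) = (v \<kappa>, - 2 *\<^sub>R g (snd \<kappa> p) (v \<kappa>))) \<and>
        (\<forall>x\<in>snd \<kappa> ` fst \<kappa>. \<forall>y. y \<noteq> 0 \<longrightarrow> (\<forall>s>0. g x (s *\<^sub>R y) = s\<^sup>2 *\<^sub>R g x y)))"

text \<open>The coefficients \<open>G\<^sup>i(x, y)\<close>, read off from the \<open>\<partial>/\<partial>y\<^sup>i\<close>-components \<open>- 2 G\<^sup>i\<close> of the spray.\<close>

definition spray_coeff ::
  "('p, 'e::euclidean_space) chart set \<Rightarrow> ('p, 'e) spray_field \<Rightarrow> ('p, 'e) chart \<Rightarrow> 'e \<Rightarrow> 'e \<Rightarrow> 'e" where
  "spray_coeff A G \<kappa> x y =
     (- 1 / 2) *\<^sub>R snd (G (chart_inv (tchart A \<kappa>) (x, y)) (tchart A \<kappa>))"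

definition spray_N ::
  "('p, real^'n) chart set \<Rightarrow> ('p, real^'n) spray_field \<Rightarrow> ('p, real^'n) chart \<Rightarrow>
   real^'n \<Rightarrow> real^'n \<Rightarrow> real^'n^'n" where
  "spray_N A G \<kappa> x y =
     (\<chi> i j. frechet_derivative (\<lambda>z. spray_coeff A G \<kappa> x z $ i) (at y) (axis j 1))"

definition geodesic ::
  "('p, 'e::euclidean_space) chart set \<Rightarrow> ('p, 'e) spray_field \<Rightarrow> real set \<Rightarrow> (real \<Rightarrow> 'p) \<Rightarrow> bool" where
  "geodesic A G I c \<longleftrightarrow>
     regular_curve A I c \<and>
     integral_curve (tangent_atlas A) (slit_bundle A) G I (velocity_lift A c)"

definition cov_deriv ::
  "('p, real^'n) chart set \<Rightarrow> ('p, real^'n) spray_field \<Rightarrow> (real \<Rightarrow> 'p) \<Rightarrow>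
   (real \<Rightarrow> ('p, real^'n) tvec) \<Rightarrow> real \<Rightarrow> ('p, real^'n) tvec" where
  "cov_deriv A G c X t =
     (\<lambda>\<kappa>. if \<kappa> \<in> A \<and> c t \<in> fst \<kappa>
          then vector_derivative (\<lambda>s. X s \<kappa>) (at t)
               + spray_N A G \<kappa> (snd \<kappa> (c t)) (velocity A c t \<kappa>) *v X t \<kappa>
          else 0)"

definition linearly_parallel ::
  "('p, real^'n) chart set \<Rightarrow> ('p, real^'n) spray_field \<Rightarrow> real set \<Rightarrow> (real \<Rightarrow> 'p) \<Rightarrow>
   (real \<Rightarrow> ('p, real^'n) tvec) \<Rightarrow> bool" where
  "linearly_parallel A G I c X \<longleftrightarrow> (\<forall>t\<in>I. cov_deriv A G c X t = tv_zero)"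


section \<open>Submersions between spray structures\<close>

definition smooth_submersion ::
  "('q, 'f::euclidean_space) chart set \<Rightarrow> ('p, 'e::euclidean_space) chart set \<Rightarrow> ('q \<Rightarrow> 'p) \<Rightarrow> bool" where
  "smooth_submersion B A \<pi> \<longleftrightarrow>
     smooth_map B A \<pi> \<and>
     (\<forall>q\<in>pts B. tangent_map B A \<pi> q ` tangent_space B q = tangent_space A (\<pi> q))"

definition vertical_space ::
  "('q, 'f::euclidean_space) chart set \<Rightarrow> ('p, 'e::euclidean_space) chart set \<Rightarrow> ('q \<Rightarrow> 'p) \<Rightarrow>
   'q \<Rightarrow> ('q, 'f) tvec set" where
  "vertical_space B A \<pi> q = {v \<in> tangent_space B q. tangent_map B A \<pi> q v = tv_zero}"

text \<open>A smooth linear subbundle of the tangent bundle, as a set of pairs (point, tangent vector): near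
  every point, the fibers are spanned by a smooth frame of linearly independent vector fields. The
  frame \<open>b\<^sub>0, \<dots>, b\<^sub>k\<^sub>-\<^sub>1\<close> is written in the coordinates of a chart.\<close>

definition smooth_distribution ::
  "('q, 'f::euclidean_space) chart set \<Rightarrow> ('q \<times> ('q, 'f) tvec) set \<Rightarrow> bool" where
  "smooth_distribution B L \<longleftrightarrow>
     L \<subseteq> (SIGMA q : pts B. tangent_space B q) \<and>
     (\<exists>k::nat. \<forall>\<kappa>\<in>B. \<forall>q\<in>fst \<kappa>. \<exists>W b.
        open W \<and> snd \<kappa> q \<in> W \<and> W \<subseteq> snd \<kappa> ` fst \<kappa> \<and>
        (\<forall>i<k. smooth_on W (b i)) \<and>
        (\<forall>x\<in>W. inj_on (\<lambda>i. b i x) {..<k} \<and> independent ((\<lambda>i. b i x) ` {..<k}) \<and>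
           (\<lambda>v. v \<kappa>) ` (L `` {chart_inv \<kappa> x}) = span ((\<lambda>i. b i x) ` {..<k})))"

definition horizontal_distribution ::
  "('q, 'f::euclidean_space) chart set \<Rightarrow> ('p, 'e::euclidean_space) chart set \<Rightarrow> ('q \<Rightarrow> 'p) \<Rightarrow>
   ('q \<times> ('q, 'f) tvec) set \<Rightarrow> bool" where
  "horizontal_distribution B A \<pi> L \<longleftrightarrow>
     smooth_distribution B L \<and>
     (\<forall>q\<in>pts B. L `` {q} \<inter> vertical_space B A \<pi> q = {tv_zero} \<and>
        tangent_space B q = {tv_add l k |l k. l \<in> L `` {q} \<and> k \<in> vertical_space B A \<pi> q})"

definition spray_submersion ::
  "('q, 'f::euclidean_space) chart set \<Rightarrow> ('q, 'f) spray_field \<Rightarrow>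
   ('p, 'e::euclidean_space) chart set \<Rightarrow> ('p, 'e) spray_field \<Rightarrow>
   ('q \<Rightarrow> 'p) \<Rightarrow> ('q \<times> ('q, 'f) tvec) set \<Rightarrow> bool" where
  "spray_submersion B H A G \<pi> L \<longleftrightarrow>
     smooth_manifold B \<and> smooth_manifold A \<and> spray B H \<and> spray A G \<and>
     smooth_submersion B A \<pi> \<and> horizontal_distribution B A \<pi> L \<and>
     (\<forall>u \<in> L \<inter> slit_bundle B. tangent_to (tangent_atlas B) (L \<inter> slit_bundle B) u (H u)) \<and>
     (\<forall>I c. geodesic B H I c \<and> velocity_lift B c ` I \<subseteq> L \<inter> slit_bundle B \<longrightarrow>
        geodesic A G I (\<pi> \<circ> c))"

definition proj_onto_L ::
  "('q, 'f::euclidean_space) chart set \<Rightarrow> ('p, 'e::euclidean_space) chart set \<Rightarrow> ('q \<Rightarrow> 'p) \<Rightarrow>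
   ('q \<times> ('q, 'f) tvec) set \<Rightarrow> 'q \<times> ('q, 'f) tvec \<Rightarrow> 'q \<times> ('q, 'f) tvec" where
  "proj_onto_L B A \<pi> L =
     (\<lambda>(q, v). (q, THE l. l \<in> L `` {q} \<and> (\<exists>k\<in>vertical_space B A \<pi> q. v = tv_add l k)))"

definition L_to_TM ::
  "('q, 'f::euclidean_space) chart set \<Rightarrow> ('p, 'e::euclidean_space) chart set \<Rightarrow> ('q \<Rightarrow> 'p) \<Rightarrow>
   ('q \<times> ('q, 'f) tvec) set \<Rightarrow> 'q \<times> ('q, 'f) tvec \<Rightarrow> 'p \<times> ('p, 'e) tvec" where
  "L_to_TM B A \<pi> L = restrict (\<lambda>(q, v). (\<pi> q, tangent_map B A \<pi> q v)) L"

definition lifting_tangent_to ::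
  "('q, 'f::euclidean_space) chart set \<Rightarrow> ('q \<Rightarrow> 'p) \<Rightarrow> ('q \<times> ('q, 'f) tvec) set \<Rightarrow> real set \<Rightarrow>
   (real \<Rightarrow> 'p) \<Rightarrow> (real \<Rightarrow> 'q) \<Rightarrow> bool" where
  "lifting_tangent_to B \<pi> L I c d \<longleftrightarrow>
     smooth_curve B I d \<and> (\<forall>t\<in>I. \<pi> (d t) = c t \<and> velocity_lift B d t \<in> L)"

text \<open>Smoothness of the lifted field is a consequence and is not assumed.\<close>

definition field_lifting ::
  "('q, 'f::euclidean_space) chart set \<Rightarrow> ('p, 'e::euclidean_space) chart set \<Rightarrow> ('q \<Rightarrow> 'p) \<Rightarrow>
   ('q \<times> ('q, 'f) tvec) set \<Rightarrow> real set \<Rightarrow> (real \<Rightarrow> 'q) \<Rightarrow>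
   (real \<Rightarrow> ('p, 'e) tvec) \<Rightarrow> (real \<Rightarrow> ('q, 'f) tvec) \<Rightarrow> bool" where
  "field_lifting B A \<pi> L I d X Y \<longleftrightarrow>
     (\<forall>t\<in>I. (d t, Y t) \<in> L \<and> tangent_map B A \<pi> (d t) (Y t) = X t)"

end

theory Submission
  imports Defs
begin

text \<open>
  Let \<open>f\<close> be the submersion in coordinates, let \<open>g\<close> and \<open>g'\<close> be the coefficients of the sprays
  upstairs and downstairs, and let \<open>N = \<partial>g/\<partial>y\<close> and \<open>N' = \<partial>g'/\<partial>y\<close>. For horizontal \<open>y\<close> at \<open>x\<close>, a
  geodesic with initial velocity \<open>y\<close> projects to a geodesic. Comparing the accelerations of the two
  curves gives
  \<open>D\<^sup>2f(x)(y, y) - 2 Df(x) g(x, y) = - 2 g'(f x, Df(x) y)\<close>.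
  This holds on a linear space of vectors \<open>y\<close>, so it can be differentiated there: for a second
  horizontal vector \<open>\<xi>\<close>,
  \<open>D\<^sup>2f(x)(y, \<xi>) + N'(f x, Df(x) y) Df(x) \<xi> = Df(x) N(x, y) \<xi>\<close>,
  by the symmetry of second derivatives. If now \<open>y\<close> is the velocity of the lifted curve and \<open>\<xi>\<close> the
  lifted field, then \<open>X = Df(x) \<xi>\<close> has the derivative \<open>X' = D\<^sup>2f(x)(y, \<xi>) + Df(x) \<xi>'\<close>, and so
  \<open>X' + N' X = Df(x) (\<xi>' + N \<xi>)\<close>: the covariant derivative upstairs is mapped to the one downstairs
  (\<open>cov_deriv_related\<close>, \<open>cov_deriv_projection\<close>). Projecting to the complement first only removes a
  vertical vector, and on the complement the tangent map is injective. This gives the lifting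
  property and the statement on parallel fields.

  The first relation (\<open>horizontal_spray_relation\<close>) requires that a geodesic with velocity in the
  complement exists for each horizontal initial vector; otherwise the assumption on geodesics says
  nothing. Two facts produce it. The complement has a smooth horizontal lift \<open>h\<close>, by Cramer's rule
  in a local frame (\<open>smooth_horizontal_lift\<close>). And the geodesic equation, restricted to horizontal
  velocities, becomes an ordinary differential equation for the point \<open>x\<close> and the projected velocity
  \<open>w\<close>, with \<open>x' = h(x, w)\<close>. Its solutions exist by the theorem of Picard and Lindeloef and are smooth
  (\<open>ode_solution_exists\<close>); that they are geodesics is the tangency of the spray to the complement
  (\<open>spray_tangent_to_horizontal\<close>).

  For the vertical part of the covariant derivative to make sense, the latter must be a tangent
  vector, that is, independent of the coordinates. The same computation shows this, as coordinate
  changes relate the coefficients of one spray in two charts in all directions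
  (\<open>spray_coeff_transform\<close>).
\<close>

section \<open>Calculus of smooth maps\<close>

abbreviation fd :: "('a::real_normed_vector \<Rightarrow> 'b::real_normed_vector) \<Rightarrow> 'a \<Rightarrow> 'a \<Rightarrow> 'b"
  where "fd f x \<equiv> frechet_derivative f (at x)"

lemma fd_eqI: "(f has_derivative f') (at x) \<Longrightarrow> fd f x = f'"
  using frechet_derivative_at by metis

lemma has_derivative_fd: "f differentiable (at x) \<Longrightarrow> (f has_derivative fd f x) (at x)"
  using frechet_derivative_works by blast

lemma fd_cong:
  assumes "open S" "x \<in> S" "\<And>y. y \<in> S \<Longrightarrow> f y = g y"
  shows "fd f x = fd g x"
proof -
  have "(f has_derivative D) (at x) \<longleftrightarrow> (g has_derivative D) (at x)" for D
    using assms has_derivative_transform_within_open[of f D x UNIV S g]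
      has_derivative_transform_within_open[of g D x UNIV S f] by metis
  then show ?thesis unfolding frechet_derivative_def by simp
qed

lemma differentiable_cong_open:
  assumes "open S" "x \<in> S" "\<And>y. y \<in> S \<Longrightarrow> f y = g y" "f differentiable (at x)"
  shows "g differentiable (at x)"
  using assms has_derivative_transform_within_open[of f _ x UNIV S g]
  unfolding differentiable_def by metis

lemma Ck_on_cong:
  assumes "open S" "\<And>y. y \<in> S \<Longrightarrow> f y = g y" "Ck_on k S f"
  shows "Ck_on k S g"
  using assms(2,3)
proof (induction k arbitrary: f g)
  case 0
  then show ?case by (metis Ck_on.simps(1) continuous_on_cong)
next
  case (Suc k)
  have "g differentiable (at x)" if "x \<in> S" for x
    using Suc.prems differentiable_cong_open[OF assms(1) that, of f g] that by auto
  moreover have "Ck_on k S (\<lambda>x. fd g x v)" for v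
  proof (rule Suc.IH[of "\<lambda>x. fd f x v"])
    show "fd f y v = fd g y v" if "y \<in> S" for y
      using fd_cong[OF assms(1) that, of f g] Suc.prems(1) by simp
    show "Ck_on k S (\<lambda>x. fd f x v)" using Suc.prems by simp
  qed
  ultimately show ?case by simp
qed

lemma Ck_on_subset: "Ck_on k S f \<Longrightarrow> T \<subseteq> S \<Longrightarrow> Ck_on k T f"
  by (induction k arbitrary: f) (auto intro: continuous_on_subset)

lemma Ck_on_SucD: "Ck_on (Suc k) S f \<Longrightarrow> Ck_on k S f"
proof (induction k arbitrary: f)
  case 0
  then show ?case
    by (auto intro!: continuous_at_imp_continuous_on differentiable_imp_continuous_within)
next
  case (Suc k)
  then have "Ck_on (Suc k) S (\<lambda>x. fd f x v)" for v by simp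
  then have "Ck_on k S (\<lambda>x. fd f x v)" for v using Suc.IH by blast
  then show ?case using Suc.prems by simp
qed

lemma Ck_on_const: "Ck_on k S (\<lambda>x. c)"
  by (induction k arbitrary: c) auto

lemma Ck_on_linear_compose:
  assumes L: "bounded_linear L" and S: "open S" and "Ck_on k S f"
  shows "Ck_on k S (\<lambda>x. L (f x))"
  using assms(3)
proof (induction k arbitrary: f)
  case 0
  then show ?case using bounded_linear.continuous_on[OF L] by auto
next
  case (Suc k)
  have der: "((\<lambda>x. L (f x)) has_derivative (\<lambda>v. L (fd f x v))) (at x)" if "x \<in> S" for x
    by (rule bounded_linear.has_derivative[OF L has_derivative_fd]) (use Suc.prems that in auto)
  have "Ck_on k S (\<lambda>x. fd (\<lambda>x. L (f x)) x v)" for v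
    by (rule Ck_on_cong[OF S, of "\<lambda>x. L (fd f x v)"])
       (use fd_eqI[OF der] Suc in simp_all)
  then show ?case using der unfolding Ck_on.simps differentiable_def by blast
qed

lemma Ck_on_add:
  assumes S: "open S" and "Ck_on k S f" "Ck_on k S g"
  shows "Ck_on k S (\<lambda>x. f x + g x)"
  using assms(2,3)
proof (induction k arbitrary: f g)
  case 0
  then show ?case by (auto intro: continuous_on_add)
next
  case (Suc k)
  have der: "((\<lambda>x. f x + g x) has_derivative (\<lambda>v. fd f x v + fd g x v)) (at x)" if "x \<in> S" for x
    by (rule has_derivative_add[OF has_derivative_fd has_derivative_fd]) (use Suc.prems that in auto)
  have "Ck_on k S (\<lambda>x. fd (\<lambda>x. f x + g x) x v)" for v
    by (rule Ck_on_cong[OF S, of "\<lambda>x. fd f x v + fd g x v"])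
       (use fd_eqI[OF der] Suc in simp_all)
  then show ?case using der unfolding Ck_on.simps differentiable_def by blast
qed

lemma Ck_on_bilinear:
  assumes B: "bounded_bilinear B" and S: "open S" and "Ck_on k S f" "Ck_on k S g"
  shows "Ck_on k S (\<lambda>x. B (f x) (g x))"
  using assms(3,4)
proof (induction k arbitrary: f g)
  case 0
  then show ?case using bounded_bilinear.continuous_on[OF B] by auto
next
  case (Suc k)
  have der: "((\<lambda>x. B (f x) (g x)) has_derivative (\<lambda>v. B (f x) (fd g x v) + B (fd f x v) (g x))) (at x)"
    if "x \<in> S" for x
    by (rule bounded_bilinear.FDERIV[OF B has_derivative_fd has_derivative_fd]) (use Suc.prems that in auto)
  have "Ck_on k S (\<lambda>x. fd (\<lambda>x. B (f x) (g x)) x v)" for v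
  proof (rule Ck_on_cong[OF S, of "\<lambda>x. B (f x) (fd g x v) + B (fd f x v) (g x)"])
    show "B (f y) (fd g y v) + B (fd f y v) (g y) = fd (\<lambda>x. B (f x) (g x)) y v" if "y \<in> S" for y
      using fd_eqI[OF der[OF that]] by simp
    show "Ck_on k S (\<lambda>x. B (f x) (fd g x v) + B (fd f x v) (g x))"
      using Suc.prems Ck_on_SucD[OF Suc.prems(1)] Ck_on_SucD[OF Suc.prems(2)]
      by (intro Ck_on_add S Suc.IH) simp_all
  qed
  then show ?case using der unfolding Ck_on.simps differentiable_def by blast
qed

lemma Ck_on_sum:
  assumes S: "open S" and "\<And>i. i \<in> A \<Longrightarrow> Ck_on k S (f i)"
  shows "Ck_on k S (\<lambda>x. \<Sum>i\<in>A. f i x)"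
  using assms(2)
  by (induction A rule: infinite_finite_induct) (auto intro!: Ck_on_add S Ck_on_const)

text \<open>The chain rule turns the derivative of \<open>g \<circ> f\<close> into a sum of products of directional
  derivatives \<open>\<partial>\<^sub>b g \<circ> f\<close> along basis vectors \<open>b\<close>, of one order less, with coefficients of
  class \<open>C\<^sup>k\<close>. This is where the Euclidean domain of \<open>g\<close> matters: a directional derivative in a
  direction that varies with the point has no immediate meaning in terms of \<open>Ck_on\<close>.\<close>

lemma Ck_on_compose:
  fixes f :: "'a::real_normed_vector \<Rightarrow> 'b::euclidean_space" and g :: "'b \<Rightarrow> 'c::real_normed_vector"
  assumes S: "open S" and T: "open T" and "Ck_on k S f" "Ck_on k T g" and fS: "f ` S \<subseteq> T"
  shows "Ck_on k S (\<lambda>x. g (f x))"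
  using assms(3,4)
proof (induction k arbitrary: g)
  case 0
  then show ?case using continuous_on_compose2[OF _ _ fS] by auto
next
  case (Suc k)
  have df: "f differentiable (at x)" if "x \<in> S" for x using Suc.prems that by auto
  have dg: "g differentiable (at (f x))" if "x \<in> S" for x using Suc.prems that fS by auto
  have der: "((\<lambda>x. g (f x)) has_derivative (\<lambda>v. fd g (f x) (fd f x v))) (at x)" if "x \<in> S" for x
    using has_derivative_compose[OF has_derivative_fd[OF df[OF that]] has_derivative_fd[OF dg[OF that]]] .
  have "Ck_on k S (\<lambda>x. fd (\<lambda>x. g (f x)) x v)" for v
  proof (rule Ck_on_cong[OF S, of "\<lambda>x. \<Sum>b\<in>Basis. (fd f x v \<bullet> b) *\<^sub>R fd g (f x) b"])
    show "(\<Sum>b\<in>Basis. (fd f y v \<bullet> b) *\<^sub>R fd g (f y) b) = fd (\<lambda>x. g (f x)) y v" if "y \<in> S" for y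
    proof -
      have l: "linear (fd g (f y))" using dg[OF that] by (rule linear_frechet_derivative)
      have "fd (\<lambda>x. g (f x)) y v = fd g (f y) (\<Sum>b\<in>Basis. (fd f y v \<bullet> b) *\<^sub>R b)"
        unfolding fd_eqI[OF der[OF that]] by (simp add: euclidean_representation)
      then show ?thesis by (simp only: linear_sum[OF l] linear_scale[OF l])
    qed
    have "Ck_on k S f" using Suc.prems Ck_on_SucD by blast
    then have 1: "Ck_on k S (\<lambda>x. fd g (f x) b)" for b
      using Suc.IH[of "\<lambda>x. fd g x b"] Suc.prems by simp
    have "Ck_on k S (\<lambda>x. fd f x v \<bullet> b)" for b
      by (rule Ck_on_linear_compose[OF _ S]) (use Suc.prems in \<open>auto intro: bounded_linear_inner_left\<close>)
    then show "Ck_on k S (\<lambda>x. \<Sum>b\<in>Basis. (fd f x v \<bullet> b) *\<^sub>R fd g (f x) b)"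
      by (intro Ck_on_sum Ck_on_bilinear[OF bounded_bilinear_scaleR] S 1)
  qed
  then show ?case using der unfolding Ck_on.simps differentiable_def by blast
qed

lemma smooth_on_cong:
  assumes "open S" "smooth_on S f" "\<And>y. y \<in> S \<Longrightarrow> f y = g y"
  shows "smooth_on S g"
  using assms Ck_on_cong[of S f g] unfolding smooth_on_def by blast

lemma smooth_on_subset: "smooth_on S f \<Longrightarrow> T \<subseteq> S \<Longrightarrow> smooth_on T f"
  unfolding smooth_on_def using Ck_on_subset by blast

lemma smooth_on_differentiable: "smooth_on S f \<Longrightarrow> x \<in> S \<Longrightarrow> f differentiable (at x)"
  unfolding smooth_on_def using Ck_on.simps(2) by blast

lemma smooth_on_has_derivative: "smooth_on S f \<Longrightarrow> x \<in> S \<Longrightarrow> (f has_derivative fd f x) (at x)"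
  using smooth_on_differentiable has_derivative_fd by blast

lemma smooth_on_continuous_on: "smooth_on S f \<Longrightarrow> continuous_on S f"
  unfolding smooth_on_def using Ck_on.simps(1) by blast

lemma smooth_on_const: "smooth_on S (\<lambda>x. c)"
  by (simp add: smooth_on_def Ck_on_const)

lemma smooth_on_linear_compose:
  "bounded_linear L \<Longrightarrow> open S \<Longrightarrow> smooth_on S f \<Longrightarrow> smooth_on S (\<lambda>x. L (f x))"
  by (simp add: smooth_on_def Ck_on_linear_compose)

lemma Ck_on_ident: "Ck_on k S (\<lambda>x. x)"
  by (cases k) (auto simp: Ck_on_const)

lemma smooth_on_linear: "bounded_linear L \<Longrightarrow> open S \<Longrightarrow> smooth_on S L"
  using smooth_on_linear_compose[of L S "\<lambda>x. x"] Ck_on_ident by (auto simp: smooth_on_def)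

lemma smooth_on_add: "open S \<Longrightarrow> smooth_on S f \<Longrightarrow> smooth_on S g \<Longrightarrow> smooth_on S (\<lambda>x. f x + g x)"
  by (simp add: smooth_on_def Ck_on_add)

lemma smooth_on_sum:
  "open S \<Longrightarrow> (\<And>i. i \<in> A \<Longrightarrow> smooth_on S (f i)) \<Longrightarrow> smooth_on S (\<lambda>x. \<Sum>i\<in>A. f i x)"
  by (simp add: smooth_on_def Ck_on_sum)

lemma smooth_on_bilinear:
  "bounded_bilinear B \<Longrightarrow> open S \<Longrightarrow> smooth_on S f \<Longrightarrow> smooth_on S g \<Longrightarrow>
    smooth_on S (\<lambda>x. B (f x) (g x))"
  by (simp add: smooth_on_def Ck_on_bilinear)

lemmas smooth_on_scaleR = smooth_on_bilinear[OF bounded_bilinear_scaleR]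
lemmas smooth_on_mult = smooth_on_bilinear[OF bounded_bilinear_mult]

lemma smooth_on_prod:
  fixes f :: "'i \<Rightarrow> 'a::real_normed_vector \<Rightarrow> real"
  assumes "open S" "\<And>i. i \<in> A \<Longrightarrow> smooth_on S (f i)"
  shows "smooth_on S (\<lambda>x. \<Prod>i\<in>A. f i x)"
  using assms(2)
  by (induction A rule: infinite_finite_induct) (auto intro!: smooth_on_mult assms(1) smooth_on_const)

lemma smooth_on_compose:
  fixes f :: "'a::real_normed_vector \<Rightarrow> 'b::euclidean_space" and g :: "'b \<Rightarrow> 'c::real_normed_vector"
  assumes "open S" "open T" "smooth_on S f" "smooth_on T g" "f ` S \<subseteq> T"
  shows "smooth_on S (\<lambda>x. g (f x))"
  using assms Ck_on_compose[of S T _ f g] by (simp add: smooth_on_def)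

lemma smooth_on_Pair:
  assumes "open S" "smooth_on S f" "smooth_on S g"
  shows "smooth_on S (\<lambda>x. (f x, g x))"
proof -
  have "smooth_on S (\<lambda>x. (f x, 0) + (0, g x))"
    by (intro smooth_on_add smooth_on_linear_compose[of "\<lambda>a. (a, 0)"]
        smooth_on_linear_compose[of "\<lambda>a. (0, a)"] assms bounded_linear_Pair
        bounded_linear_ident bounded_linear_zero)
  then show ?thesis by simp
qed

lemma smooth_on_fd: "smooth_on S f \<Longrightarrow> smooth_on S (\<lambda>x. fd f x v)"
  unfolding smooth_on_def using Ck_on.simps(2) by blast

lemma linear_fd: "smooth_on S f \<Longrightarrow> x \<in> S \<Longrightarrow> linear (fd f x)"
  using linear_frechet_derivative smooth_on_differentiable by blast

lemma fd_basis_expansion: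
  fixes f :: "'a::euclidean_space \<Rightarrow> 'b::real_normed_vector"
  assumes "linear (fd f x)"
  shows "fd f x v = (\<Sum>b\<in>Basis. (v \<bullet> b) *\<^sub>R fd f x b)"
proof -
  have "fd f x v = fd f x (\<Sum>b\<in>Basis. (v \<bullet> b) *\<^sub>R b)" by (simp add: euclidean_representation)
  then show ?thesis by (simp only: linear_sum[OF assms] linear_scale[OF assms])
qed

text \<open>A directional derivative in a direction that varies with the point, through the expansion of
  the direction in a basis.\<close>

lemma smooth_on_fd_apply:
  fixes f :: "'b::euclidean_space \<Rightarrow> 'c::real_normed_vector"
    and u :: "'a::real_normed_vector \<Rightarrow> 'b"
  assumes "open S" "open T" "smooth_on T f" "smooth_on S u" "smooth_on S w" "u ` S \<subseteq> T"
  shows "smooth_on S (\<lambda>x. fd f (u x) (w x))"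
proof (rule smooth_on_cong[OF assms(1)])
  show "smooth_on S (\<lambda>x. \<Sum>b\<in>Basis. (w x \<bullet> b) *\<^sub>R fd f (u x) b)"
    by (intro smooth_on_sum smooth_on_scaleR smooth_on_linear_compose[OF bounded_linear_inner_left]
        smooth_on_compose[OF assms(1,2,4) _ assms(6)] smooth_on_fd assms)
  show "(\<Sum>b\<in>Basis. (w y \<bullet> b) *\<^sub>R fd f (u y) b) = fd f (u y) (w y)" if "y \<in> S" for y
    using fd_basis_expansion[OF linear_fd[OF assms(3), of "u y"], of "w y"] assms(6) that by auto
qed

lemma Ck_on_inverse:
  fixes f :: "'a::real_normed_vector \<Rightarrow> real"
  assumes S: "open S" and "Ck_on k S f" and nz: "\<And>x. x \<in> S \<Longrightarrow> f x \<noteq> 0"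
  shows "Ck_on k S (\<lambda>x. inverse (f x))"
  using assms(2)
proof (induction k)
  case 0
  then show ?case using nz by (auto intro: continuous_on_inverse)
next
  case (Suc k)
  have der: "((\<lambda>x. inverse (f x)) has_derivative (\<lambda>v. - (inverse (f x) * fd f x v * inverse (f x)))) (at x)"
    if "x \<in> S" for x
    by (rule Deriv.has_derivative_inverse[of f, OF nz[OF that] has_derivative_fd]) (use Suc.prems that in auto)
  have "Ck_on k S f" using Suc.prems Ck_on_SucD by blast
  then have IH: "Ck_on k S (\<lambda>x. inverse (f x))" using Suc.IH by blast
  have "Ck_on k S (\<lambda>x. fd (\<lambda>x. inverse (f x)) x v)" for v
  proof (rule Ck_on_cong[OF S])
    show "Ck_on k S (\<lambda>x. - (inverse (f x) * fd f x v * inverse (f x)))"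
      by (intro Ck_on_linear_compose[OF bounded_linear_minus[OF bounded_linear_ident]]
          Ck_on_bilinear[OF bounded_bilinear_mult] S IH) (use Suc.prems in auto)
    show "- (inverse (f y) * fd f y v * inverse (f y)) = fd (\<lambda>x. inverse (f x)) y v" if "y \<in> S" for y
      using fd_eqI[OF der[OF that]] by simp
  qed
  then show ?case using der unfolding Ck_on.simps differentiable_def by blast
qed

lemma smooth_on_divide:
  fixes f :: "'a::real_normed_vector \<Rightarrow> real"
  assumes "open S" "smooth_on S f" "smooth_on S g" "\<And>x. x \<in> S \<Longrightarrow> g x \<noteq> 0"
  shows "smooth_on S (\<lambda>x. f x / g x)"
  unfolding divide_inverse
  using assms Ck_on_inverse[of S _ g] by (intro smooth_on_mult) (auto simp: smooth_on_def)

lemma smooth_on_det: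
  fixes A :: "'a::real_normed_vector \<Rightarrow> real^'n^'n"
  assumes "open S" "\<And>i j. smooth_on S (\<lambda>x. A x $ i $ j)"
  shows "smooth_on S (\<lambda>x. det (A x))"
  unfolding det_def
  by (intro smooth_on_sum smooth_on_mult smooth_on_prod smooth_on_const assms)


lemma vector_derivative_eq_fd:
  fixes f :: "real \<Rightarrow> 'a::real_normed_vector"
  assumes "f differentiable (at t)"
  shows "vector_derivative f (at t) = fd f t 1"
  using frechet_derivative_eq_vector_derivative[OF assms] by simp

lemma smooth_on_vector_derivative:
  fixes f :: "real \<Rightarrow> 'a::real_normed_vector"
  assumes "open S" "smooth_on S f"
  shows "smooth_on S (\<lambda>t. vector_derivative f (at t))"
  by (rule smooth_on_cong[OF assms(1) smooth_on_fd[OF assms(2), of 1]])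
     (simp add: vector_derivative_eq_fd smooth_on_differentiable[OF assms(2)])

lemma smooth_on_has_vector_derivative:
  fixes f :: "real \<Rightarrow> 'a::real_normed_vector"
  assumes "smooth_on S f" "t \<in> S"
  shows "(f has_vector_derivative vector_derivative f (at t)) (at t)"
  using smooth_on_differentiable[OF assms] vector_derivative_works by blast

lemma has_vector_derivative_compose:
  fixes u :: "real \<Rightarrow> 'a::real_normed_vector"
  assumes "(u has_vector_derivative u') (at t)" "(f has_derivative f') (at (u t))"
  shows "((\<lambda>s. f (u s)) has_vector_derivative f' u') (at t)"
  using has_derivative_compose[OF assms(1)[unfolded has_vector_derivative_def] assms(2)]
    linear_scale[OF has_derivative_linear[OF assms(2)]]
  unfolding has_vector_derivative_def by simp

section \<open>Symmetry of second derivatives\<close>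

text \<open>The mean value theorem, applied first in the direction \<open>u\<close> and then in the direction \<open>v\<close> to
  the second difference of \<open>\<phi>\<close> over a small parallelogram, produces a value of
  \<open>\<partial>\<^sub>v \<partial>\<^sub>u \<phi>\<close> nearby. The second difference is symmetric in \<open>u\<close> and \<open>v\<close>, so shrinking the
  parallelogram shows that the derivatives commute.\<close>

lemma second_difference_mean_value:
  fixes \<phi> :: "'a::real_normed_vector \<Rightarrow> real"
  assumes d1: "\<And>z. z \<in> W \<Longrightarrow> \<phi> differentiable (at z)"
    and d2: "\<And>z. z \<in> W \<Longrightarrow> (\<lambda>z. fd \<phi> z u) differentiable (at z)"
    and h: "0 < h"
    and W: "\<And>s t. 0 \<le> s \<Longrightarrow> s \<le> h \<Longrightarrow> 0 \<le> t \<Longrightarrow> t \<le> h \<Longrightarrow> x + s *\<^sub>R u + t *\<^sub>R v \<in> W"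
  shows "\<exists>s t. 0 \<le> s \<and> s \<le> h \<and> 0 \<le> t \<and> t \<le> h \<and>
    \<phi> (x + h *\<^sub>R u + h *\<^sub>R v) - \<phi> (x + h *\<^sub>R u) - \<phi> (x + h *\<^sub>R v) + \<phi> x
      = h * h * fd (\<lambda>z. fd \<phi> z u) (x + s *\<^sub>R u + t *\<^sub>R v) v"
proof -
  have der1: "((\<lambda>s. \<phi> (x + s *\<^sub>R u + t *\<^sub>R v)) has_real_derivative fd \<phi> (x + s *\<^sub>R u + t *\<^sub>R v) u) (at s)"
    if "0 \<le> s" "s \<le> h" "0 \<le> t" "t \<le> h" for s t
  proof -
    have "((\<lambda>s. x + s *\<^sub>R u + t *\<^sub>R v) has_vector_derivative u) (at s)"
      by (auto intro!: derivative_eq_intros)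
    from has_vector_derivative_compose[OF this has_derivative_fd[OF d1[OF W[OF that]]]]
    show ?thesis by (simp add: has_real_derivative_iff_has_vector_derivative)
  qed
  have "\<exists>s. 0 < s \<and> s < h \<and>
      (\<phi> (x + h *\<^sub>R u + h *\<^sub>R v) - \<phi> (x + h *\<^sub>R u + 0 *\<^sub>R v))
      - (\<phi> (x + 0 *\<^sub>R u + h *\<^sub>R v) - \<phi> (x + 0 *\<^sub>R u + 0 *\<^sub>R v))
      = (h - 0) * (fd \<phi> (x + s *\<^sub>R u + h *\<^sub>R v) u - fd \<phi> (x + s *\<^sub>R u + 0 *\<^sub>R v) u)"
    by (rule MVT2[OF h, of "\<lambda>s. \<phi> (x + s *\<^sub>R u + h *\<^sub>R v) - \<phi> (x + s *\<^sub>R u + 0 *\<^sub>R v)"])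
       (intro DERIV_diff der1, use h in auto)
  then obtain s where s: "0 < s" "s < h"
    and eq1: "\<phi> (x + h *\<^sub>R u + h *\<^sub>R v) - \<phi> (x + h *\<^sub>R u) - \<phi> (x + h *\<^sub>R v) + \<phi> x
      = h * (fd \<phi> (x + s *\<^sub>R u + h *\<^sub>R v) u - fd \<phi> (x + s *\<^sub>R u + 0 *\<^sub>R v) u)"
    by auto
  have der2: "((\<lambda>t. fd \<phi> (x + s *\<^sub>R u + t *\<^sub>R v) u) has_real_derivative
      fd (\<lambda>z. fd \<phi> z u) (x + s *\<^sub>R u + t *\<^sub>R v) v) (at t)" if "0 \<le> t" "t \<le> h" for t
  proof -
    have "x + s *\<^sub>R u + t *\<^sub>R v \<in> W" using W s that by simp
    note d = has_derivative_fd[OF d2[OF this]]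
    have "((\<lambda>t. x + s *\<^sub>R u + t *\<^sub>R v) has_vector_derivative v) (at t)"
      by (auto intro!: derivative_eq_intros)
    from has_vector_derivative_compose[OF this d]
    show ?thesis by (simp add: has_real_derivative_iff_has_vector_derivative)
  qed
  obtain t where t: "0 < t" "t < h"
    and eq2: "fd \<phi> (x + s *\<^sub>R u + h *\<^sub>R v) u - fd \<phi> (x + s *\<^sub>R u + 0 *\<^sub>R v) u
      = (h - 0) * fd (\<lambda>z. fd \<phi> z u) (x + s *\<^sub>R u + t *\<^sub>R v) v"
    using MVT2[OF h, of "\<lambda>t. fd \<phi> (x + s *\<^sub>R u + t *\<^sub>R v) u"
        "\<lambda>t. fd (\<lambda>z. fd \<phi> z u) (x + s *\<^sub>R u + t *\<^sub>R v) v"] der2 by blast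
  show ?thesis
    by (rule exI[of _ s], rule exI[of _ t]) (use s t eq1 eq2 in simp)
qed

lemma second_derivative_symmetric_real:
  fixes \<phi> :: "'a::real_normed_vector \<Rightarrow> real"
  assumes S: "open S" and x: "x \<in> S" and sm: "smooth_on S \<phi>"
  shows "fd (\<lambda>z. fd \<phi> z u) x v = fd (\<lambda>z. fd \<phi> z v) x u"
proof -
  let ?A = "\<lambda>z. fd (\<lambda>z. fd \<phi> z u) z v" and ?B = "\<lambda>z. fd (\<lambda>z. fd \<phi> z v) z u"
  have cA: "isCont ?A x" and cB: "isCont ?B x"
    using smooth_on_continuous_on[OF smooth_on_fd[OF smooth_on_fd[OF sm]]] S x
    by (auto simp: continuous_on_eq_continuous_at)
  have "\<bar>?A x - ?B x\<bar> \<le> e" if e: "e > 0" for e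
  proof -
    obtain d1 where d1: "d1 > 0" "\<And>z. dist z x < d1 \<Longrightarrow> \<bar>?A z - ?A x\<bar> < e/2"
      using cA e unfolding continuous_at_eps_delta dist_real_def by (metis half_gt_zero)
    obtain d2 where d2: "d2 > 0" "\<And>z. dist z x < d2 \<Longrightarrow> \<bar>?B z - ?B x\<bar> < e/2"
      using cB e unfolding continuous_at_eps_delta dist_real_def by (metis half_gt_zero)
    obtain d3 where d3: "d3 > 0" "ball x d3 \<subseteq> S" using S x openE by blast
    define d where "d = min d1 (min d2 d3)"
    have d: "d > 0" using d1 d2 d3 by (simp add: d_def)
    define h where "h = d / (norm u + norm v + 1)"
    have pos: "norm u + norm v + 1 > 0" by (smt (verit) norm_ge_zero)
    have h: "h > 0" using d pos by (simp add: h_def)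
    have near: "dist (x + s *\<^sub>R u + t *\<^sub>R v) x < d" if "0 \<le> s" "s \<le> h" "0 \<le> t" "t \<le> h" for s t
    proof -
      have "dist (x + s *\<^sub>R u + t *\<^sub>R v) x \<le> s * norm u + t * norm v"
        using norm_triangle_ineq[of "s *\<^sub>R u" "t *\<^sub>R v"] that by (simp add: dist_norm algebra_simps)
      also have "\<dots> \<le> h * norm u + h * norm v"
        by (intro add_mono mult_right_mono) (use that in auto)
      also have "\<dots> < h * (norm u + norm v + 1)" using h by (simp add: algebra_simps)
      also have "\<dots> = d" using pos by (simp add: h_def)
      finally show ?thesis .
    qed
    have dd: "\<phi> differentiable (at z)" "(\<lambda>z. fd \<phi> z w) differentiable (at z)" if "z \<in> S" for z w
      using smooth_on_differentiable[OF sm that] smooth_on_differentiable[OF smooth_on_fd[OF sm] that]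
      by auto
    have inS: "z \<in> S" if "dist z x < d" for z
      using that d3 by (auto simp: d_def dist_commute subset_iff)
    obtain s t where st: "0 \<le> s" "s \<le> h" "0 \<le> t" "t \<le> h"
      "\<phi> (x + h *\<^sub>R u + h *\<^sub>R v) - \<phi> (x + h *\<^sub>R u) - \<phi> (x + h *\<^sub>R v) + \<phi> x
        = h * h * ?A (x + s *\<^sub>R u + t *\<^sub>R v)"
      using second_difference_mean_value[of S \<phi> u h x v, OF dd h] inS near by blast
    have near': "dist (x + s *\<^sub>R v + t *\<^sub>R u) x < d" if "0 \<le> s" "s \<le> h" "0 \<le> t" "t \<le> h" for s t
      using near[OF that(3,4,1,2)] by (simp add: algebra_simps)
    obtain s' t' where st': "0 \<le> s'" "s' \<le> h" "0 \<le> t'" "t' \<le> h"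
      "\<phi> (x + h *\<^sub>R v + h *\<^sub>R u) - \<phi> (x + h *\<^sub>R v) - \<phi> (x + h *\<^sub>R u) + \<phi> x
        = h * h * ?B (x + s' *\<^sub>R v + t' *\<^sub>R u)"
      using second_difference_mean_value[of S \<phi> v h x u, OF dd h] inS near' by blast
    have "h * h * ?A (x + s *\<^sub>R u + t *\<^sub>R v) = h * h * ?B (x + s' *\<^sub>R v + t' *\<^sub>R u)"
      using st(5) st'(5) by (simp add: algebra_simps)
    then have "?A (x + s *\<^sub>R u + t *\<^sub>R v) = ?B (x + s' *\<^sub>R v + t' *\<^sub>R u)" using h by simp
    moreover have "\<bar>?A (x + s *\<^sub>R u + t *\<^sub>R v) - ?A x\<bar> < e/2"
      using d1(2) near[OF st(1-4)] by (simp add: d_def)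
    moreover have "\<bar>?B (x + s' *\<^sub>R v + t' *\<^sub>R u) - ?B x\<bar> < e/2"
      using d2(2) near'[OF st'(1-4)] by (simp add: d_def)
    ultimately show ?thesis by linarith
  qed
  then have "\<bar>?A x - ?B x\<bar> \<le> 0" by (rule field_le_epsilon) auto
  then show ?thesis by simp
qed

lemma fd_linear_compose:
  assumes "bounded_linear L" "f differentiable (at x)"
  shows "fd (\<lambda>x. L (f x)) x v = L (fd f x v)"
  using fd_eqI[OF bounded_linear.has_derivative[OF assms(1) has_derivative_fd[OF assms(2)]]] by simp

lemma second_derivative_symmetric:
  fixes f :: "'a::real_normed_vector \<Rightarrow> 'b::euclidean_space"
  assumes S: "open S" and x: "x \<in> S" and sm: "smooth_on S f"
  shows "fd (\<lambda>z. fd f z u) x v = fd (\<lambda>z. fd f z v) x u"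
proof (rule euclidean_eqI)
  fix b :: 'b assume "b \<in> Basis"
  note L = bounded_linear_inner_left[of b]
  have *: "fd (\<lambda>z. fd f z u) x v \<bullet> b = fd (\<lambda>z. fd (\<lambda>z. f z \<bullet> b) z u) x v" for u v
  proof -
    have "fd (\<lambda>z. fd f z u) x v \<bullet> b = fd (\<lambda>z. fd f z u \<bullet> b) x v"
      using fd_linear_compose[OF L smooth_on_differentiable[OF smooth_on_fd[OF sm] x]] by simp
    also have "\<dots> = fd (\<lambda>z. fd (\<lambda>z. f z \<bullet> b) z u) x v"
      using fd_cong[OF S x, of "\<lambda>z. fd f z u \<bullet> b" "\<lambda>z. fd (\<lambda>z. f z \<bullet> b) z u"]
        fd_linear_compose[OF L smooth_on_differentiable[OF sm]] by simp
    finally show ?thesis .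
  qed
  show "fd (\<lambda>z. fd f z u) x v \<bullet> b = fd (\<lambda>z. fd f z v) x u \<bullet> b"
    unfolding * by (rule second_derivative_symmetric_real[OF S x smooth_on_linear_compose[OF L S sm]])
qed

section \<open>Local solutions of smooth ordinary differential equations\<close>

lemma smooth_imp_lipschitz_on_cball:
  fixes F :: "'a::euclidean_space \<Rightarrow> 'b::real_normed_vector"
  assumes sm: "smooth_on W F" and sub: "cball z r \<subseteq> W"
  shows "\<exists>K\<ge>0. \<forall>x\<in>cball z r. \<forall>y\<in>cball z r. norm (F x - F y) \<le> K * norm (x - y)"
proof -
  have "\<exists>B. \<forall>x\<in>cball z r. norm (fd F x b) \<le> B" for b
  proof -
    have "continuous_on (cball z r) (\<lambda>x. fd F x b)"
      using smooth_on_continuous_on[OF smooth_on_fd[OF sm]] sub continuous_on_subset by blast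
    then have "bounded ((\<lambda>x. fd F x b) ` cball z r)"
      by (intro compact_imp_bounded compact_continuous_image) auto
    then show ?thesis unfolding bounded_iff by auto
  qed
  then obtain B where B: "\<And>b x. x \<in> cball z r \<Longrightarrow> norm (fd F x b) \<le> B b" by metis
  define K where "K = (\<Sum>b\<in>Basis. \<bar>B b\<bar>)"
  have "norm (fd F x v) \<le> K * norm v" if x: "x \<in> cball z r" for x v
  proof -
    have "norm (fd F x v) \<le> (\<Sum>b\<in>Basis. norm ((v \<bullet> b) *\<^sub>R fd F x b))"
      unfolding fd_basis_expansion[OF linear_fd[OF sm subsetD[OF sub x]], of v] by (rule norm_sum)
    also have "\<dots> \<le> (\<Sum>b\<in>Basis. \<bar>B b\<bar> * norm v)"
    proof (rule sum_mono)
      fix b :: 'a assume "b \<in> Basis"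
      have "norm ((v \<bullet> b) *\<^sub>R fd F x b) = \<bar>v \<bullet> b\<bar> * norm (fd F x b)" by simp
      also have "\<dots> \<le> norm v * \<bar>B b\<bar>"
        by (rule mult_mono[OF Basis_le_norm[OF \<open>b \<in> Basis\<close>]]) (use B[OF x, of b] in auto)
      finally show "norm ((v \<bullet> b) *\<^sub>R fd F x b) \<le> \<bar>B b\<bar> * norm v" by (simp add: mult.commute)
    qed
    finally show ?thesis by (simp add: K_def sum_distrib_right)
  qed
  then have on: "onorm (fd F x) \<le> K" if "x \<in> cball z r" for x
    using that by (intro onorm_le)
  have "norm (F x - F y) \<le> K * norm (x - y)" if "x \<in> cball z r" "y \<in> cball z r" for x y
  proof (rule differentiable_bound[OF convex_cball _ on that])
    show "(F has_derivative fd F x) (at x within cball z r)" if "x \<in> cball z r" for x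
      using smooth_on_has_derivative[OF sm] sub that has_derivative_at_withinI by blast
  qed auto
  moreover have "K \<ge> 0" by (simp add: K_def sum_nonneg)
  ultimately show ?thesis by blast
qed

text \<open>The theorem of Picard and Lindeloef in a global form: the contraction principle is applied to the
  integral equation on bounded continuous functions on the whole line, where the integral is frozen
  outside of \<open>[-\<epsilon>, \<epsilon>]\<close>.\<close>

lemma picard_lindeloef_bounded:
  fixes F :: "'a::euclidean_space \<Rightarrow> 'a"
  assumes lip: "\<And>x y. norm (F x - F y) \<le> K * norm (x - y)"
    and bd: "\<And>x. norm (F x) \<le> M"
    and e: "\<epsilon> > 0" "8 * \<epsilon> * K \<le> 1"
  shows "\<exists>u. u 0 = z0 \<and> (\<forall>t\<in>{-\<epsilon><..<\<epsilon>}. norm (u t - z0) \<le> 4 * \<epsilon> * M \<and>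
           (u has_vector_derivative F (u t)) (at t))"
proof -
  have K: "K \<ge> 0"
  proof -
    obtain b :: 'a where "b \<in> Basis" using nonempty_Basis by blast
    then have "norm (F b - F 0) \<le> K" using lip[of b 0] by simp
    then show ?thesis using norm_ge_zero order_trans by blast
  qed
  have M: "M \<ge> 0" using bd[of 0] norm_ge_zero order_trans by blast
  have cF: "continuous_on UNIV F"
    by (rule lipschitz_on_continuous_on[of K]) (use lip K in \<open>auto simp: lipschitz_on_def dist_norm\<close>)
  define J where "J u s = integral {-\<epsilon>..s} (\<lambda>s. F (u s))" for u :: "real \<Rightarrow> 'a" and s
  \<comment> \<open>Freezing the time makes \<open>P u\<close> bounded and continuous on the whole line. The integrals start at
    \<open>-\<epsilon>\<close> instead of \<open>0\<close> so that only positively oriented intervals occur.\<close>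
  define \<tau> where "\<tau> t = max (-\<epsilon>) (min \<epsilon> t)" for t
  have \<tau>: "\<tau> t \<in> {-\<epsilon>..\<epsilon>}" for t using e by (auto simp: \<tau>_def)
  have c\<tau>: "continuous_on UNIV \<tau>" unfolding \<tau>_def by (intro continuous_intros)
  have cFu: "continuous_on S (\<lambda>s. F (apply_bcontfun u s))" for u :: "real \<Rightarrow>\<^sub>C 'a" and S
    by (rule continuous_on_compose2[OF cF]) auto
  have iFu: "(\<lambda>s. F (apply_bcontfun u s)) integrable_on {a..b}" for u :: "real \<Rightarrow>\<^sub>C 'a" and a b
    by (rule integrable_continuous_real[OF cFu])
  have cJ: "continuous_on {-\<epsilon>..\<epsilon>} (J (apply_bcontfun u))" for u :: "real \<Rightarrow>\<^sub>C 'a"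
    unfolding J_def by (rule indefinite_integral_continuous_1[OF iFu])
  have Jb: "norm (J (apply_bcontfun u) s) \<le> 2 * \<epsilon> * M" if "s \<in> {-\<epsilon>..\<epsilon>}" for u :: "real \<Rightarrow>\<^sub>C 'a" and s
  proof -
    have "norm (J (apply_bcontfun u) s) \<le> M * (s - (-\<epsilon>))" unfolding J_def
      by (rule integral_bound) (use that bd cFu in auto)
    also have "\<dots> \<le> M * (2 * \<epsilon>)" by (rule mult_left_mono) (use that M in auto)
    finally show ?thesis by (simp add: algebra_simps)
  qed
  have Jl: "norm (J (apply_bcontfun u) s - J (apply_bcontfun v) s) \<le> 2 * \<epsilon> * K * dist u v"
    if "s \<in> {-\<epsilon>..\<epsilon>}" for u v :: "real \<Rightarrow>\<^sub>C 'a" and s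
  proof -
    have "J (apply_bcontfun u) s - J (apply_bcontfun v) s
        = integral {-\<epsilon>..s} (\<lambda>s. F (apply_bcontfun u s) - F (apply_bcontfun v s))"
      unfolding J_def using integral_diff[OF iFu iFu] by metis
    moreover have "norm (integral {-\<epsilon>..s} (\<lambda>s. F (apply_bcontfun u s) - F (apply_bcontfun v s)))
        \<le> (K * dist u v) * (s - (-\<epsilon>))"
    proof (rule integral_bound)
      show "norm (F (apply_bcontfun u t) - F (apply_bcontfun v t)) \<le> K * dist u v" for t
        using lip[of "apply_bcontfun u t" "apply_bcontfun v t"] dist_bounded[of u t v] K
        by (simp add: dist_norm) (meson mult_left_mono order_trans)
      show "continuous_on {-\<epsilon>..s} (\<lambda>s. F (apply_bcontfun u s) - F (apply_bcontfun v s))"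
        by (intro continuous_on_diff cFu)
    qed (use that in auto)
    moreover have "(K * dist u v) * (s - (-\<epsilon>)) \<le> (K * dist u v) * (2 * \<epsilon>)"
      by (rule mult_left_mono) (use that K in auto)
    ultimately show ?thesis by (simp add: algebra_simps)
  qed
  define P where "P u t = z0 + (J (apply_bcontfun u) (\<tau> t) - J (apply_bcontfun u) 0)"
    for u :: "real \<Rightarrow>\<^sub>C 'a" and t
  have z: "0 \<in> {-\<epsilon>..\<epsilon>}" using e by auto
  have Pb: "norm (P u t - z0) \<le> 4 * \<epsilon> * M" for u t
    unfolding P_def
    using norm_triangle_ineq4[of "J (apply_bcontfun u) (\<tau> t)" "J (apply_bcontfun u) 0"]
      Jb[OF \<tau>, of u t] Jb[OF z, of u] by simp
  have Pc: "P u \<in> bcontfun" for u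
  proof (rule bcontfun_normI)
    have "continuous_on UNIV (\<lambda>t. J (apply_bcontfun u) (\<tau> t))"
      by (rule continuous_on_compose2[OF cJ c\<tau>]) (use \<tau> in auto)
    then show "continuous_on UNIV (P u)" unfolding P_def by (intro continuous_intros)
    show "norm (P u t) \<le> norm z0 + 4 * \<epsilon> * M" for t
      using Pb[of u t] norm_triangle_ineq[of z0 "P u t - z0"] by simp
  qed
  have "dist (Bcontfun (P u)) (Bcontfun (P v)) \<le> 1/2 * dist u v" for u v
  proof (rule dist_bound)
    fix t
    have "P u t - P v t = (J (apply_bcontfun u) (\<tau> t) - J (apply_bcontfun v) (\<tau> t))
        - (J (apply_bcontfun u) 0 - J (apply_bcontfun v) 0)" by (simp add: P_def)
    then have "norm (P u t - P v t) \<le> 2 * \<epsilon> * K * dist u v + 2 * \<epsilon> * K * dist u v"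
      using norm_triangle_ineq4[of "J (apply_bcontfun u) (\<tau> t) - J (apply_bcontfun v) (\<tau> t)"
          "J (apply_bcontfun u) 0 - J (apply_bcontfun v) 0"] Jl[OF \<tau>, of u t v] Jl[OF z, of u v]
      by (simp only:)
    also have "\<dots> = 4 * \<epsilon> * K * dist u v" by simp
    also have "\<dots> \<le> 1/2 * dist u v" by (rule mult_right_mono) (use e in auto)
    finally show "dist (apply_bcontfun (Bcontfun (P u)) t) (apply_bcontfun (Bcontfun (P v)) t) \<le> 1/2 * dist u v"
      by (simp add: Bcontfun_inverse[OF Pc] dist_norm)
  qed
  then obtain u where fp: "Bcontfun (P u) = u"
    using banach_fix_type[of "1/2" "\<lambda>u. Bcontfun (P u)"] by auto
  have u: "apply_bcontfun u = P u" using Bcontfun_inverse[OF Pc, of u] fp by simp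
  have u0: "P u 0 = z0" using e by (simp add: P_def \<tau>_def)
  have "(P u has_vector_derivative F (P u t)) (at t)" if t: "t \<in> {-\<epsilon><..<\<epsilon>}" for t
  proof -
    have "(J (P u) has_vector_derivative F (P u t)) (at t within {-\<epsilon>..\<epsilon>})"
      unfolding J_def using integral_has_vector_derivative[OF cFu[of "{-\<epsilon>..\<epsilon>}" u], of t] t
      by (simp add: u)
    then have "(J (P u) has_vector_derivative F (P u t)) (at t)"
      using t at_within_Icc_at[of "-\<epsilon>" t \<epsilon>] by simp
    then have "((\<lambda>t. z0 + (J (P u) t - J (P u) 0)) has_vector_derivative F (P u t)) (at t)"
      by (auto intro!: derivative_eq_intros)
    then show ?thesis
      by (rule has_vector_derivative_transform_within_open[of _ _ _ "{-\<epsilon><..<\<epsilon>}"])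
         (use t in \<open>auto simp: P_def u \<tau>_def\<close>)
  qed
  then show ?thesis using u0 Pb by (intro exI[of _ "P u"]) auto
qed

lemma has_vector_derivative_imp_fd:
  fixes u :: "real \<Rightarrow> 'a::real_normed_vector"
  assumes "(u has_vector_derivative u') (at t)"
  shows "u differentiable (at t)" "fd u t = (\<lambda>s. s *\<^sub>R u')"
  using assms fd_eqI unfolding has_vector_derivative_def differentiable_def by blast+

text \<open>A solution is as smooth as the equation: if \<open>u\<close> is of class \<open>C\<^sup>k\<close>, so is \<open>u' = F \<circ> u\<close>.\<close>

lemma ode_solution_smooth:
  fixes F :: "'a::euclidean_space \<Rightarrow> 'a"
  assumes "open J" "open W" "smooth_on W F"
    and u: "\<And>t. t \<in> J \<Longrightarrow> u t \<in> W \<and> (u has_vector_derivative F (u t)) (at t)"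
  shows "smooth_on J u"
proof -
  have d1: "u differentiable (at t)" and d2: "fd u t = (\<lambda>s. s *\<^sub>R F (u t))" if "t \<in> J" for t
    using has_vector_derivative_imp_fd u[OF that] by blast+
  have uW: "u ` J \<subseteq> W" using u by blast
  have "Ck_on k J u" for k
  proof (induction k)
    case 0
    have "isCont u t" if "t \<in> J" for t
      using d1[OF that] by (rule differentiable_imp_continuous_within)
    then show ?case by (simp add: continuous_at_imp_continuous_on)
  next
    case (Suc k)
    have "Ck_on k W F" using assms(3) by (simp only: smooth_on_def)
    then have "Ck_on k J (\<lambda>t. F (u t))"
      using Ck_on_compose[OF assms(1,2) Suc _ uW] by blast
    then have "Ck_on k J (\<lambda>t. s *\<^sub>R F (u t))" for s
      by (rule Ck_on_linear_compose[OF bounded_linear_scaleR_right \<open>open J\<close>])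
    then have "Ck_on k J (\<lambda>t. fd u t s)" for s
      using Ck_on_cong[OF \<open>open J\<close>, of "\<lambda>t. s *\<^sub>R F (u t)" "\<lambda>t. fd u t s"] d2 by metis
    then show ?case using d1 by simp
  qed
  then show ?thesis by (simp add: smooth_on_def)
qed

lemma ode_solution_exists:
  fixes F :: "'a::euclidean_space \<Rightarrow> 'a"
  assumes W: "open W" and sm: "smooth_on W F" and z0: "z0 \<in> W"
  shows "\<exists>\<epsilon>>0. \<exists>u. u 0 = z0 \<and> smooth_on {-\<epsilon><..<\<epsilon>} u \<and>
    (\<forall>t\<in>{-\<epsilon><..<\<epsilon>}. u t \<in> W \<and> (u has_vector_derivative F (u t)) (at t))"
proof -
  obtain r where r: "r > 0" "cball z0 r \<subseteq> W" using open_contains_cball W z0 by blast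
  obtain K where K: "K \<ge> 0"
      "\<And>x y. x \<in> cball z0 r \<Longrightarrow> y \<in> cball z0 r \<Longrightarrow> norm (F x - F y) \<le> K * norm (x - y)"
    using smooth_imp_lipschitz_on_cball[OF sm r(2)] by blast
  have "bounded (F ` cball z0 r)"
    using smooth_on_continuous_on[OF sm] r(2)
    by (intro compact_imp_bounded compact_continuous_image) (auto intro: continuous_on_subset)
  then obtain M where M: "M > 0" "\<And>x. x \<in> cball z0 r \<Longrightarrow> norm (F x) \<le> M"
    unfolding bounded_pos by auto
  \<comment> \<open>Composing with the nearest point projection onto the ball makes \<open>F\<close> globally Lipschitz and
    bounded; the solution does not leave the ball within the time \<open>\<epsilon>\<close>.\<close>
  define Q where "Q = closest_point (cball z0 r)"
  have Q: "Q x \<in> cball z0 r" for x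
    unfolding Q_def by (rule closest_point_in_set) (use r in auto)
  have Ql: "norm (Q x - Q y) \<le> norm (x - y)" for x y
    using closest_point_lipschitz[of "cball z0 r" x y] r by (auto simp: Q_def dist_norm)
  have Qi: "Q x = x" if "x \<in> cball z0 r" for x using that by (simp add: Q_def closest_point_self)
  define \<epsilon> where "\<epsilon> = min (1 / (8 * (K + 1))) (r / (4 * M))"
  have e: "\<epsilon> > 0" using r K M by (simp add: \<epsilon>_def)
  have eK: "8 * \<epsilon> * K \<le> 1"
  proof -
    have "8 * \<epsilon> * K \<le> 8 * (1 / (8 * (K + 1))) * K"
      by (intro mult_right_mono mult_left_mono) (use K in \<open>auto simp: \<epsilon>_def\<close>)
    also have "\<dots> \<le> 1" using K by simp
    finally show ?thesis .
  qed
  have eM: "4 * \<epsilon> * M \<le> r"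
  proof -
    have "4 * \<epsilon> * M \<le> 4 * (r / (4 * M)) * M"
      by (intro mult_right_mono mult_left_mono) (use M in \<open>auto simp: \<epsilon>_def\<close>)
    then show ?thesis using M by simp
  qed
  have "norm (F (Q x) - F (Q y)) \<le> K * norm (x - y)" for x y
    using K(2)[OF Q Q, of x y] mult_left_mono[OF Ql K(1), of x y] by simp
  moreover have "norm (F (Q x)) \<le> M" for x using M Q by simp
  ultimately obtain u where u: "u 0 = z0"
    "\<And>t. t \<in> {-\<epsilon><..<\<epsilon>} \<Longrightarrow> norm (u t - z0) \<le> 4 * \<epsilon> * M \<and> (u has_vector_derivative F (Q (u t))) (at t)"
    using picard_lindeloef_bounded[of "\<lambda>x. F (Q x)" K M \<epsilon> z0, OF _ _ e eK] by blast
  have "u t \<in> cball z0 r" if "t \<in> {-\<epsilon><..<\<epsilon>}" for t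
    using u(2)[OF that] eM by (simp add: dist_norm norm_minus_commute)
  then have sol: "u t \<in> W \<and> (u has_vector_derivative F (u t)) (at t)" if "t \<in> {-\<epsilon><..<\<epsilon>}" for t
    using u(2)[OF that] r(2) Qi that by auto
  show ?thesis
    using e u(1) sol ode_solution_smooth[OF open_greaterThanLessThan W sm sol]
    by (intro exI[of _ \<epsilon>] conjI exI[of _ u]) auto
qed

section \<open>Tangent vectors in coordinates\<close>

definition local_rep :: "('p, 'e) chart \<Rightarrow> ('q, 'f) chart \<Rightarrow> ('p \<Rightarrow> 'q) \<Rightarrow> 'e \<Rightarrow> 'f" where
  "local_rep \<kappa> \<mu> f = snd \<mu> \<circ> f \<circ> chart_inv \<kappa>"

lemma transition_eq_local_rep: "snd \<mu> \<circ> chart_inv \<kappa> = local_rep \<kappa> \<mu> id"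
  by (simp add: local_rep_def)

lemma chart_inv_snd: "smooth_atlas A \<Longrightarrow> \<kappa> \<in> A \<Longrightarrow> p \<in> fst \<kappa> \<Longrightarrow> chart_inv \<kappa> (snd \<kappa> p) = p"
  unfolding chart_inv_def smooth_atlas_def by simp

lemma local_rep_apply:
  "smooth_atlas A \<Longrightarrow> \<kappa> \<in> A \<Longrightarrow> p \<in> fst \<kappa> \<Longrightarrow> local_rep \<kappa> \<mu> f (snd \<kappa> p) = snd \<mu> (f p)"
  by (simp add: local_rep_def chart_inv_snd)

lemma smooth_local_rep:
  assumes "smooth_map A B f" "\<kappa> \<in> A" "\<mu> \<in> B"
  shows "open (snd \<kappa> ` (fst \<kappa> \<inter> f -` fst \<mu>))"
    and "smooth_on (snd \<kappa> ` (fst \<kappa> \<inter> f -` fst \<mu>)) (local_rep \<kappa> \<mu> f)"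
  using assms unfolding smooth_map_def local_rep_def by auto

lemma smooth_map_id:
  assumes "smooth_atlas A"
  shows "smooth_map A A id"
  unfolding smooth_map_def
proof (intro conjI ballI)
  fix \<kappa> \<mu> assume "\<kappa> \<in> A" "\<mu> \<in> A"
  then show "open (snd \<kappa> ` (fst \<kappa> \<inter> id -` fst \<mu>))"
    and "smooth_on (snd \<kappa> ` (fst \<kappa> \<inter> id -` fst \<mu>)) (snd \<mu> \<circ> id \<circ> chart_inv \<kappa>)"
    using assms unfolding smooth_atlas_def by simp_all
qed simp

lemma local_rep_diff:
  assumes "smooth_map A B f" "\<kappa> \<in> A" "\<mu> \<in> B" "p \<in> fst \<kappa>" "f p \<in> fst \<mu>"
  shows "local_rep \<kappa> \<mu> f differentiable (at (snd \<kappa> p))"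
  by (rule smooth_on_differentiable[OF smooth_local_rep(2)[OF assms(1-3)]]) (use assms in auto)

lemma open_chart_image:
  assumes "smooth_atlas A" "\<kappa> \<in> A"
  shows "open (snd \<kappa> ` fst \<kappa>)"
  using assms unfolding smooth_atlas_def by (metis Int_absorb)

lemma fd_chain:
  assumes "f differentiable (at x)" "g differentiable (at (f x))"
  shows "fd (\<lambda>y. g (f y)) x v = fd g (f x) (fd f x v)"
  using fd_eqI[OF has_derivative_compose[OF has_derivative_fd[OF assms(1)] has_derivative_fd[OF assms(2)]]]
  by simp

text \<open>The chain rule for coordinate expressions. It contains the independence of the tangent map of
  the chart, and, for identity maps, the cocycle property of the Jacobians.\<close>

lemma fd_local_rep_comp:
  assumes A: "smooth_atlas A" and B: "smooth_atlas B"
    and f: "smooth_map A B f" and g: "smooth_map B C g"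
    and ch: "\<kappa> \<in> A" "\<mu> \<in> B" "\<nu> \<in> C" "p \<in> fst \<kappa>" "f p \<in> fst \<mu>" "g (f p) \<in> fst \<nu>"
  shows "fd (local_rep \<kappa> \<nu> (g \<circ> f)) (snd \<kappa> p) v
    = fd (local_rep \<mu> \<nu> g) (snd \<mu> (f p)) (fd (local_rep \<kappa> \<mu> f) (snd \<kappa> p) v)"
proof -
  let ?S = "snd \<kappa> ` (fst \<kappa> \<inter> f -` fst \<mu>)"
  have eq: "local_rep \<kappa> \<mu> f (snd \<kappa> p) = snd \<mu> (f p)" using local_rep_apply[OF A] ch by blast
  have "fd (local_rep \<kappa> \<nu> (g \<circ> f)) (snd \<kappa> p)
      = fd (\<lambda>x. local_rep \<mu> \<nu> g (local_rep \<kappa> \<mu> f x)) (snd \<kappa> p)"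
  proof (rule fd_cong[OF smooth_local_rep(1)[OF f ch(1,2)]])
    fix x assume "x \<in> ?S"
    then obtain q where "q \<in> fst \<kappa>" "f q \<in> fst \<mu>" "x = snd \<kappa> q" by auto
    then show "local_rep \<kappa> \<nu> (g \<circ> f) x = local_rep \<mu> \<nu> g (local_rep \<kappa> \<mu> f x)"
      by (simp add: local_rep_apply[OF A ch(1)] local_rep_apply[OF B ch(2)])
  qed (use ch in auto)
  then show ?thesis
    using fd_chain[OF local_rep_diff[OF f ch(1,2,4,5)], of "local_rep \<mu> \<nu> g" v]
      local_rep_diff[OF g ch(2,3,5,6)] eq by simp
qed

lemma tangent_space_transform:
  assumes "v \<in> tangent_space A p" "\<kappa> \<in> A" "\<kappa>' \<in> A" "p \<in> fst \<kappa>" "p \<in> fst \<kappa>'"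
  shows "v \<kappa>' = fd (local_rep \<kappa> \<kappa>' id) (snd \<kappa> p) (v \<kappa>)"
  using assms unfolding tangent_space_def transition_eq_local_rep by blast

lemma tangent_space_outside: "v \<in> tangent_space A p \<Longrightarrow> \<kappa> \<notin> A \<or> p \<notin> fst \<kappa> \<Longrightarrow> v \<kappa> = 0"
  unfolding tangent_space_def by blast

lemma tangent_space_eqI:
  assumes "v \<in> tangent_space A p" "w \<in> tangent_space A p" "\<kappa> \<in> A" "p \<in> fst \<kappa>" "v \<kappa> = w \<kappa>"
  shows "v = w"
proof
  fix \<kappa>'
  show "v \<kappa>' = w \<kappa>'"
    using tangent_space_outside[of _ A p \<kappa>'] tangent_space_transform[of _ A p \<kappa> \<kappa>'] assms by metis
qed

text \<open>By the cocycle property it is enough to compare all charts with a single one.\<close>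

lemma tangent_spaceI:
  assumes A: "smooth_atlas A" and \<kappa>: "\<kappa> \<in> A" "p \<in> fst \<kappa>"
    and out: "\<And>\<mu>. \<mu> \<notin> A \<or> p \<notin> fst \<mu> \<Longrightarrow> v \<mu> = 0"
    and tr: "\<And>\<mu>. \<mu> \<in> A \<Longrightarrow> p \<in> fst \<mu> \<Longrightarrow> v \<mu> = fd (local_rep \<kappa> \<mu> id) (snd \<kappa> p) e"
  shows "v \<in> tangent_space A p"
proof -
  have "v \<nu> = fd (local_rep \<mu> \<nu> id) (snd \<mu> p) (v \<mu>)"
    if "\<mu> \<in> A" "\<nu> \<in> A" "p \<in> fst \<mu>" "p \<in> fst \<nu>" for \<mu> \<nu>
    using fd_local_rep_comp[OF A A smooth_map_id[OF A] smooth_map_id[OF A] \<kappa>(1) that(1,2) \<kappa>(2)] that tr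
    by simp
  then show ?thesis using out unfolding tangent_space_def transition_eq_local_rep by blast
qed

lemma fd_local_rep_id:
  assumes "smooth_atlas A" "\<kappa> \<in> A" "p \<in> fst \<kappa>"
  shows "fd (local_rep \<kappa> \<kappa> id) (snd \<kappa> p) v = v"
proof -
  have "fd (local_rep \<kappa> \<kappa> id) (snd \<kappa> p) = fd (\<lambda>x. x) (snd \<kappa> p)"
    by (rule fd_cong[OF open_chart_image[OF assms(1,2)]])
       (use assms in \<open>auto simp: local_rep_apply[OF assms(1,2)]\<close>)
  then show ?thesis by simp
qed

lemma tangent_vector_with_coordinates:
  assumes A: "smooth_atlas A" "\<kappa> \<in> A" "p \<in> fst \<kappa>"
  shows "\<exists>v\<in>tangent_space A p. v \<kappa> = e"
proof
  let ?v = "\<lambda>\<mu>. if \<mu> \<in> A \<and> p \<in> fst \<mu> then fd (local_rep \<kappa> \<mu> id) (snd \<kappa> p) e else 0"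
  show "?v \<in> tangent_space A p" by (rule tangent_spaceI[OF A, where e = e]) auto
  show "?v \<kappa> = e" using fd_local_rep_id[OF A] A by simp
qed

lemma tv_zero_in_tangent_space:
  assumes "smooth_atlas A"
  shows "tv_zero \<in> tangent_space A p"
proof -
  have "fd (local_rep \<kappa> \<mu> id) (snd \<kappa> p) 0 = 0" if "\<kappa> \<in> A" "\<mu> \<in> A" "p \<in> fst \<kappa>" "p \<in> fst \<mu>" for \<kappa> \<mu>
    using linear_0[OF linear_frechet_derivative[OF local_rep_diff[OF smooth_map_id[OF assms]]]] that by auto
  then show ?thesis unfolding tangent_space_def tv_zero_def transition_eq_local_rep by simp
qed

lemma tv_eq_zero_iff:
  assumes "smooth_atlas A" "v \<in> tangent_space A p" "\<kappa> \<in> A" "p \<in> fst \<kappa>"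
  shows "v = tv_zero \<longleftrightarrow> v \<kappa> = 0"
  using tangent_space_eqI[OF assms(2) tv_zero_in_tangent_space[OF assms(1)] assms(3,4)]
  by (auto simp: tv_zero_def)

lemma tangent_map_in_chart:
  assumes A: "smooth_atlas A" and f: "smooth_map A B f" and v: "v \<in> tangent_space A p"
    and ch: "\<kappa> \<in> A" "p \<in> fst \<kappa>" "\<mu> \<in> B" "f p \<in> fst \<mu>"
  shows "tangent_map A B f p v \<mu> = fd (local_rep \<kappa> \<mu> f) (snd \<kappa> p) (v \<kappa>)"
proof -
  let ?k = "SOME \<kappa>. \<kappa> \<in> A \<and> p \<in> fst \<kappa>"
  have k: "?k \<in> A" "p \<in> fst ?k" using someI[of "\<lambda>\<kappa>. \<kappa> \<in> A \<and> p \<in> fst \<kappa>" \<kappa>] ch by auto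
  have "tangent_map A B f p v \<mu> = fd (local_rep ?k \<mu> f) (snd ?k p) (v ?k)"
    using ch by (simp add: tangent_map_def Let_def local_rep_def)
  also have "v ?k = fd (local_rep \<kappa> ?k id) (snd \<kappa> p) (v \<kappa>)"
    using tangent_space_transform[OF v ch(1) k(1) ch(2) k(2)] .
  also have "fd (local_rep ?k \<mu> f) (snd ?k p) \<dots> = fd (local_rep \<kappa> \<mu> (f \<circ> id)) (snd \<kappa> p) (v \<kappa>)"
    using fd_local_rep_comp[OF A A smooth_map_id[OF A] f ch(1) k(1) ch(3,2)] k ch by simp
  finally show ?thesis by simp
qed

lemma tangent_map_in_tangent_space:
  assumes A: "smooth_atlas A" and B: "smooth_atlas B" and f: "smooth_map A B f"
    and v: "v \<in> tangent_space A p" and p: "p \<in> pts A"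
  shows "tangent_map A B f p v \<in> tangent_space B (f p)"
proof -
  obtain \<kappa> where k: "\<kappa> \<in> A" "p \<in> fst \<kappa>" using p unfolding pts_def by blast
  have "f p \<in> pts B" using f p by (auto simp: smooth_map_def)
  then obtain \<mu> where m: "\<mu> \<in> B" "f p \<in> fst \<mu>" unfolding pts_def by blast
  show ?thesis
  proof (rule tangent_spaceI[OF B m])
    show "tangent_map A B f p v \<nu> = 0" if "\<nu> \<notin> B \<or> f p \<notin> fst \<nu>" for \<nu>
      using that by (auto simp: tangent_map_def Let_def)
    fix \<nu> assume n: "\<nu> \<in> B" "f p \<in> fst \<nu>"
    show "tangent_map A B f p v \<nu> = fd (local_rep \<mu> \<nu> id) (snd \<mu> (f p)) (tangent_map A B f p v \<mu>)"
      using fd_local_rep_comp[OF A B f smooth_map_id[OF B] k(1) m(1) n(1) k(2) m(2)] n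
        tangent_map_in_chart[OF A f v k m] tangent_map_in_chart[OF A f v k n] by simp
  qed
qed

text \<open>The tangent map of a map between Euclidean spaces. It describes the coordinate changes of the
  tangent bundle as well as the effect of a map on velocity lifts.\<close>

definition prolong ::
  "('a::real_normed_vector \<Rightarrow> 'b::real_normed_vector) \<Rightarrow> 'a \<times> 'a \<Rightarrow> 'b \<times> 'b" where
  "prolong f = (\<lambda>(x, y). (f x, fd f x y))"

lemma smooth_on_prolong:
  fixes f :: "'a::euclidean_space \<Rightarrow> 'b::real_normed_vector"
  assumes "open S" "smooth_on S f"
  shows "smooth_on (S \<times> UNIV) (prolong f)"
proof -
  have o: "open (S \<times> (UNIV :: 'a set))" using assms by (simp add: open_Times)
  have "smooth_on (S \<times> UNIV) (\<lambda>z. (f (fst z), fd f (fst z) (snd z)))"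
    by (intro smooth_on_Pair o smooth_on_compose[OF o assms(1) _ assms(2)]
        smooth_on_fd_apply[OF o assms] smooth_on_linear bounded_linear_fst bounded_linear_snd) auto
  then show ?thesis by (simp add: prolong_def case_prod_unfold)
qed

text \<open>The product rule for the expansion of \<open>Df(x) y\<close> in a basis: \<open>x\<close> enters through the Jacobian, which
  gives a second derivative, and \<open>y\<close> linearly.\<close>

lemma fd_prolong:
  fixes f :: "'a::euclidean_space \<Rightarrow> 'b::real_normed_vector"
  assumes S: "open S" "smooth_on S f" "x \<in> S"
  shows "fd (prolong f) (x, y) (u, w) = (fd f x u, fd (\<lambda>z. fd f z y) x u + fd f x w)"
proof -
  have o: "open (S \<times> (UNIV :: 'a set))" using assms by (simp add: open_Times)
  have l: "linear (fd f z)" if "z \<in> S" for z using linear_fd[OF S(2) that] .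
  have d: "(fst has_derivative fst) (at (x,y))" "(snd has_derivative snd) (at (x,y))"
    using bounded_linear_imp_has_derivative bounded_linear_fst bounded_linear_snd by blast+
  have d1: "((\<lambda>z. f (fst z)) has_derivative (\<lambda>v. fd f x (fst v))) (at (x,y))"
    using has_derivative_compose[OF d(1), of f] smooth_on_has_derivative[OF S(2,3)] by simp
  have d2: "((\<lambda>z. fd f (fst z) b) has_derivative (\<lambda>v. fd (\<lambda>z. fd f z b) x (fst v))) (at (x,y))" for b
    using has_derivative_compose[OF d(1), of "\<lambda>z. fd f z b"]
      smooth_on_has_derivative[OF smooth_on_fd[OF S(2)] S(3)] by simp
  have "((\<lambda>z. \<Sum>b\<in>Basis. (snd z \<bullet> b) *\<^sub>R fd f (fst z) b) has_derivative
      (\<lambda>v. \<Sum>b\<in>Basis. (snd (x,y) \<bullet> b) *\<^sub>R fd (\<lambda>z. fd f z b) x (fst v) + (snd v \<bullet> b) *\<^sub>R fd f (fst (x,y)) b))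
      (at (x,y))"
    by (intro has_derivative_sum has_derivative_scaleR d2 has_derivative_inner_left d(2))
  moreover have "fd (\<lambda>z. fd f z y) x u' = (\<Sum>b\<in>Basis. (y \<bullet> b) *\<^sub>R fd (\<lambda>z. fd f z b) x u')" for u'
  proof -
    have "((\<lambda>z. \<Sum>b\<in>Basis. (y \<bullet> b) *\<^sub>R fd f z b) has_derivative
        (\<lambda>u. \<Sum>b\<in>Basis. (y \<bullet> b) *\<^sub>R fd (\<lambda>z. fd f z b) x u)) (at x)"
      by (intro has_derivative_sum has_derivative_scaleR_right smooth_on_has_derivative[OF smooth_on_fd[OF S(2)] S(3)])
    from fd_eqI[OF this] show ?thesis
      using fd_cong[OF S(1,3), of "\<lambda>z. fd f z y" "\<lambda>z. \<Sum>b\<in>Basis. (y \<bullet> b) *\<^sub>R fd f z b"]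
        fd_basis_expansion[OF l] by simp
  qed
  ultimately have "((\<lambda>z. \<Sum>b\<in>Basis. (snd z \<bullet> b) *\<^sub>R fd f (fst z) b) has_derivative
      (\<lambda>v. fd (\<lambda>z. fd f z y) x (fst v) + fd f x (snd v))) (at (x,y))"
    by (simp add: sum.distrib fd_basis_expansion[OF l[OF S(3)], of "snd _"])
  then have "((\<lambda>z. fd f (fst z) (snd z)) has_derivative
      (\<lambda>v. fd (\<lambda>z. fd f z y) x (fst v) + fd f x (snd v))) (at (x,y))"
  proof (rule has_derivative_transform_within_open[OF _ o])
    fix z assume "z \<in> S \<times> (UNIV :: 'a set)"
    then have "fst z \<in> S" by auto
    from fd_basis_expansion[OF l[OF this], of "snd z"]
    show "(\<Sum>b\<in>Basis. (snd z \<bullet> b) *\<^sub>R fd f (fst z) b) = fd f (fst z) (snd z)" by simp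
  qed (use S in auto)
  from has_derivative_Pair[OF d1 this]
  have "(prolong f has_derivative (\<lambda>v. (fd f x (fst v), fd (\<lambda>z. fd f z y) x (fst v) + fd f x (snd v)))) (at (x,y))"
    by (simp add: prolong_def case_prod_unfold)
  from fd_eqI[OF this] show ?thesis by simp
qed

lemma tchart_simps:
  "(p, v) \<in> fst (tchart A \<kappa>) \<longleftrightarrow> p \<in> fst \<kappa> \<and> v \<in> tangent_space A p"
  "snd (tchart A \<kappa>) (p, v) = (snd \<kappa> p, v \<kappa>)"
  by (auto simp: tchart_def)

lemma inj_on_tchart:
  assumes "smooth_atlas A" "\<kappa> \<in> A"
  shows "inj_on (snd (tchart A \<kappa>)) (fst (tchart A \<kappa>))"
proof (rule inj_onI)
  fix a b assume ab: "a \<in> fst (tchart A \<kappa>)" "b \<in> fst (tchart A \<kappa>)" "snd (tchart A \<kappa>) a = snd (tchart A \<kappa>) b"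
  obtain p v q w where e: "a = (p, v)" "b = (q, w)" by fastforce
  have "p = q" using ab assms by (auto simp: e tchart_simps smooth_atlas_def inj_on_def)
  then show "a = b" using ab tangent_space_eqI[of v A p w \<kappa>] assms by (simp add: e tchart_simps)
qed

lemma chart_inv_tchart:
  assumes "smooth_atlas A" "\<kappa> \<in> A" "p \<in> fst \<kappa>" "v \<in> tangent_space A p"
  shows "chart_inv (tchart A \<kappa>) (snd \<kappa> p, v \<kappa>) = (p, v)"
  unfolding chart_inv_def
  using inv_into_f_f[OF inj_on_tchart[OF assms(1,2)], of "(p, v)"] assms by (simp add: tchart_simps)

lemma tchart_image:
  assumes "smooth_atlas A" "\<kappa> \<in> A"
  shows "snd (tchart A \<kappa>) ` {(p, v). p \<in> fst \<kappa> \<inter> U \<and> v \<in> tangent_space A p} = snd \<kappa> ` (fst \<kappa> \<inter> U) \<times> UNIV"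
proof (intro equalityI subsetI)
  fix z assume "z \<in> snd \<kappa> ` (fst \<kappa> \<inter> U) \<times> (UNIV :: 'b set)"
  then obtain p e where p: "p \<in> fst \<kappa>" "p \<in> U" "z = (snd \<kappa> p, e)" by auto
  then obtain v where "v \<in> tangent_space A p" "v \<kappa> = e"
    using tangent_vector_with_coordinates[OF assms] by blast
  then show "z \<in> snd (tchart A \<kappa>) ` {(p, v). p \<in> fst \<kappa> \<inter> U \<and> v \<in> tangent_space A p}"
    using p by (intro image_eqI[of _ _ "(p, v)"]) (auto simp: tchart_simps)
qed (auto simp: tchart_simps)

text \<open>Two coordinate vectors of the same tangent vector are related by the Jacobian, so the coordinate
  changes of the tangent bundle are the prolongations of those of the manifold.\<close>

lemma local_rep_tchart:
  assumes A: "smooth_atlas A" "\<kappa> \<in> A" "\<kappa>' \<in> A" and z: "z \<in> snd \<kappa> ` (fst \<kappa> \<inter> fst \<kappa>') \<times> UNIV"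
  shows "local_rep (tchart A \<kappa>) (tchart A \<kappa>') id z = prolong (local_rep \<kappa> \<kappa>' id) z"
proof -
  obtain p e where p: "p \<in> fst \<kappa>" "p \<in> fst \<kappa>'" "z = (snd \<kappa> p, e)" using z by auto
  obtain v where v: "v \<in> tangent_space A p" "v \<kappa> = e"
    using tangent_vector_with_coordinates[OF A(1,2) p(1)] by blast
  then show ?thesis
    using chart_inv_tchart[OF A(1,2) p(1) v(1)] p tangent_space_transform[OF v(1) A(2,3) p(1,2)]
      local_rep_apply[OF A(1,2) p(1), of \<kappa>' id]
    by (simp add: prolong_def) (simp add: local_rep_def tchart_simps)
qed

lemma smooth_atlas_tangent_atlas:
  assumes A: "smooth_atlas A"
  shows "smooth_atlas (tangent_atlas A)"
  unfolding smooth_atlas_def tangent_atlas_def ball_simps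
proof (intro conjI ballI)
  fix \<kappa> \<kappa>' assume k: "\<kappa> \<in> A" "\<kappa>' \<in> A"
  show "inj_on (snd (tchart A \<kappa>)) (fst (tchart A \<kappa>))" using inj_on_tchart[OF A k(1)] .
  have int: "fst (tchart A \<kappa>) \<inter> fst (tchart A \<kappa>') = {(p, v). p \<in> fst \<kappa> \<inter> fst \<kappa>' \<and> v \<in> tangent_space A p}"
    by (auto simp: tchart_simps)
  note im = tchart_image[OF A k(1), of "fst \<kappa>'", folded int]
  have o: "open (snd \<kappa> ` (fst \<kappa> \<inter> fst \<kappa>'))"
    and sm: "smooth_on (snd \<kappa> ` (fst \<kappa> \<inter> fst \<kappa>')) (local_rep \<kappa> \<kappa>' id)"
    using A k unfolding smooth_atlas_def transition_eq_local_rep by auto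
  show o': "open (snd (tchart A \<kappa>) ` (fst (tchart A \<kappa>) \<inter> fst (tchart A \<kappa>')))"
    unfolding im using o by (simp add: open_Times)
  show "smooth_on (snd (tchart A \<kappa>) ` (fst (tchart A \<kappa>) \<inter> fst (tchart A \<kappa>')))
      (snd (tchart A \<kappa>') \<circ> chart_inv (tchart A \<kappa>))"
    unfolding transition_eq_local_rep
    by (rule smooth_on_cong[OF o'[unfolded im], folded im, OF smooth_on_prolong[OF o sm, folded im]])
       (use local_rep_tchart[OF A k] im in auto)
qed

section \<open>Curves in coordinates\<close>

lemma smooth_curve_in_chart:
  assumes A: "smooth_atlas A" and I: "open I" "is_interval I" "I \<noteq> {}"
    and \<kappa>: "\<kappa> \<in> A" "c ` I \<subseteq> fst \<kappa>" and sm: "smooth_on I (\<lambda>t. snd \<kappa> (c t))"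
  shows "smooth_curve A I c"
  unfolding smooth_curve_def
proof (intro conjI ballI)
  show "c ` I \<subseteq> pts A" using \<kappa> by (auto simp: pts_def)
  fix \<mu> assume m: "\<mu> \<in> A"
  let ?S = "snd \<kappa> ` (fst \<kappa> \<inter> fst \<mu>)"
  have oS: "open ?S" and smS: "smooth_on ?S (local_rep \<kappa> \<mu> id)"
    using A m \<kappa> unfolding smooth_atlas_def transition_eq_local_rep by auto
  have "I \<inter> c -` fst \<mu> = I \<inter> (\<lambda>t. snd \<kappa> (c t)) -` ?S"
    using \<kappa> A unfolding smooth_atlas_def inj_on_def by (auto simp: image_iff) blast
  moreover have "open (I \<inter> (\<lambda>t. snd \<kappa> (c t)) -` ?S)"
    using continuous_open_preimage[OF smooth_on_continuous_on[OF sm] I(1) oS] .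
  ultimately show o: "open (I \<inter> c -` fst \<mu>)" by simp
  have "smooth_on (I \<inter> c -` fst \<mu>) (\<lambda>t. local_rep \<kappa> \<mu> id (snd \<kappa> (c t)))"
    by (rule smooth_on_compose[OF o oS smooth_on_subset[OF sm] smS]) (use \<kappa> in auto)
  then show "smooth_on (I \<inter> c -` fst \<mu>) (snd \<mu> \<circ> c)"
    by (rule smooth_on_cong[OF o]) (use \<kappa> in \<open>auto simp: local_rep_apply[OF A \<kappa>(1)]\<close>)
qed (use I in auto)

lemma smooth_curveD:
  assumes "smooth_curve A I c" "\<kappa> \<in> A"
  shows "open (I \<inter> c -` fst \<kappa>)" "smooth_on (I \<inter> c -` fst \<kappa>) (\<lambda>t. snd \<kappa> (c t))"
  using assms unfolding smooth_curve_def by (auto simp: o_def)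

lemma velocity_in_chart:
  "\<kappa> \<in> A \<Longrightarrow> c t \<in> fst \<kappa> \<Longrightarrow> velocity A c t \<kappa> = vector_derivative (\<lambda>t. snd \<kappa> (c t)) (at t)"
  by (simp add: velocity_def o_def)

lemma has_velocity:
  assumes "smooth_curve A I c" "\<kappa> \<in> A" "t \<in> I" "c t \<in> fst \<kappa>"
  shows "((\<lambda>t. snd \<kappa> (c t)) has_vector_derivative velocity A c t \<kappa>) (at t)"
  using smooth_on_has_vector_derivative[OF smooth_curveD(2)[OF assms(1,2)], of t] assms
  by (simp add: velocity_in_chart)

lemma has_velocity_image:
  assumes A: "smooth_atlas A" and f: "smooth_map A B f" and c: "smooth_curve A I c"
    and ch: "\<kappa> \<in> A" "t \<in> I" "c t \<in> fst \<kappa>" "\<mu> \<in> B" "f (c t) \<in> fst \<mu>"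
  shows "((\<lambda>t. snd \<mu> (f (c t))) has_vector_derivative
    fd (local_rep \<kappa> \<mu> f) (snd \<kappa> (c t)) (velocity A c t \<kappa>)) (at t)"
proof -
  have d: "(local_rep \<kappa> \<mu> f has_derivative fd (local_rep \<kappa> \<mu> f) (snd \<kappa> (c t))) (at (snd \<kappa> (c t)))"
    by (rule has_derivative_fd[OF local_rep_diff[OF f]]) (use ch in auto)
  show ?thesis
    by (rule has_vector_derivative_transform_within_open
          [OF has_vector_derivative_compose[OF has_velocity[OF c ch(1-3)] d] smooth_curveD(1)[OF c ch(1)]])
       (use ch in \<open>auto simp: local_rep_apply[OF A ch(1)]\<close>)
qed

lemma velocity_in_tangent_space:
  assumes A: "smooth_atlas A" and c: "smooth_curve A I c" and t: "t \<in> I"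
  shows "velocity A c t \<in> tangent_space A (c t)"
proof -
  have "c t \<in> pts A" using c t unfolding smooth_curve_def by blast
  then obtain \<kappa> where k: "\<kappa> \<in> A" "c t \<in> fst \<kappa>" unfolding pts_def by blast
  show ?thesis
  proof (rule tangent_spaceI[OF A k])
    show "velocity A c t \<mu> = 0" if "\<mu> \<notin> A \<or> c t \<notin> fst \<mu>" for \<mu> using that by (auto simp: velocity_def)
    show "velocity A c t \<mu> = fd (local_rep \<kappa> \<mu> id) (snd \<kappa> (c t)) (velocity A c t \<kappa>)"
      if "\<mu> \<in> A" "c t \<in> fst \<mu>" for \<mu>
      using vector_derivative_at[OF has_velocity_image[OF A smooth_map_id[OF A] c k(1) t k(2) that(1)]] that
      by (simp add: velocity_in_chart)
  qed
qed

lemma smooth_velocity_lift_in_chart: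
  assumes A: "smooth_atlas A" and c: "smooth_curve A I c" and \<kappa>: "\<kappa> \<in> A" "c ` I \<subseteq> fst \<kappa>"
  shows "smooth_curve (tangent_atlas A) I (velocity_lift A c)"
proof (rule smooth_curve_in_chart[OF smooth_atlas_tangent_atlas[OF A]])
  show I: "open I" "is_interval I" "I \<noteq> {}" using c by (auto simp: smooth_curve_def)
  show "tchart A \<kappa> \<in> tangent_atlas A" using \<kappa> by (simp add: tangent_atlas_def)
  show "velocity_lift A c ` I \<subseteq> fst (tchart A \<kappa>)"
    using velocity_in_tangent_space[OF A c] \<kappa> by (auto simp: velocity_lift_def tchart_simps)
  have "I \<inter> c -` fst \<kappa> = I" using \<kappa> by auto
  with smooth_curveD(2)[OF c \<kappa>(1)] have "smooth_on I (\<lambda>t. snd \<kappa> (c t))" by simp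
  then have "smooth_on I (\<lambda>t. (snd \<kappa> (c t), vector_derivative (\<lambda>t. snd \<kappa> (c t)) (at t)))"
    by (intro smooth_on_Pair smooth_on_vector_derivative I)
  then show "smooth_on I (\<lambda>t. snd (tchart A \<kappa>) (velocity_lift A c t))"
    by (rule smooth_on_cong[OF I(1)])
       (use \<kappa> in \<open>auto simp: velocity_lift_def tchart_simps velocity_in_chart\<close>)
qed

section \<open>Sprays and covariant derivatives in coordinates\<close>

lemma slit_bundle_iff: "(p, v) \<in> slit_bundle A \<longleftrightarrow> p \<in> pts A \<and> v \<in> tangent_space A p \<and> v \<noteq> tv_zero"
  by (auto simp: slit_bundle_def)

lemma in_ptsI: "\<kappa> \<in> A \<Longrightarrow> p \<in> fst \<kappa> \<Longrightarrow> p \<in> pts A"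
  unfolding pts_def by blast

lemma spray_in_chart:
  assumes A: "smooth_atlas A" and G: "spray A G" and \<kappa>: "\<kappa> \<in> A" "p \<in> fst \<kappa>"
    and v: "v \<in> tangent_space A p" "v \<noteq> tv_zero"
  shows "G (p, v) (tchart A \<kappa>) = (v \<kappa>, - 2 *\<^sub>R spray_coeff A G \<kappa> (snd \<kappa> p) (v \<kappa>))"
proof -
  have "(p, v) \<in> slit_bundle A" using v in_ptsI[OF \<kappa>] by (simp add: slit_bundle_iff)
  moreover have "\<exists>g. \<forall>(p, v)\<in>slit_bundle A. p \<in> fst \<kappa> \<longrightarrow>
      G (p, v) (tchart A \<kappa>) = (v \<kappa>, - 2 *\<^sub>R g (snd \<kappa> p) (v \<kappa>))"
    using G \<kappa>(1) unfolding spray_def by meson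
  ultimately obtain z where "G (p, v) (tchart A \<kappa>) = (v \<kappa>, z)" using \<kappa>(2) by fast
  then show ?thesis by (simp add: spray_coeff_def chart_inv_tchart[OF A \<kappa> v(1)])
qed

lemma tchart_image_slit:
  assumes "smooth_atlas A" "\<kappa> \<in> A"
  shows "snd (tchart A \<kappa>) ` (fst (tchart A \<kappa>) \<inter> slit_bundle A) = snd \<kappa> ` fst \<kappa> \<times> (UNIV - {0})"
proof (intro equalityI subsetI)
  fix z assume "z \<in> snd (tchart A \<kappa>) ` (fst (tchart A \<kappa>) \<inter> slit_bundle A)"
  then obtain p v where "p \<in> fst \<kappa>" "v \<in> tangent_space A p" "v \<noteq> tv_zero" "z = (snd \<kappa> p, v \<kappa>)"
    by (auto simp: tchart_simps slit_bundle_iff)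
  then show "z \<in> snd \<kappa> ` fst \<kappa> \<times> (UNIV - {0})" using tv_eq_zero_iff[OF assms(1) _ assms(2)] by auto
next
  fix z assume "z \<in> snd \<kappa> ` fst \<kappa> \<times> (UNIV - {0} :: 'b set)"
  then obtain p e where p: "p \<in> fst \<kappa>" "z = (snd \<kappa> p, e)" "e \<noteq> 0" by auto
  then obtain v where v: "v \<in> tangent_space A p" "v \<kappa> = e"
    using tangent_vector_with_coordinates[OF assms] by blast
  then have "v \<noteq> tv_zero" using p by (auto simp: tv_zero_def)
  then show "z \<in> snd (tchart A \<kappa>) ` (fst (tchart A \<kappa>) \<inter> slit_bundle A)"
    using p v in_ptsI[OF assms(2) p(1)]
    by (intro image_eqI[of _ _ "(p, v)"]) (auto simp: tchart_simps slit_bundle_iff)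
qed

lemma smooth_spray_coeff:
  assumes A: "smooth_atlas A" and G: "spray A G" and \<kappa>: "\<kappa> \<in> A"
  shows "smooth_on (snd \<kappa> ` fst \<kappa> \<times> (UNIV - {0})) (\<lambda>z. spray_coeff A G \<kappa> (fst z) (snd z))"
proof -
  have o: "open (snd \<kappa> ` fst \<kappa> \<times> (UNIV - {0 :: 'b}))"
    using open_chart_image[OF A \<kappa>] by (simp add: open_Times open_delete)
  have "smooth_vector_field_on (tangent_atlas A) (slit_bundle A) G" using G by (simp add: spray_def)
  then have "smooth_on (snd \<kappa> ` fst \<kappa> \<times> (UNIV - {0})) (\<lambda>z. G (chart_inv (tchart A \<kappa>) z) (tchart A \<kappa>))"
    using \<kappa> unfolding smooth_vector_field_on_def tangent_atlas_def by (auto simp: tchart_image_slit[OF A \<kappa>])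
  then have "smooth_on (snd \<kappa> ` fst \<kappa> \<times> (UNIV - {0}))
      (\<lambda>z. (- 1 / 2) *\<^sub>R snd (G (chart_inv (tchart A \<kappa>) z) (tchart A \<kappa>)))"
    by (rule smooth_on_linear_compose[OF bounded_linear_const_scaleR[OF bounded_linear_snd] o])
  then show ?thesis by (simp add: spray_coeff_def)
qed

lemma spray_coeff_fiber_differentiable:
  assumes A: "smooth_atlas A" and G: "spray A G" and \<kappa>: "\<kappa> \<in> A" "p \<in> fst \<kappa>" and y: "y \<noteq> 0"
  shows "spray_coeff A G \<kappa> (snd \<kappa> p) differentiable (at y)"
proof -
  have "(\<lambda>z. spray_coeff A G \<kappa> (fst z) (snd z)) differentiable (at (snd \<kappa> p, y))"
    by (rule smooth_on_differentiable[OF smooth_spray_coeff[OF A G \<kappa>(1)]]) (use \<kappa> y in auto)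
  from has_derivative_compose[OF has_derivative_Pair[OF has_derivative_const has_derivative_ident]
      has_derivative_fd[OF this]]
  show ?thesis unfolding differentiable_def by auto
qed

text \<open>The transformation law of the vector field \<open>G\<close> under coordinate changes \<open>\<tau>\<close> of the tangent
  bundle, i.e. under the prolongation of \<open>\<tau>\<close>, is the transformation law of the coefficients.\<close>

lemma spray_coeff_transform:
  assumes A: "smooth_atlas A" and G: "spray A G"
    and ch: "\<kappa> \<in> A" "\<kappa>' \<in> A" "p \<in> fst \<kappa>" "p \<in> fst \<kappa>'" and y: "y \<noteq> 0"
  defines "\<tau> \<equiv> local_rep \<kappa> \<kappa>' id"
  shows "fd (\<lambda>z. fd \<tau> z y) (snd \<kappa> p) y - 2 *\<^sub>R fd \<tau> (snd \<kappa> p) (spray_coeff A G \<kappa> (snd \<kappa> p) y)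
    = - 2 *\<^sub>R spray_coeff A G \<kappa>' (snd \<kappa>' p) (fd \<tau> (snd \<kappa> p) y)"
proof -
  obtain v where v: "v \<in> tangent_space A p" "v \<kappa> = y"
    using tangent_vector_with_coordinates[OF A ch(1,3)] by blast
  have nz: "v \<noteq> tv_zero" using v y by (auto simp: tv_zero_def)
  have v': "v \<kappa>' = fd \<tau> (snd \<kappa> p) y" using tangent_space_transform[OF v(1) ch] v(2) by (simp add: \<tau>_def)
  let ?S = "snd \<kappa> ` (fst \<kappa> \<inter> id -` fst \<kappa>')"
  note \<tau> = smooth_local_rep[OF smooth_map_id[OF A] ch(1,2), folded \<tau>_def]
  have l: "linear (fd \<tau> (snd \<kappa> p))" by (rule linear_fd[OF \<tau>(2)]) (use ch in auto)
  have "(p, v) \<in> slit_bundle A" using v nz in_ptsI[OF ch(1,3)] by (simp add: slit_bundle_iff)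
  then have "G (p, v) \<in> tangent_space (tangent_atlas A) (p, v)"
    using G by (simp add: spray_def smooth_vector_field_on_def)
  from tangent_space_transform[OF this, of "tchart A \<kappa>" "tchart A \<kappa>'"]
  have "G (p, v) (tchart A \<kappa>')
      = fd (local_rep (tchart A \<kappa>) (tchart A \<kappa>') id) (snd \<kappa> p, y) (G (p, v) (tchart A \<kappa>))"
    using ch v by (simp add: tangent_atlas_def tchart_simps)
  also have "fd (local_rep (tchart A \<kappa>) (tchart A \<kappa>') id) (snd \<kappa> p, y) = fd (prolong \<tau>) (snd \<kappa> p, y)"
    by (rule fd_cong[OF open_Times[OF \<tau>(1) open_UNIV]])
       (use ch local_rep_tchart[OF A ch(1,2)] in \<open>auto simp: \<tau>_def\<close>)
  finally have "snd (G (p, v) (tchart A \<kappa>'))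
    = fd (\<lambda>z. fd \<tau> z y) (snd \<kappa> p) y + fd \<tau> (snd \<kappa> p) (- 2 *\<^sub>R spray_coeff A G \<kappa> (snd \<kappa> p) y)"
    using fd_prolong[OF \<tau>, of "snd \<kappa> p"] ch
    by (simp add: spray_in_chart[OF A G ch(1,3) v(1) nz] v(2))
  then show ?thesis
    by (simp add: spray_in_chart[OF A G ch(2,4) v(1) nz] v' linear_scale[OF l] linear_neg[OF l])
qed

lemma spray_N_mult:
  assumes "spray_coeff A G \<kappa> x differentiable (at y)"
  shows "spray_N A G \<kappa> x y *v \<xi> = fd (spray_coeff A G \<kappa> x) y \<xi>"
proof -
  let ?g = "spray_coeff A G \<kappa> x"
  have comp: "fd (\<lambda>z. ?g z $ i) y v = fd ?g y v $ i" for i v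
    using fd_linear_compose[OF bounded_linear_vec_nth assms] by simp
  have "fd ?g y \<xi> = fd ?g y (\<Sum>j\<in>UNIV. \<xi> $ j *\<^sub>R axis j 1)"
    by (simp add: basis_expansion scalar_mult_eq_scaleR[symmetric])
  also have "\<dots> = (\<Sum>j\<in>UNIV. \<xi> $ j *\<^sub>R fd ?g y (axis j 1))"
    using linear_frechet_derivative[OF assms] by (simp add: linear_sum linear_scale)
  finally show ?thesis
    by (simp add: vec_eq_iff spray_N_def comp matrix_vector_mult_def mult.commute)
qed

lemma cov_deriv_in_chart:
  assumes A: "smooth_atlas A" and G: "spray A G" and \<kappa>: "\<kappa> \<in> A" "c t \<in> fst \<kappa>"
    and nz: "velocity A c t \<kappa> \<noteq> 0"
  shows "cov_deriv A G c X t \<kappa> = vector_derivative (\<lambda>s. X s \<kappa>) (at t)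
    + fd (spray_coeff A G \<kappa> (snd \<kappa> (c t))) (velocity A c t \<kappa>) (X t \<kappa>)"
  using \<kappa> by (simp add: cov_deriv_def spray_N_mult[OF spray_coeff_fiber_differentiable[OF A G \<kappa> nz]])

lemma has_vector_derivative_fd_along:
  fixes f :: "'a::euclidean_space \<Rightarrow> 'b::real_normed_vector" and x \<xi> :: "real \<Rightarrow> 'a"
  assumes S: "open S" "smooth_on S f" "x t \<in> S"
    and x: "(x has_vector_derivative x') (at t)" and \<xi>: "(\<xi> has_vector_derivative \<xi>') (at t)"
  shows "((\<lambda>s. fd f (x s) (\<xi> s)) has_vector_derivative
    fd (\<lambda>z. fd f z (\<xi> t)) (x t) x' + fd f (x t) \<xi>') (at t)"
proof -
  have "open (S \<times> (UNIV :: 'a set))" using S by (simp add: open_Times)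
  have d: "(prolong f has_derivative fd (prolong f) (x t, \<xi> t)) (at (x t, \<xi> t))"
    by (rule smooth_on_has_derivative[OF smooth_on_prolong[OF S(1,2)]]) (use S in auto)
  have "((\<lambda>s. (x s, \<xi> s)) has_vector_derivative (x', \<xi>')) (at t)"
    using has_derivative_Pair[OF x[unfolded has_vector_derivative_def] \<xi>[unfolded has_vector_derivative_def]]
    by (simp add: has_vector_derivative_def)
  from has_vector_derivative_compose[OF this d]
  have "((\<lambda>s. prolong f (x s, \<xi> s)) has_vector_derivative
      (fd f (x t) x', fd (\<lambda>z. fd f z (\<xi> t)) (x t) x' + fd f (x t) \<xi>')) (at t)"
    by (simp add: fd_prolong[OF S])
  from bounded_linear.has_vector_derivative[OF bounded_linear_snd this]
  show ?thesis by (simp add: prolong_def)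
qed

text \<open>Suppose that \<open>f\<close> relates the sprays with coefficients \<open>g\<close> and \<open>g'\<close> in the directions of a
  subspace \<open>V\<close>. Differentiating the relation at \<open>y\<close> in a direction \<open>\<xi>\<close> of \<open>V\<close> polarizes its term
  that is quadratic in \<open>y\<close>, and replaces \<open>g\<close> and \<open>g'\<close> by the linear connection coefficients \<open>\<partial>g\<close>
  and \<open>\<partial>g'\<close>.\<close>

lemma spray_relation_polarized:
  fixes f :: "'a::euclidean_space \<Rightarrow> 'b::euclidean_space"
  assumes S: "open S" "smooth_on S f" "x \<in> S"
    and V: "subspace V" "y \<in> V" "\<xi> \<in> V" "y \<noteq> 0"
    and rel: "\<And>z. z \<in> V \<Longrightarrow> z \<noteq> 0 \<Longrightarrow>
      fd (\<lambda>w. fd f w z) x z - 2 *\<^sub>R fd f x (g z) = - 2 *\<^sub>R g' (fd f x z)"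
    and g: "g differentiable (at y)" and g': "g' differentiable (at (fd f x y))"
  shows "fd (\<lambda>w. fd f w \<xi>) x y + fd g' (fd f x y) (fd f x \<xi>) = fd f x (fd g y \<xi>)"
proof -
  define Q where "Q a b = fd (\<lambda>w. fd f w a) x b" for a b
  have sym: "Q a b = Q b a" for a b
    unfolding Q_def by (rule second_derivative_symmetric[OF S(1,3,2)])
  have lQ: "linear (Q a)" for a
    unfolding Q_def by (rule linear_fd[OF smooth_on_fd[OF S(2)] S(3)])
  have l: "linear (fd f x)" by (rule linear_fd[OF S(2,3)])
  let ?\<gamma> = "\<lambda>s::real. y + s *\<^sub>R \<xi>"
  \<comment> \<open>Symmetry merges the two mixed terms of the quadratic expansion into \<open>2 Q(\<xi>, y)\<close>.\<close>
  have Qexp: "Q (?\<gamma> s) (?\<gamma> s) = Q y y + s *\<^sub>R (2 *\<^sub>R Q \<xi> y) + (s * s) *\<^sub>R Q \<xi> \<xi>" for s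
    by (simp add: linear_add[OF lQ] linear_scale[OF lQ] sym[of "y + s *\<^sub>R \<xi>"] sym[of y \<xi>]
        algebra_simps scaleR_2)
  have d\<gamma>: "(?\<gamma> has_vector_derivative \<xi>) (at 0)" by (auto intro!: derivative_eq_intros)
  have dg: "((\<lambda>s. g (?\<gamma> s)) has_vector_derivative fd g y \<xi>) (at 0)"
    using has_vector_derivative_compose[OF d\<gamma>, of g] has_derivative_fd[OF g] by simp
  have d1: "((\<lambda>s. Q (?\<gamma> s) (?\<gamma> s) - 2 *\<^sub>R fd f x (g (?\<gamma> s))) has_vector_derivative
      2 *\<^sub>R Q \<xi> y - 2 *\<^sub>R fd f x (fd g y \<xi>)) (at 0)"
  proof (intro has_vector_derivative_diff)
    show "((\<lambda>s. Q (?\<gamma> s) (?\<gamma> s)) has_vector_derivative 2 *\<^sub>R Q \<xi> y) (at 0)"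
      unfolding Qexp by (auto intro!: derivative_eq_intros)
    have "bounded_linear (\<lambda>v. 2 *\<^sub>R fd f x v)"
      using l by (intro bounded_linear_const_scaleR) (simp add: linear_conv_bounded_linear)
    from bounded_linear.has_vector_derivative[OF this dg]
    show "((\<lambda>s. 2 *\<^sub>R fd f x (g (?\<gamma> s))) has_vector_derivative 2 *\<^sub>R fd f x (fd g y \<xi>)) (at 0)" .
  qed
  have lin\<gamma>: "fd f x (?\<gamma> s) = fd f x y + s *\<^sub>R fd f x \<xi>" for s
    by (simp add: linear_add[OF l] linear_scale[OF l])
  have "((\<lambda>s. fd f x y + s *\<^sub>R fd f x \<xi>) has_vector_derivative fd f x \<xi>) (at 0)"
    by (auto intro!: derivative_eq_intros)
  then have "((\<lambda>s. g' (fd f x (?\<gamma> s))) has_vector_derivative fd g' (fd f x y) (fd f x \<xi>)) (at 0)"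
    unfolding lin\<gamma>
    using has_vector_derivative_compose[of "\<lambda>s. fd f x y + s *\<^sub>R fd f x \<xi>" _ 0 g'] has_derivative_fd[OF g'] by simp
  from bounded_linear.has_vector_derivative[OF bounded_linear_scaleR_right this, of "-2"]
  have d2: "((\<lambda>s. - 2 *\<^sub>R g' (fd f x (?\<gamma> s))) has_vector_derivative
      - 2 *\<^sub>R fd g' (fd f x y) (fd f x \<xi>)) (at 0)" .
  \<comment> \<open>The relation is assumed for nonzero vectors only, so \<open>s\<close> has to stay small.\<close>
  define N where "N = ?\<gamma> -` (UNIV - {0})"
  have N: "open N" "0 \<in> N"
    unfolding N_def using V by (auto intro!: open_vimage continuous_intros)
  have "((\<lambda>s. Q (?\<gamma> s) (?\<gamma> s) - 2 *\<^sub>R fd f x (g (?\<gamma> s))) has_vector_derivative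
      - 2 *\<^sub>R fd g' (fd f x y) (fd f x \<xi>)) (at 0)"
  proof (rule has_vector_derivative_transform_within_open[OF d2 N])
    fix s assume "s \<in> N"
    then show "- 2 *\<^sub>R g' (fd f x (?\<gamma> s)) = Q (?\<gamma> s) (?\<gamma> s) - 2 *\<^sub>R fd f x (g (?\<gamma> s))"
      using rel[of "?\<gamma> s"] V by (simp add: N_def Q_def subspace_add subspace_scale)
  qed
  from vector_derivative_unique_at[OF d1 this]
  have "2 *\<^sub>R (Q \<xi> y + fd g' (fd f x y) (fd f x \<xi>)) = 2 *\<^sub>R fd f x (fd g y \<xi>)"
    by (simp add: algebra_simps)
  then show ?thesis unfolding Q_def by simp
qed

text \<open>The derivative of \<open>X = Df(x) Y\<close> contains, besides \<open>Df(x) Y'\<close>, the second derivative of \<open>f\<close> at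
  the velocity and \<open>Y\<close>. The polarized relation says that the connection terms compensate for it.
  Only the velocity and the field at the time \<open>t\<close> have to lie in \<open>V\<close>. The lemma serves twice: for a
  submersion with \<open>V\<close> the horizontal directions, and for the identity in two charts with all
  directions.\<close>

lemma cov_deriv_related:
  fixes B :: "('q, real^'m) chart set" and A :: "('p, real^'n) chart set"
  assumes B: "smooth_atlas B" "spray B H" and A: "smooth_atlas A" "spray A G"
    and \<pi>: "smooth_map B A \<pi>" and d: "smooth_curve B I d"
    and ch: "\<kappa> \<in> B" "t \<in> I" "d t \<in> fst \<kappa>" "\<mu> \<in> A" "\<pi> (d t) \<in> fst \<mu>"
    and c: "\<And>s. s \<in> I \<Longrightarrow> \<pi> (d s) = c s"
    and Y: "(\<lambda>s. Y s \<kappa>) differentiable (at t)"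
    and X: "\<And>s. s \<in> I \<Longrightarrow> d s \<in> fst \<kappa> \<Longrightarrow> c s \<in> fst \<mu> \<Longrightarrow>
      X s \<mu> = fd (local_rep \<kappa> \<mu> \<pi>) (snd \<kappa> (d s)) (Y s \<kappa>)"
    and V: "subspace V" "velocity B d t \<kappa> \<in> V" "Y t \<kappa> \<in> V"
    and nz: "velocity A c t \<mu> \<noteq> 0"
    and rel: "\<And>y. y \<in> V \<Longrightarrow> y \<noteq> 0 \<Longrightarrow>
      fd (\<lambda>w. fd (local_rep \<kappa> \<mu> \<pi>) w y) (snd \<kappa> (d t)) y
        - 2 *\<^sub>R fd (local_rep \<kappa> \<mu> \<pi>) (snd \<kappa> (d t)) (spray_coeff B H \<kappa> (snd \<kappa> (d t)) y)
      = - 2 *\<^sub>R spray_coeff A G \<mu> (snd \<mu> (c t)) (fd (local_rep \<kappa> \<mu> \<pi>) (snd \<kappa> (d t)) y)"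
  shows "cov_deriv A G c X t \<mu> = fd (local_rep \<kappa> \<mu> \<pi>) (snd \<kappa> (d t)) (cov_deriv B H d Y t \<kappa>)"
proof -
  define f where "f = local_rep \<kappa> \<mu> \<pi>"
  let ?S = "snd \<kappa> ` (fst \<kappa> \<inter> \<pi> -` fst \<mu>)"
  let ?x = "snd \<kappa> (d t)" and ?y = "velocity B d t \<kappa>"
  note f = smooth_local_rep[OF \<pi> ch(1,4), folded f_def]
  have x: "?x \<in> ?S" using ch by auto
  have ct: "c t \<in> fst \<mu>" using c ch by auto
  have oI: "open I" using d by (simp add: smooth_curve_def)
  have l: "linear (fd f ?x)" by (rule linear_fd[OF f(2) x])
  have "((\<lambda>t. snd \<mu> (c t)) has_vector_derivative fd f ?x ?y) (at t)"
    by (rule has_vector_derivative_transform_within_open[OF has_velocity_image[OF B(1) \<pi> d ch, folded f_def] oI])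
       (use ch c in auto)
  then have vel: "velocity A c t \<mu> = fd f ?x ?y"
    using velocity_in_chart[OF ch(4), of c t] ct by (simp add: vector_derivative_at)
  then have y: "?y \<noteq> 0" using nz linear_0[OF l] by auto
  define Y' where "Y' = vector_derivative (\<lambda>s. Y s \<kappa>) (at t)"
  have Y': "((\<lambda>s. Y s \<kappa>) has_vector_derivative Y') (at t)"
    using Y unfolding Y'_def by (simp add: vector_derivative_works)
  let ?J = "(I \<inter> d -` fst \<kappa>) \<inter> (\<lambda>s. snd \<kappa> (d s)) -` ?S"
  have J: "open ?J"
    by (rule continuous_open_preimage[OF smooth_on_continuous_on smooth_curveD(1)[OF d ch(1)] f(1)])
       (rule smooth_curveD(2)[OF d ch(1)])
  \<comment> \<open>\<open>?J\<close> is the open set of times at which both charts can be used.\<close>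
  have "((\<lambda>s. X s \<mu>) has_vector_derivative
      fd (\<lambda>z. fd f z (Y t \<kappa>)) ?x ?y + fd f ?x Y') (at t)"
  proof (rule has_vector_derivative_transform_within_open[OF
      has_vector_derivative_fd_along[OF f x has_velocity[OF d ch(1-3)] Y'] J])
    fix s assume s: "s \<in> ?J"
    then obtain p where p: "p \<in> fst \<kappa>" "\<pi> p \<in> fst \<mu>" "snd \<kappa> p = snd \<kappa> (d s)" by auto
    then have "p = d s" using s chart_inv_snd[OF B(1) ch(1)] by (metis IntD1 IntD2 vimageE)
    then show "fd f (snd \<kappa> (d s)) (Y s \<kappa>) = X s \<mu>" using p s X[of s] c[of s] by (simp add: f_def)
  qed (use ch in auto)
  from vector_derivative_at[OF this]
  have X': "vector_derivative (\<lambda>s. X s \<mu>) (at t) = fd (\<lambda>z. fd f z (Y t \<kappa>)) ?x ?y + fd f ?x Y'" .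
  have Xt: "X t \<mu> = fd f ?x (Y t \<kappa>)" using X ch ct by (simp add: f_def)
  have "cov_deriv A G c X t \<mu> = fd (\<lambda>z. fd f z (Y t \<kappa>)) ?x ?y + fd f ?x Y'
      + fd (spray_coeff A G \<mu> (snd \<mu> (c t))) (fd f ?x ?y) (fd f ?x (Y t \<kappa>))"
    using cov_deriv_in_chart[OF A ch(4), of c t X, OF ct nz] by (simp add: X' Xt vel)
  also have "\<dots> = fd f ?x Y' + fd f ?x (fd (spray_coeff B H \<kappa> ?x) ?y (Y t \<kappa>))"
    using spray_relation_polarized[OF f x V y rel[folded f_def]
        spray_coeff_fiber_differentiable[OF B ch(1,3) y] spray_coeff_fiber_differentiable[OF A ch(4) ct]]
      nz vel by (simp add: algebra_simps)
  also have "\<dots> = fd f ?x (cov_deriv B H d Y t \<kappa>)"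
    using cov_deriv_in_chart[OF B ch(1), of d t Y, OF ch(3) y] by (simp add: Y'_def linear_add[OF l])
  finally show ?thesis by (simp add: f_def)
qed

text \<open>The transformation law of the spray coefficients is the relation of the previous lemma for the
  coordinate changes, in all directions. Hence the covariant derivative does not depend on the
  coordinates. This is what allows to decompose it into horizontal and vertical parts later.\<close>

lemma cov_deriv_in_tangent_space:
  fixes A :: "('p, real^'n) chart set"
  assumes A: "smooth_atlas A" "spray A G" and c: "regular_curve A I c" and t: "t \<in> I"
    and X: "\<And>s. s \<in> I \<Longrightarrow> X s \<in> tangent_space A (c s)"
    and dX: "\<And>\<kappa>. \<kappa> \<in> A \<Longrightarrow> c t \<in> fst \<kappa> \<Longrightarrow> (\<lambda>s. X s \<kappa>) differentiable (at t)"
  shows "cov_deriv A G c X t \<in> tangent_space A (c t)"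
proof -
  have sc: "smooth_curve A I c" and vel: "velocity A c t \<noteq> tv_zero"
    using c t by (auto simp: regular_curve_def)
  have "c t \<in> pts A" using sc t unfolding smooth_curve_def by blast
  then obtain \<kappa> where k: "\<kappa> \<in> A" "c t \<in> fst \<kappa>" unfolding pts_def by blast
  show ?thesis
  proof (rule tangent_spaceI[OF A(1) k])
    show "cov_deriv A G c X t \<mu> = 0" if "\<mu> \<notin> A \<or> c t \<notin> fst \<mu>" for \<mu>
      using that by (auto simp: cov_deriv_def)
    fix \<mu> assume m: "\<mu> \<in> A" "c t \<in> fst \<mu>"
    show "cov_deriv A G c X t \<mu> = fd (local_rep \<kappa> \<mu> id) (snd \<kappa> (c t)) (cov_deriv A G c X t \<kappa>)"
    proof (rule cov_deriv_related[where Y = X and V = UNIV, OF A A smooth_map_id[OF A(1)] sc k(1) t k(2) m(1) _ _ dX[OF k] _ subspace_UNIV])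
      show "velocity A c t \<mu> \<noteq> 0"
        using vel tv_eq_zero_iff[OF A(1) velocity_in_tangent_space[OF A(1) sc t] m] by simp
      show "X s \<mu> = fd (local_rep \<kappa> \<mu> id) (snd \<kappa> (c s)) (X s \<kappa>)"
        if "s \<in> I" "c s \<in> fst \<kappa>" "c s \<in> fst \<mu>" for s
        using tangent_space_transform[OF X[OF that(1)] k(1) m(1) that(2,3)] .
      show "fd (\<lambda>w. fd (local_rep \<kappa> \<mu> id) w y) (snd \<kappa> (c t)) y
          - 2 *\<^sub>R fd (local_rep \<kappa> \<mu> id) (snd \<kappa> (c t)) (spray_coeff A G \<kappa> (snd \<kappa> (c t)) y)
        = - 2 *\<^sub>R spray_coeff A G \<mu> (snd \<mu> (c t)) (fd (local_rep \<kappa> \<mu> id) (snd \<kappa> (c t)) y)"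
        if "y \<noteq> 0" for y
        using spray_coeff_transform[OF A k(1) m(1) k(2) m(2) that] .
    qed (use m in auto)
  qed
qed

lemma smooth_cov_deriv:
  fixes A :: "('p, real^'n) chart set"
  assumes A: "smooth_atlas A" "spray A G" and c: "regular_curve A I c" and X: "smooth_field_along A I c X"
  shows "smooth_field_along A I c (cov_deriv A G c X)"
  unfolding smooth_field_along_def
proof (intro conjI ballI)
  have sc: "smooth_curve A I c" using c by (simp add: regular_curve_def)
  have Xt: "X t \<in> tangent_space A (c t)" if "t \<in> I" for t
    using X that by (simp add: smooth_field_along_def)
  have Xs: "smooth_on (I \<inter> c -` fst \<kappa>) (\<lambda>t. X t \<kappa>)" if "\<kappa> \<in> A" for \<kappa>
    using X that by (simp add: smooth_field_along_def)
  show "cov_deriv A G c X t \<in> tangent_space A (c t)" if t: "t \<in> I" for t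
  proof (rule cov_deriv_in_tangent_space[OF A c t Xt])
    show "(\<lambda>s. X s \<kappa>) differentiable at t" if "\<kappa> \<in> A" "c t \<in> fst \<kappa>" for \<kappa>
      by (rule smooth_on_differentiable[OF Xs[OF that(1)]]) (use t that in auto)
  qed
  fix \<kappa> assume k: "\<kappa> \<in> A"
  let ?J = "I \<inter> c -` fst \<kappa>"
  let ?x = "\<lambda>t. snd \<kappa> (c t)" and ?W = "snd \<kappa> ` fst \<kappa> \<times> (UNIV - {0 :: real^'n})"
  let ?g = "\<lambda>z. spray_coeff A G \<kappa> (fst z) (snd z)"
  note J = smooth_curveD[OF sc k]
  have W: "open ?W" using open_chart_image[OF A(1) k] by (simp add: open_Times open_delete)
  have nz: "velocity A c t \<kappa> \<noteq> 0" if "t \<in> ?J" for t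
    using tv_eq_zero_iff[OF A(1) velocity_in_tangent_space[OF A(1) sc] k] c that
    by (auto simp: regular_curve_def)
  have "smooth_on ?J (\<lambda>t. vector_derivative ?x (at t))" by (rule smooth_on_vector_derivative[OF J])
  then have v: "smooth_on ?J (\<lambda>t. velocity A c t \<kappa>)"
    by (rule smooth_on_cong[OF J(1)]) (simp add: velocity_in_chart[OF k])
  have "smooth_on ?J (\<lambda>t. vector_derivative (\<lambda>s. X s \<kappa>) (at t) + fd ?g (?x t, velocity A c t \<kappa>) (0, X t \<kappa>))"
    by (intro smooth_on_add J(1) smooth_on_vector_derivative Xs[OF k]
        smooth_on_fd_apply[OF J(1) W smooth_spray_coeff[OF A k]] smooth_on_Pair v J(2) smooth_on_const)
       (use nz in auto)
  then show "smooth_on ?J (\<lambda>t. cov_deriv A G c X t \<kappa>)"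
  proof (rule smooth_on_cong[OF J(1)])
    fix t assume t: "t \<in> ?J"
    have "(?g has_derivative fd ?g (?x t, velocity A c t \<kappa>)) (at (?x t, velocity A c t \<kappa>))"
      by (rule smooth_on_has_derivative[OF smooth_spray_coeff[OF A k]]) (use t nz in auto)
    from has_derivative_compose[OF has_derivative_Pair[OF has_derivative_const has_derivative_ident] this]
    have "fd (spray_coeff A G \<kappa> (?x t)) (velocity A c t \<kappa>) = (\<lambda>w. fd ?g (?x t, velocity A c t \<kappa>) (0, w))"
      by (intro fd_eqI) simp
    then show "vector_derivative (\<lambda>s. X s \<kappa>) (at t) + fd ?g (?x t, velocity A c t \<kappa>) (0, X t \<kappa>)
        = cov_deriv A G c X t \<kappa>"
      using cov_deriv_in_chart[OF A k, of c t X] t nz[OF t] by simp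
  qed
qed

section \<open>Horizontal lifts\<close>

text \<open>A surjection that is injective on a space with a smooth frame has a smooth right inverse into
  this space: in the frame it is given by Cramer's rule. Counting dimensions shows first that the
  frame has as many members as the target has coordinates.\<close>

lemma smooth_right_inverse_on_frame:
  fixes f :: "'a::euclidean_space \<Rightarrow> real^'n" and b :: "nat \<Rightarrow> 'a \<Rightarrow> 'a"
  assumes W: "open W" "smooth_on W f" and b: "\<And>i. i < k \<Longrightarrow> smooth_on W (b i)"
    and frame: "\<And>x. x \<in> W \<Longrightarrow> inj_on (\<lambda>i. b i x) {..<k} \<and> independent ((\<lambda>i. b i x) ` {..<k}) \<and>
      S x = span ((\<lambda>i. b i x) ` {..<k})"
    and inj: "\<And>x y. x \<in> W \<Longrightarrow> y \<in> S x \<Longrightarrow> fd f x y = 0 \<Longrightarrow> y = 0"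
    and surj: "\<And>x w. x \<in> W \<Longrightarrow> \<exists>y\<in>S x. fd f x y = w"
    and ne: "W \<noteq> {}"
  shows "\<exists>h. smooth_on (W \<times> UNIV) (\<lambda>z. h (fst z) (snd z)) \<and>
    (\<forall>x\<in>W. \<forall>w. h x w \<in> S x \<and> fd f x (h x w) = w)"
proof -
  have l: "linear (fd f x)" if "x \<in> W" for x using linear_fd[OF W(2) that] .
  have subS: "subspace (S x)" if "x \<in> W" for x using frame[OF that] by simp
  have injS: "inj_on (fd f x) (S x)" if "x \<in> W" for x
  proof (rule inj_onI)
    fix y z assume "y \<in> S x" "z \<in> S x" "fd f x y = fd f x z"
    then show "y = z"
      using inj[OF that, of "y - z"] subspace_diff[OF subS[OF that]] linear_diff[OF l[OF that]] by simp
  qed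
  have "k = CARD('n)"
  proof -
    obtain x where x: "x \<in> W" using ne by blast
    have "dim (S x) = card ((\<lambda>i. b i x) ` {..<k})"
      using frame[OF x] by (simp add: dim_span dim_eq_card_independent)
    also have "\<dots> = k" using frame[OF x] by (simp add: card_image)
    finally have "dim (S x) = k" .
    moreover have "dim (fd f x ` S x) = dim (S x)"
      using injS[OF x] subS[OF x] by (intro dim_image_eq[OF l[OF x]]) (metis span_eq_iff)
    moreover have "w \<in> fd f x ` S x" for w using surj[OF x, of w] by blast
    then have "fd f x ` S x = UNIV" by blast
    ultimately show ?thesis by simp
  qed
  then obtain e :: "'n \<Rightarrow> nat" where e: "bij_betw e UNIV {..<k}"
    using finite_same_card_bij[of "UNIV :: 'n set" "{..<k}"] finite_lessThan by (metis card_lessThan finite_class.finite_UNIV)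
  have ek: "e j < k" for j using bij_betwE[OF e] by blast
  define A :: "'a \<Rightarrow> real^'n^'n" where "A x = (\<chi> i j. fd f x (b (e j) x) $ i)" for x
  have A_mult: "A x *v \<alpha> = fd f x (\<Sum>j\<in>UNIV. \<alpha> $ j *\<^sub>R b (e j) x)" if "x \<in> W" for x \<alpha>
  proof -
    have "column j (A x) = fd f x (b (e j) x)" for j by (simp add: column_def A_def)
    then show ?thesis
      unfolding matrix_mult_sum linear_sum[OF l[OF that]] linear_scale[OF l[OF that]]
      by (simp add: scalar_mult_eq_scaleR)
  qed
  have inS: "(\<Sum>j\<in>UNIV. \<alpha> j *\<^sub>R b (e j) x) \<in> S x" if "x \<in> W" for x \<alpha>
  proof (intro subspace_sum[OF subS[OF that]] subspace_scale[OF subS[OF that]])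
    show "b (e j) x \<in> S x" for j using frame[OF that] ek[of j] by (auto intro: span_base)
  qed
  have detA: "det (A x) \<noteq> 0" if x: "x \<in> W" for x
  proof -
    have "\<alpha> = 0" if a: "A x *v \<alpha> = 0" for \<alpha>
    proof -
      have z: "(\<Sum>j\<in>UNIV. \<alpha> $ j *\<^sub>R b (e j) x) = 0"
        using inj[OF x inS[OF x]] a A_mult[OF x] by metis
      define \<beta> where "\<beta> = inv_into UNIV e"
      have be: "\<beta> (e j) = j" for j using e by (simp add: \<beta>_def bij_betw_def)
      define \<phi> where "\<phi> = inv_into {..<k} (\<lambda>i. b i x)"
      have ph: "\<phi> (b (e j) x) = e j" for j
        using inv_into_f_f[of "\<lambda>i. b i x" "{..<k}" "e j"] frame[OF x] ek[of j] by (simp add: \<phi>_def)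
      have "(\<Sum>v\<in>(\<lambda>i. b i x) ` {..<k}. \<alpha> $ \<beta> (\<phi> v) *\<^sub>R v) = (\<Sum>i<k. \<alpha> $ \<beta> (\<phi> (b i x)) *\<^sub>R b i x)"
        using frame[OF x] by (simp add: sum.reindex)
      also have "\<dots> = (\<Sum>j\<in>UNIV. \<alpha> $ j *\<^sub>R b (e j) x)"
        using sum.reindex_bij_betw[OF e, of "\<lambda>i. \<alpha> $ \<beta> (\<phi> (b i x)) *\<^sub>R b i x"] by (simp add: ph be)
      finally have "(\<Sum>v\<in>(\<lambda>i. b i x) ` {..<k}. \<alpha> $ \<beta> (\<phi> v) *\<^sub>R v) = 0" using z by simp
      then have "\<alpha> $ \<beta> (\<phi> v) = 0" if "v \<in> (\<lambda>i. b i x) ` {..<k}" for v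
        using independentD[of "(\<lambda>i. b i x) ` {..<k}" "(\<lambda>i. b i x) ` {..<k}" "\<lambda>v. \<alpha> $ \<beta> (\<phi> v)" v]
          frame[OF x] that by auto
      then have "\<alpha> $ \<beta> (\<phi> (b (e j) x)) = 0" for j using ek[of j] by auto
      then show "\<alpha> = 0" by (simp add: vec_eq_iff ph be)
    qed
    then show ?thesis
      using matrix_left_invertible_ker[of "A x"] invertible_left_inverse[of "A x"] invertible_det_nz[of "A x"]
      by metis
  qed
  define \<sigma> where "\<sigma> x w = (\<chi> k. det (\<chi> i j. if j = k then w $ i else A x $ i $ j) / det (A x))"
    for x and w :: "real^'n"
  have \<sigma>: "A x *v \<sigma> x w = w" if "x \<in> W" for x w
    by (rule iffD2[OF cramer[OF detA[OF that]]]) (rule \<sigma>_def)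
  define h where "h x w = (\<Sum>j\<in>UNIV. \<sigma> x w $ j *\<^sub>R b (e j) x)" for x w
  have "smooth_on (W \<times> UNIV) (\<lambda>z. h (fst z) (snd z))"
  proof -
    have o: "open (W \<times> (UNIV :: (real^'n) set))" using W by (simp add: open_Times)
    have fst: "smooth_on (W \<times> (UNIV :: (real^'n) set)) (\<lambda>z. g (fst z))" if "smooth_on W g"
      for g :: "'a \<Rightarrow> 'c::real_normed_vector"
      by (rule smooth_on_compose[OF o W(1) smooth_on_linear[OF bounded_linear_fst o] that]) auto
    have "smooth_on W (\<lambda>x. fd f x (b (e j) x) $ i)" for i j
      by (rule smooth_on_linear_compose[OF bounded_linear_vec_nth W(1)],
          rule smooth_on_fd_apply[OF W(1) W smooth_on_linear[OF bounded_linear_ident W(1)] b[OF ek]]) simp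
    then have entry: "smooth_on (W \<times> (UNIV :: (real^'n) set)) (\<lambda>z. A (fst z) $ i $ j)" for i j
      unfolding A_def vec_lambda_beta by (rule fst)
    have vec: "smooth_on (W \<times> (UNIV :: (real^'n) set)) (\<lambda>z. snd z $ i)" for i
      by (intro smooth_on_linear_compose[OF bounded_linear_vec_nth o] smooth_on_linear[OF bounded_linear_snd o])
    have col: "smooth_on (W \<times> UNIV)
        (\<lambda>z. (\<chi> i j'. if j' = j then snd z $ i else A (fst z) $ i $ j') $ i $ j')" for i j j'
      using entry vec by (cases "j' = j") simp_all
    have "smooth_on (W \<times> UNIV) (\<lambda>z. \<sigma> (fst z) (snd z) $ j)" for j
      unfolding \<sigma>_def vec_lambda_beta
      by (rule smooth_on_divide[OF o smooth_on_det[OF o col] smooth_on_det[OF o entry]])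
         (use detA in auto)
    then show ?thesis
      unfolding h_def by (intro smooth_on_sum[OF o] smooth_on_scaleR[OF o] fst[OF b[OF ek]])
  qed
  moreover have "fd f x (h x w) = w" if "x \<in> W" for x w
    unfolding h_def A_mult[OF that, symmetric] by (rule \<sigma>[OF that])
  moreover have "h x w \<in> S x" if "x \<in> W" for x w unfolding h_def by (rule inS[OF that])
  ultimately show ?thesis by (intro exI[of _ h] conjI ballI allI) simp_all
qed

lemma vertical_iff_fd_zero:
  assumes B: "smooth_atlas B" and A: "smooth_atlas A" and \<pi>: "smooth_map B A \<pi>"
    and v: "v \<in> tangent_space B q" and ch: "\<kappa> \<in> B" "q \<in> fst \<kappa>" "\<mu> \<in> A" "\<pi> q \<in> fst \<mu>"
  shows "v \<in> vertical_space B A \<pi> q \<longleftrightarrow> fd (local_rep \<kappa> \<mu> \<pi>) (snd \<kappa> q) (v \<kappa>) = 0"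
  using tv_eq_zero_iff[OF A tangent_map_in_tangent_space[OF B A \<pi> v in_ptsI[OF ch(1,2)]] ch(3,4)] v
    tangent_map_in_chart[OF B \<pi> v ch]
  by (simp add: vertical_space_def)

definition fiber_coords :: "('q, 'f) chart \<Rightarrow> ('q \<times> ('q, 'f) tvec) set \<Rightarrow> 'q \<Rightarrow> 'f set" where
  "fiber_coords \<kappa> L q = (\<lambda>v. v \<kappa>) ` (L `` {q})"

lemma horizontal_in_tangent_space:
  assumes "horizontal_distribution B A \<pi> L" "(q, l) \<in> L"
  shows "l \<in> tangent_space B q"
proof -
  have "L \<subseteq> (SIGMA q : pts B. tangent_space B q)"
    using assms(1) by (simp add: horizontal_distribution_def smooth_distribution_def)
  then show ?thesis using assms(2) by blast
qed

lemma horizontal_complement: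
  assumes "horizontal_distribution B A \<pi> L" "q \<in> pts B"
  shows "L `` {q} \<inter> vertical_space B A \<pi> q = {tv_zero}"
    and "tangent_space B q = {tv_add l k |l k. l \<in> L `` {q} \<and> k \<in> vertical_space B A \<pi> q}"
  using assms unfolding horizontal_distribution_def by simp_all

lemma horizontal_decomposition:
  assumes "horizontal_distribution B A \<pi> L" "q \<in> pts B" "v \<in> tangent_space B q"
  obtains l k where "(q, l) \<in> L" "k \<in> vertical_space B A \<pi> q" "v = tv_add l k"
proof -
  have "v \<in> {tv_add l k |l k. l \<in> L `` {q} \<and> k \<in> vertical_space B A \<pi> q}"
    using assms(3) horizontal_complement(2)[OF assms(1,2)] by simp
  then show ?thesis using that by blast
qed

lemma horizontal_vertical_zero:
  assumes "horizontal_distribution B A \<pi> L" "q \<in> pts B" "(q, l) \<in> L" "l \<in> vertical_space B A \<pi> q"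
  shows "l = tv_zero"
  using horizontal_complement(1)[OF assms(1,2)] assms(3,4) by blast

lemma fiber_coords_frame:
  assumes "horizontal_distribution B A \<pi> L" "\<kappa> \<in> B" "q \<in> fst \<kappa>"
  obtains k :: nat and W and b :: "nat \<Rightarrow> 'f \<Rightarrow> 'f::euclidean_space"
  where "open W" "snd \<kappa> q \<in> W" "\<And>i. i < k \<Longrightarrow> smooth_on W (b i)"
    and "\<And>x. x \<in> W \<Longrightarrow> inj_on (\<lambda>i. b i x) {..<k} \<and> independent ((\<lambda>i. b i x) ` {..<k}) \<and>
      fiber_coords \<kappa> L (chart_inv \<kappa> x) = span ((\<lambda>i. b i x) ` {..<k})"
proof -
  have "smooth_distribution B L" using assms(1) by (simp add: horizontal_distribution_def)
  then obtain k :: nat where k: "\<forall>\<kappa>\<in>B. \<forall>q\<in>fst \<kappa>. \<exists>W b.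
        open W \<and> snd \<kappa> q \<in> W \<and> W \<subseteq> snd \<kappa> ` fst \<kappa> \<and>
        (\<forall>i<k. smooth_on W (b i)) \<and>
        (\<forall>x\<in>W. inj_on (\<lambda>i. b i x) {..<k} \<and> independent ((\<lambda>i. b i x) ` {..<k}) \<and>
           (\<lambda>v. v \<kappa>) ` (L `` {chart_inv \<kappa> x}) = span ((\<lambda>i. b i x) ` {..<k}))"
    unfolding smooth_distribution_def by (elim conjE exE) (rule that)
  obtain W b where "open W" "snd \<kappa> q \<in> W" "\<forall>i<k. smooth_on W (b i)"
    "\<forall>x\<in>W. inj_on (\<lambda>i. b i x) {..<k} \<and> independent ((\<lambda>i. b i x) ` {..<k}) \<and>
           (\<lambda>v. v \<kappa>) ` (L `` {chart_inv \<kappa> x}) = span ((\<lambda>i. b i x) ` {..<k})"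
    using bspec[OF bspec[OF k assms(2)] assms(3)] by (elim exE conjE) (rule that)
  then show ?thesis by (intro that[of W k b]) (simp_all add: fiber_coords_def)
qed

lemma subspace_fiber_coords:
  assumes "smooth_atlas B" "horizontal_distribution B A \<pi> L" "\<kappa> \<in> B" "q \<in> fst \<kappa>"
  shows "subspace (fiber_coords \<kappa> L q)"
proof -
  obtain k :: nat and W b where "snd \<kappa> q \<in> W"
    "\<And>x. x \<in> W \<Longrightarrow> inj_on (\<lambda>i. b i x) {..<k} \<and> independent ((\<lambda>i. b i x) ` {..<k}) \<and>
      fiber_coords \<kappa> L (chart_inv \<kappa> x) = span ((\<lambda>i. b i x) ` {..<k})"
    by (rule fiber_coords_frame[OF assms(2-4)]) (rule that)
  then have "fiber_coords \<kappa> L (chart_inv \<kappa> (snd \<kappa> q)) = span ((\<lambda>i. b i (snd \<kappa> q)) ` {..<k})" by simp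
  then show ?thesis using chart_inv_snd[OF assms(1,3,4)] by simp
qed

text \<open>The derivative is injective on a fiber of the complement because a horizontal vector that it
  kills is vertical, hence zero. It is still surjective there because every tangent vector differs
  from a horizontal one by a vertical vector.\<close>

lemma fiber_coords_iso:
  assumes B: "smooth_atlas B" and A: "smooth_atlas A" and \<pi>: "smooth_submersion B A \<pi>"
    and L: "horizontal_distribution B A \<pi> L"
    and ch: "\<kappa> \<in> B" "q \<in> fst \<kappa>" "\<mu> \<in> A" "\<pi> q \<in> fst \<mu>"
  shows "y \<in> fiber_coords \<kappa> L q \<Longrightarrow> fd (local_rep \<kappa> \<mu> \<pi>) (snd \<kappa> q) y = 0 \<Longrightarrow> y = 0"
    and "\<exists>y\<in>fiber_coords \<kappa> L q. fd (local_rep \<kappa> \<mu> \<pi>) (snd \<kappa> q) y = w"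
proof -
  let ?D = "fd (local_rep \<kappa> \<mu> \<pi>) (snd \<kappa> q)"
  have sm: "smooth_map B A \<pi>" using \<pi> by (simp add: smooth_submersion_def)
  note vert = vertical_iff_fd_zero[OF B A sm _ ch] and q = in_ptsI[OF ch(1,2)]
  show "y = 0" if "y \<in> fiber_coords \<kappa> L q" "?D y = 0"
  proof -
    obtain l where l: "(q, l) \<in> L" "y = l \<kappa>" using \<open>y \<in> _\<close> by (auto simp: fiber_coords_def)
    then have "l = tv_zero"
      using horizontal_vertical_zero[OF L q] vert[OF horizontal_in_tangent_space[OF L]] that(2) by metis
    then show ?thesis using l by (simp add: tv_zero_def)
  qed
  obtain u where u: "u \<in> tangent_space A (\<pi> q)" "u \<mu> = w"
    using tangent_vector_with_coordinates[OF A ch(3,4)] by blast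
  then obtain v where v: "v \<in> tangent_space B q" "u = tangent_map B A \<pi> q v"
    using \<pi> q unfolding smooth_submersion_def by blast
  obtain l k where lk: "(q, l) \<in> L" "k \<in> vertical_space B A \<pi> q" "v = tv_add l k"
    using horizontal_decomposition[OF L q v(1)] .
  have kt: "k \<in> tangent_space B q" using lk by (simp add: vertical_space_def)
  have "linear ?D" by (rule linear_frechet_derivative[OF local_rep_diff[OF sm ch(1,3,2,4)]])
  then have "?D (v \<kappa>) = ?D (l \<kappa>) + ?D (k \<kappa>)" using lk(3) by (simp add: tv_add_def linear_add)
  then have "?D (l \<kappa>) = w"
    using u v tangent_map_in_chart[OF B sm v(1) ch] vert[OF kt] lk(2) by simp
  then show "\<exists>y\<in>fiber_coords \<kappa> L q. ?D y = w" using lk(1) by (auto simp: fiber_coords_def)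
qed

text \<open>The lift \<open>h\<close> describes the complement by a smooth function: \<open>y\<close> is horizontal at \<open>x\<close> exactly if
  \<open>h(x, Df(x) y) = y\<close>. Smoothness of horizontal fields and curves can thus be read off from their
  projections.\<close>

lemma smooth_horizontal_lift:
  fixes A :: "('p, real^'n) chart set" and B :: "('q, 'f::euclidean_space) chart set"
  assumes B: "smooth_atlas B" and A: "smooth_atlas A" and \<pi>: "smooth_submersion B A \<pi>"
    and L: "horizontal_distribution B A \<pi> L"
    and ch: "\<kappa> \<in> B" "q \<in> fst \<kappa>" "\<mu> \<in> A" "\<pi> q \<in> fst \<mu>"
  obtains W h where "open W" "snd \<kappa> q \<in> W" "W \<subseteq> snd \<kappa> ` (fst \<kappa> \<inter> \<pi> -` fst \<mu>)"
    "smooth_on (W \<times> UNIV) (\<lambda>z. h (fst z) (snd z))"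
    "\<And>x w. x \<in> W \<Longrightarrow> h x w \<in> fiber_coords \<kappa> L (chart_inv \<kappa> x)"
    "\<And>x w. x \<in> W \<Longrightarrow> fd (local_rep \<kappa> \<mu> \<pi>) x (h x w) = w"
    "\<And>x y. x \<in> W \<Longrightarrow> y \<in> fiber_coords \<kappa> L (chart_inv \<kappa> x) \<Longrightarrow> h x (fd (local_rep \<kappa> \<mu> \<pi>) x y) = y"
proof -
  let ?f = "local_rep \<kappa> \<mu> \<pi>" and ?S = "snd \<kappa> ` (fst \<kappa> \<inter> \<pi> -` fst \<mu>)"
  let ?V = "\<lambda>x. fiber_coords \<kappa> L (chart_inv \<kappa> x)"
  have sm: "smooth_map B A \<pi>" using \<pi> by (simp add: smooth_submersion_def)
  note f = smooth_local_rep[OF sm ch(1,3)]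
  obtain k W0 and b :: "nat \<Rightarrow> _" where W0: "open W0" "snd \<kappa> q \<in> W0" "\<And>i. i < k \<Longrightarrow> smooth_on W0 (b i)"
    and frame: "\<And>x. x \<in> W0 \<Longrightarrow> inj_on (\<lambda>i. b i x) {..<k} \<and> independent ((\<lambda>i. b i x) ` {..<k}) \<and>
      ?V x = span ((\<lambda>i. b i x) ` {..<k})"
    by (rule fiber_coords_frame[OF L ch(1,2)]) (rule that)
  define W where "W = W0 \<inter> ?S"
  have W: "open W" "snd \<kappa> q \<in> W" "W \<subseteq> ?S" using W0 f(1) ch by (auto simp: W_def)
  have pt: "\<exists>p. p \<in> fst \<kappa> \<and> \<pi> p \<in> fst \<mu> \<and> x = snd \<kappa> p \<and> chart_inv \<kappa> x = p" if "x \<in> W" for x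
  proof -
    obtain p where p: "p \<in> fst \<kappa>" "\<pi> p \<in> fst \<mu>" "x = snd \<kappa> p" using \<open>x \<in> W\<close> by (auto simp: W_def)
    then show ?thesis using chart_inv_snd[OF B ch(1) p(1)] by blast
  qed
  have inj: "y = 0" if "x \<in> W" "y \<in> ?V x" "fd ?f x y = 0" for x y
    using pt[OF that(1)] fiber_coords_iso(1)[OF B A \<pi> L ch(1) _ ch(3)] that by metis
  have surj: "\<exists>y\<in>?V x. fd ?f x y = w" if "x \<in> W" for x w
    using pt[OF that(1)] fiber_coords_iso(2)[OF B A \<pi> L ch(1) _ ch(3)] that by metis
  have "\<exists>h. smooth_on (W \<times> UNIV) (\<lambda>z. h (fst z) (snd z)) \<and>
      (\<forall>x\<in>W. \<forall>w. h x w \<in> ?V x \<and> fd ?f x (h x w) = w)"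
  proof (rule smooth_right_inverse_on_frame[OF W(1) smooth_on_subset[OF f(2) W(3)], of k b])
    show "smooth_on W (b i)" if "i < k" for i
      by (rule smooth_on_subset[OF W0(3)[OF that]]) (simp add: W_def)
  qed (use inj surj frame W(2) in \<open>auto simp: W_def\<close>)
  then obtain h where h: "smooth_on (W \<times> UNIV) (\<lambda>z. h (fst z) (snd z))"
    "\<And>x w. x \<in> W \<Longrightarrow> h x w \<in> ?V x" "\<And>x w. x \<in> W \<Longrightarrow> fd ?f x (h x w) = w" by blast
  have "h x (fd ?f x y) = y" if x: "x \<in> W" and y: "y \<in> ?V x" for x y
  proof -
    have lin: "linear (fd ?f x)" using linear_fd[OF f(2)] x W(3) by blast
    have "subspace (?V x)" using frame x by (simp add: W_def)
    then have "h x (fd ?f x y) - y \<in> ?V x" using h(2)[OF x] y by (simp add: subspace_diff)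
    moreover have "fd ?f x (h x (fd ?f x y) - y) = 0" using h(3)[OF x] by (simp add: linear_diff[OF lin])
    ultimately show ?thesis using inj[OF x] by fastforce
  qed
  then show ?thesis using that W h by blast
qed

section \<open>Submersions relate the spray coefficients\<close>

lemma spray_submersionD:
  assumes "spray_submersion B H A G \<pi> L"
  shows "smooth_atlas B" "smooth_atlas A" "spray B H" "spray A G" "smooth_submersion B A \<pi>"
    "smooth_map B A \<pi>" "horizontal_distribution B A \<pi> L"
    and "u \<in> L \<inter> slit_bundle B \<Longrightarrow> tangent_to (tangent_atlas B) (L \<inter> slit_bundle B) u (H u)"
    and "geodesic B H I c \<Longrightarrow> velocity_lift B c ` I \<subseteq> L \<inter> slit_bundle B \<Longrightarrow> geodesic A G I (\<pi> \<circ> c)"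
  using assms
  by (simp_all add: spray_submersion_def smooth_manifold_def smooth_submersion_def)

text \<open>A curve in the complement satisfies \<open>b = h(a, Df(a) b)\<close>
  in coordinates; differentiating this identity along a curve with velocity \<open>H\<close> expresses the
  coefficients of \<open>H\<close> by the derivative of \<open>h\<close>.\<close>

lemma spray_tangent_to_horizontal:
  fixes A :: "('p, 'e::euclidean_space) chart set" and B :: "('q, 'f::euclidean_space) chart set"
  assumes sub: "spray_submersion B H A G \<pi> L"
    and ch: "\<kappa> \<in> B" "\<mu> \<in> A"
    and W: "open W" "W \<subseteq> snd \<kappa> ` (fst \<kappa> \<inter> \<pi> -` fst \<mu>)"
    and h: "smooth_on (W \<times> UNIV) (\<lambda>z. h (fst z) (snd z))"
      "\<And>x w. x \<in> W \<Longrightarrow> h x w \<in> fiber_coords \<kappa> L (chart_inv \<kappa> x)"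
      "\<And>x w. x \<in> W \<Longrightarrow> fd (local_rep \<kappa> \<mu> \<pi>) x (h x w) = w"
      "\<And>x y. x \<in> W \<Longrightarrow> y \<in> fiber_coords \<kappa> L (chart_inv \<kappa> x) \<Longrightarrow> h x (fd (local_rep \<kappa> \<mu> \<pi>) x y) = y"
    and x: "x \<in> W" and w: "w \<noteq> 0"
  defines "y \<equiv> h x w"
  shows "fd (\<lambda>z. h (fst z) (snd z)) (x, w)
      (y, snd (fd (prolong (local_rep \<kappa> \<mu> \<pi>)) (x, y) (y, - 2 *\<^sub>R spray_coeff B H \<kappa> x y)))
    = - 2 *\<^sub>R spray_coeff B H \<kappa> x y"
proof -
  define f where "f = local_rep \<kappa> \<mu> \<pi>"
  let ?hh = "\<lambda>z. h (fst z) (snd z)"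
  note B = spray_submersionD(1)[OF sub] and H = spray_submersionD(3)[OF sub]
    and \<pi> = spray_submersionD(6)[OF sub] and L = spray_submersionD(7)[OF sub]
  note f = smooth_local_rep[OF \<pi> ch, folded f_def]
  have fW: "smooth_on W f" using smooth_on_subset[OF f(2) W(2)] .
  obtain p where p: "p \<in> fst \<kappa>" "snd \<kappa> p = x" using x W(2) by auto
  have px: "chart_inv \<kappa> x = p" using chart_inv_snd[OF B ch(1) p(1)] p(2) by simp
  have "y \<in> fiber_coords \<kappa> L p" using h(2)[OF x] px by (simp add: y_def)
  then obtain l where l: "(p, l) \<in> L" "l \<kappa> = y" by (auto simp: fiber_coords_def)
  have lt: "l \<in> tangent_space B p" by (rule horizontal_in_tangent_space[OF L l(1)])
  have "y \<noteq> 0" using h(3)[OF x, of w] w linear_0[OF linear_fd[OF fW x]] by (auto simp: y_def f_def)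
  then have nz: "l \<noteq> tv_zero" using l by (auto simp: tv_zero_def)
  have "(p, l) \<in> L \<inter> slit_bundle B" using l lt nz in_ptsI[OF ch(1) p(1)] by (simp add: slit_bundle_iff)
  from spray_submersionD(8)[OF sub this]
  obtain \<epsilon> \<gamma> where g: "\<epsilon> > 0" "smooth_curve (tangent_atlas B) {-\<epsilon><..<\<epsilon>} \<gamma>"
    "\<gamma> ` {-\<epsilon><..<\<epsilon>} \<subseteq> L \<inter> slit_bundle B" "\<gamma> 0 = (p, l)" "velocity (tangent_atlas B) \<gamma> 0 = H (p, l)"
    unfolding tangent_to_def by blast
  let ?I = "{-\<epsilon><..<\<epsilon>}"
  define \<zeta> where "\<zeta> t = snd (tchart B \<kappa>) (\<gamma> t)" for t
  have tc: "tchart B \<kappa> \<in> tangent_atlas B" using ch by (simp add: tangent_atlas_def)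
  have \<zeta>0: "\<zeta> 0 = (x, y)" using g l p by (simp add: \<zeta>_def tchart_simps)
  have "(\<zeta> has_vector_derivative H (p, l) (tchart B \<kappa>)) (at 0)"
    using has_velocity[OF g(2) tc, of 0] g lt p unfolding \<zeta>_def by (simp add: tchart_simps)
  then have d\<zeta>: "(\<zeta> has_vector_derivative (y, - 2 *\<^sub>R spray_coeff B H \<kappa> x y)) (at 0)"
    by (simp add: spray_in_chart[OF B H ch(1) p(1) lt nz] l(2) p(2))
  note d1 = bounded_linear.has_vector_derivative[OF bounded_linear_fst d\<zeta>, simplified]
    and d2 = bounded_linear.has_vector_derivative[OF bounded_linear_snd d\<zeta>, simplified]
  have z0: "fst (\<zeta> 0) \<in> W" "fst (\<zeta> 0) = x" "snd (\<zeta> 0) = y" using \<zeta>0 x by simp_all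
  have dw: "((\<lambda>t. fd f (fst (\<zeta> t)) (snd (\<zeta> t))) has_vector_derivative
      fd (\<lambda>z. fd f z y) x y + fd f x (- 2 *\<^sub>R spray_coeff B H \<kappa> x y)) (at 0)"
    using has_vector_derivative_fd_along[of W f "\<lambda>t. fst (\<zeta> t)" 0, OF W(1) fW z0(1) d1 d2] z0 by simp
  let ?K = "fd (\<lambda>z. fd f z y) x y + fd f x (- 2 *\<^sub>R spray_coeff B H \<kappa> x y)"
  have dp: "((\<lambda>t. (fst (\<zeta> t), fd f (fst (\<zeta> t)) (snd (\<zeta> t)))) has_vector_derivative (y, ?K)) (at 0)"
    using has_derivative_Pair[OF d1[unfolded has_vector_derivative_def] dw[unfolded has_vector_derivative_def]]
    by (simp add: has_vector_derivative_def)
  have fy: "fd f x y = w" using h(3)[OF x] by (simp add: f_def y_def)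
  have "(?hh has_derivative fd ?hh (x, w)) (at (x, w))"
    by (rule smooth_on_has_derivative[OF h(1)]) (use x in simp)
  then have "(?hh has_derivative fd ?hh (x, w)) (at (fst (\<zeta> 0), fd f (fst (\<zeta> 0)) (snd (\<zeta> 0))))"
    using z0 fy by simp
  from has_vector_derivative_compose[OF dp this]
  have dh: "((\<lambda>t. h (fst (\<zeta> t)) (fd f (fst (\<zeta> t)) (snd (\<zeta> t)))) has_vector_derivative
      fd ?hh (x, w) (y, ?K)) (at 0)" by simp
  let ?J = "(?I \<inter> \<gamma> -` fst (tchart B \<kappa>)) \<inter> \<zeta> -` (W \<times> UNIV)"
  have J: "open ?J"
    by (rule continuous_open_preimage[OF smooth_on_continuous_on smooth_curveD(1)[OF g(2) tc]])
       (use smooth_curveD(2)[OF g(2) tc] W in \<open>simp_all add: \<zeta>_def[abs_def] open_Times\<close>)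
  have J0: "0 \<in> ?J" using g lt p z0 x by (simp add: tchart_simps \<zeta>0)
  have "((\<lambda>t. snd (\<zeta> t)) has_vector_derivative fd ?hh (x, w) (y, ?K)) (at 0)"
  proof (rule has_vector_derivative_transform_within_open[OF dh J J0])
    fix t assume t: "t \<in> ?J"
    obtain p' v' where pv: "\<gamma> t = (p', v')" by fastforce
    have L': "(p', v') \<in> L" using g(3) t pv by (metis IntD1 image_subset_iff)
    have p': "p' \<in> fst \<kappa>" using t pv by (simp add: tchart_simps)
    have z: "\<zeta> t = (snd \<kappa> p', v' \<kappa>)" by (simp add: \<zeta>_def pv tchart_simps)
    have "v' \<kappa> \<in> fiber_coords \<kappa> L (chart_inv \<kappa> (snd \<kappa> p'))"
      using L' chart_inv_snd[OF B ch(1) p'] by (auto simp: fiber_coords_def)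
    then show "h (fst (\<zeta> t)) (fd f (fst (\<zeta> t)) (snd (\<zeta> t))) = snd (\<zeta> t)"
      using h(4)[of "snd \<kappa> p'" "v' \<kappa>"] t z by (simp add: f_def)
  qed
  from vector_derivative_unique_at[OF this d2]
  show ?thesis unfolding f_def[symmetric] using fd_prolong[OF W(1) fW x, of y] by simp
qed

text \<open>The equation solved here is the equation of geodesics of \<open>H\<close> for a horizontal initial
  velocity, written for the point \<open>x\<close> and the projected velocity \<open>w\<close>: the velocity of \<open>x\<close> is the
  horizontal lift \<open>h(x, w)\<close>, and \<open>w\<close> changes in the way the projection of a geodesic requires.
  By tangency of \<open>H\<close> the second derivative of \<open>x\<close> is correct as well, so that \<open>x\<close> is a geodesic with
  horizontal velocity. Its projection is a geodesic of \<open>G\<close>, and comparing accelerations at time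
  \<open>0\<close> gives the relation.\<close>

lemma horizontal_spray_relation:
  fixes A :: "('p, real^'n) chart set" and B :: "('q, 'f::euclidean_space) chart set"
  assumes sub: "spray_submersion B H A G \<pi> L"
    and ch: "\<kappa> \<in> B" "q \<in> fst \<kappa>" "\<mu> \<in> A" "\<pi> q \<in> fst \<mu>"
    and y: "y \<in> fiber_coords \<kappa> L q" "y \<noteq> 0"
  defines "f \<equiv> local_rep \<kappa> \<mu> \<pi>"
  shows "fd (\<lambda>z. fd f z y) (snd \<kappa> q) y - 2 *\<^sub>R fd f (snd \<kappa> q) (spray_coeff B H \<kappa> (snd \<kappa> q) y)
    = - 2 *\<^sub>R spray_coeff A G \<mu> (snd \<mu> (\<pi> q)) (fd f (snd \<kappa> q) y)"
proof -
  note B = spray_submersionD(1)[OF sub] and A = spray_submersionD(2)[OF sub]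
    and H = spray_submersionD(3)[OF sub] and G = spray_submersionD(4)[OF sub]
    and \<pi>s = spray_submersionD(5)[OF sub]
    and \<pi> = spray_submersionD(6)[OF sub] and L = spray_submersionD(7)[OF sub]
  obtain W h where W: "open W" "snd \<kappa> q \<in> W" "W \<subseteq> snd \<kappa> ` (fst \<kappa> \<inter> \<pi> -` fst \<mu>)"
    and h: "smooth_on (W \<times> UNIV) (\<lambda>z. h (fst z) (snd z))"
      "\<And>x w. x \<in> W \<Longrightarrow> h x w \<in> fiber_coords \<kappa> L (chart_inv \<kappa> x)"
      "\<And>x w. x \<in> W \<Longrightarrow> fd f x (h x w) = w"
      "\<And>x y. x \<in> W \<Longrightarrow> y \<in> fiber_coords \<kappa> L (chart_inv \<kappa> x) \<Longrightarrow> h x (fd f x y) = y"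
    by (rule smooth_horizontal_lift[OF B A \<pi>s L ch, folded f_def]) (rule that)
  note f = smooth_local_rep[OF \<pi> ch(1,3), folded f_def]
  have fW: "smooth_on W f" using smooth_on_subset[OF f(2) W(3)] .
  have lin: "linear (fd f x)" if "x \<in> W" for x using linear_fd[OF fW that] .
  define x0 where "x0 = snd \<kappa> q"
  define w0 where "w0 = fd f x0 y"
  have x0: "x0 \<in> W" "chart_inv \<kappa> x0 = q" using W(2) chart_inv_snd[OF B ch(1,2)] by (simp_all add: x0_def)
  have hy: "h x0 w0 = y" using h(4)[OF x0(1)] y x0 by (simp add: w0_def)
  have w0: "w0 \<noteq> 0"
    using fiber_coords_iso(1)[OF B A \<pi>s L ch y(1)] y(2) by (auto simp: w0_def f_def x0_def)
  define \<Omega> :: "('f \<times> (real^'n)) set" where "\<Omega> = W \<times> (UNIV - {0})"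
  have \<Omega>: "open \<Omega>" "(x0, w0) \<in> \<Omega>" using W x0 w0 by (simp_all add: \<Omega>_def open_Times open_delete)
  let ?hh = "\<lambda>z. h (fst z) (snd z)"
  let ?g = "\<lambda>z. spray_coeff B H \<kappa> (fst z) (snd z)"
  define \<Phi> where "\<Phi> z = (?hh z,
    snd (fd (prolong f) (fst z, ?hh z) (?hh z, - 2 *\<^sub>R ?g (fst z, ?hh z))))" for z
  have hnz: "?hh z \<noteq> 0" if "z \<in> \<Omega>" for z
  proof
    assume 0: "?hh z = 0"
    have "fst z \<in> W" "snd z \<noteq> 0" using that by (auto simp: \<Omega>_def)
    then show False using h(3)[of "fst z" "snd z"] linear_0[OF lin] 0 by simp
  qed
  have sub\<Omega>: "\<Omega> \<subseteq> W \<times> UNIV" by (auto simp: \<Omega>_def)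
  have s1: "smooth_on \<Omega> ?hh" by (rule smooth_on_subset[OF h(1) sub\<Omega>])
  have s2: "smooth_on \<Omega> (\<lambda>z. (fst z, ?hh z))"
    by (rule smooth_on_Pair[OF \<Omega>(1) smooth_on_linear[OF bounded_linear_fst \<Omega>(1)] s1])
  have oD: "open (snd \<kappa> ` fst \<kappa> \<times> (UNIV - {0 :: 'f}))"
    using open_chart_image[OF B ch(1)] by (simp add: open_Times open_delete)
  have s3: "smooth_on \<Omega> (\<lambda>z. ?g (fst z, ?hh z))"
  proof (rule smooth_on_compose[OF \<Omega>(1) oD s2 smooth_spray_coeff[OF B H ch(1)]])
    show "(\<lambda>z. (fst z, ?hh z)) ` \<Omega> \<subseteq> snd \<kappa> ` fst \<kappa> \<times> (UNIV - {0})"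
      using hnz W(3) by (fastforce simp: \<Omega>_def)
  qed
  have oW: "open (W \<times> (UNIV :: 'f set))" using W by (simp add: open_Times)
  have s4: "smooth_on \<Omega> (\<lambda>z. fd (prolong f) (fst z, ?hh z) (?hh z, - 2 *\<^sub>R ?g (fst z, ?hh z)))"
    by (rule smooth_on_fd_apply[OF \<Omega>(1) oW smooth_on_prolong[OF W(1) fW] s2
        smooth_on_Pair[OF \<Omega>(1) s1 smooth_on_linear_compose[OF bounded_linear_scaleR_right \<Omega>(1) s3]]])
       (auto simp: \<Omega>_def)
  have s\<Phi>: "smooth_on \<Omega> \<Phi>"
    unfolding \<Phi>_def by (rule smooth_on_Pair[OF \<Omega>(1) s1 smooth_on_linear_compose[OF bounded_linear_snd \<Omega>(1) s4]])
  obtain \<epsilon> u where e: "\<epsilon> > 0" and u: "u 0 = (x0, w0)" "smooth_on {-\<epsilon><..<\<epsilon>} u"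
    "\<And>t. t \<in> {-\<epsilon><..<\<epsilon>} \<Longrightarrow> u t \<in> \<Omega> \<and> (u has_vector_derivative \<Phi> (u t)) (at t)"
    using ode_solution_exists[OF \<Omega>(1) s\<Phi> \<Omega>(2)] by blast
  let ?I = "{-\<epsilon><..<\<epsilon>}"
  define x where "x t = fst (u t)" for t
  define Y where "Y t = ?hh (u t)" for t
  define d where "d t = chart_inv \<kappa> (x t)" for t
  have xW: "x t \<in> W" and snz: "snd (u t) \<noteq> 0" if "t \<in> ?I" for t
    using u(3)[OF that] by (auto simp: x_def \<Omega>_def)
  have dx: "(x has_vector_derivative Y t) (at t)" if "t \<in> ?I" for t
    using bounded_linear.has_vector_derivative[OF bounded_linear_fst conjunct2[OF u(3)[OF that]]]
    by (simp add: x_def[abs_def] Y_def \<Phi>_def)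
  \<comment> \<open>The derivative of \<open>h(x, w)\<close> along the solution is the one computed from tangency.\<close>
  have dY: "(Y has_vector_derivative - 2 *\<^sub>R spray_coeff B H \<kappa> (x t) (Y t)) (at t)" if t: "t \<in> ?I" for t
  proof -
    have "(?hh has_derivative fd ?hh (u t)) (at (u t))"
      using smooth_on_has_derivative[OF s1] u(3)[OF t] by blast
    from has_vector_derivative_compose[OF conjunct2[OF u(3)[OF t]] this]
    have "(Y has_vector_derivative fd ?hh (u t) (\<Phi> (u t))) (at t)" by (simp add: Y_def[abs_def])
    moreover have "fd ?hh (u t) (\<Phi> (u t)) = - 2 *\<^sub>R spray_coeff B H \<kappa> (x t) (Y t)"
      using spray_tangent_to_horizontal[OF sub ch(1,3) W(1,3), folded f_def, OF h xW[OF t] snz[OF t]]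
      by (simp add: \<Phi>_def x_def Y_def)
    ultimately show ?thesis by simp
  qed
  have dk: "d t \<in> fst \<kappa>" "\<pi> (d t) \<in> fst \<mu>" "snd \<kappa> (d t) = x t" if t: "t \<in> ?I" for t
  proof -
    obtain p where p: "p \<in> fst \<kappa>" "\<pi> p \<in> fst \<mu>" "x t = snd \<kappa> p" using xW[OF t] W(3) by auto
    then have "d t = p" using chart_inv_snd[OF B ch(1) p(1)] by (simp add: d_def)
    then show "d t \<in> fst \<kappa>" "\<pi> (d t) \<in> fst \<mu>" "snd \<kappa> (d t) = x t" using p by simp_all
  qed
  have I: "open ?I" "is_interval ?I" "?I \<noteq> {}" "0 \<in> ?I" using e by (auto intro: is_interval_oo)
  have "smooth_on ?I x"
    unfolding x_def by (rule smooth_on_linear_compose[OF bounded_linear_fst I(1) u(2)])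
  then have "smooth_on ?I (\<lambda>t. snd \<kappa> (d t))"
    by (rule smooth_on_cong[OF I(1)]) (simp add: dk(3))
  then have dc: "smooth_curve B ?I d"
    by (intro smooth_curve_in_chart[OF B I(1-3) ch(1)]) (use dk in auto)
  have vd: "velocity B d t \<kappa> = Y t" if t: "t \<in> ?I" for t
  proof -
    have "((\<lambda>t. snd \<kappa> (d t)) has_vector_derivative Y t) (at t)"
      by (rule has_vector_derivative_transform_within_open[OF dx[OF t] I(1) t]) (simp add: dk(3))
    then show ?thesis by (simp add: velocity_in_chart[OF ch(1), of d t, OF dk(1)[OF t]] vector_derivative_at)
  qed
  have vt: "velocity B d t \<in> tangent_space B (d t)" if "t \<in> ?I" for t
    by (rule velocity_in_tangent_space[OF B dc that])
  have Ynz: "Y t \<noteq> 0" if "t \<in> ?I" for t using hnz u(3)[OF that] by (simp add: Y_def)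
  have vnz: "velocity B d t \<noteq> tv_zero" if "t \<in> ?I" for t
    using Ynz[OF that] vd[OF that] by (auto simp: tv_zero_def)
  \<comment> \<open>The velocity \<open>h(x, w)\<close> is horizontal by the choice of \<open>h\<close>.\<close>
  have vL: "velocity_lift B d t \<in> L \<inter> slit_bundle B" if t: "t \<in> ?I" for t
  proof -
    have "Y t \<in> fiber_coords \<kappa> L (d t)" using h(2)[OF xW[OF t]] by (simp add: Y_def d_def x_def)
    then obtain l where l: "(d t, l) \<in> L" "l \<kappa> = Y t" by (auto simp: fiber_coords_def)
    have "l = velocity B d t"
      by (rule tangent_space_eqI[OF horizontal_in_tangent_space[OF L l(1)] vt[OF t] ch(1) dk(1)[OF t]])
         (simp add: l vd[OF t])
    then show ?thesis
      using l vt[OF t] vnz[OF t] in_ptsI[OF ch(1) dk(1)[OF t]] by (simp add: velocity_lift_def slit_bundle_iff)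
  qed
  have tB: "tchart B \<kappa> \<in> tangent_atlas B" and tA: "tchart A \<mu> \<in> tangent_atlas A"
    using ch by (simp_all add: tangent_atlas_def)
  have vlc: "smooth_curve (tangent_atlas B) ?I (velocity_lift B d)"
    by (rule smooth_velocity_lift_in_chart[OF B dc ch(1)]) (use dk in auto)
  have "velocity (tangent_atlas B) (velocity_lift B d) t = H (velocity_lift B d t)" if t: "t \<in> ?I" for t
  proof (rule tangent_space_eqI[OF velocity_in_tangent_space[OF smooth_atlas_tangent_atlas[OF B] vlc t] _ tB])
    show "H (velocity_lift B d t) \<in> tangent_space (tangent_atlas B) (velocity_lift B d t)"
      using H vL[OF t] by (simp add: spray_def smooth_vector_field_on_def)
    show in_t: "velocity_lift B d t \<in> fst (tchart B \<kappa>)"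
      using vt[OF t] dk(1)[OF t] by (simp add: velocity_lift_def tchart_simps)
    have "((\<lambda>s. (x s, Y s)) has_vector_derivative (Y t, - 2 *\<^sub>R spray_coeff B H \<kappa> (x t) (Y t))) (at t)"
      using has_derivative_Pair[OF dx[OF t, unfolded has_vector_derivative_def]
          dY[OF t, unfolded has_vector_derivative_def]]
      by (simp add: has_vector_derivative_def)
    then have "((\<lambda>s. snd (tchart B \<kappa>) (velocity_lift B d s)) has_vector_derivative
        (Y t, - 2 *\<^sub>R spray_coeff B H \<kappa> (x t) (Y t))) (at t)"
      by (rule has_vector_derivative_transform_within_open[OF _ I(1) t])
         (simp add: velocity_lift_def tchart_simps dk(3) vd)
    then show "velocity (tangent_atlas B) (velocity_lift B d) t (tchart B \<kappa>)
        = H (velocity_lift B d t) (tchart B \<kappa>)"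
      using velocity_in_chart[OF tB, of "velocity_lift B d" t, OF in_t] spray_in_chart[OF B H ch(1) dk(1)[OF t] vt[OF t] vnz[OF t]]
      by (simp add: vector_derivative_at velocity_lift_def dk(3)[OF t] vd[OF t])
  qed
  then have "geodesic B H ?I d"
    unfolding geodesic_def regular_curve_def integral_curve_def using dc vnz vlc vL by blast
  then have geo: "geodesic A G ?I (\<pi> \<circ> d)"
    using spray_submersionD(9)[OF sub] vL by blast
  have d0: "d 0 = q" using u(1) x0 by (simp add: d_def x_def)
  have xY0: "x 0 = x0" "Y 0 = y" using u(1) hy by (simp_all add: x_def Y_def)
  have pc: "smooth_curve A ?I (\<pi> \<circ> d)" and
    pvc: "smooth_curve (tangent_atlas A) ?I (velocity_lift A (\<pi> \<circ> d))"
    and pvel: "velocity (tangent_atlas A) (velocity_lift A (\<pi> \<circ> d)) 0 = G (velocity_lift A (\<pi> \<circ> d) 0)"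
    and pnz: "velocity A (\<pi> \<circ> d) 0 \<noteq> tv_zero"
    using geo I(4) by (simp_all add: geodesic_def regular_curve_def integral_curve_def)
  have pv: "velocity A (\<pi> \<circ> d) t \<mu> = fd f (x t) (Y t)" if t: "t \<in> ?I" for t
    using vector_derivative_at[OF has_velocity_image[OF B \<pi> dc ch(1) t dk(1)[OF t] ch(3) dk(2)[OF t], folded f_def]]
      velocity_in_chart[OF ch(3), of "\<pi> \<circ> d" t] dk[OF t] vd[OF t] by simp
  have fx: "snd \<mu> (\<pi> (d t)) = f (x t)" if t: "t \<in> ?I" for t
    using local_rep_apply[OF B ch(1) dk(1)[OF t], of \<mu> \<pi>] dk(3)[OF t] by (simp add: f_def)
  have dfx: "((\<lambda>s. f (x s)) has_vector_derivative fd f x0 y) (at 0)"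
    using has_vector_derivative_compose[OF dx[OF I(4)], of f] smooth_on_has_derivative[OF fW x0(1)] xY0
    by simp
  have dfY: "((\<lambda>s. fd f (x s) (Y s)) has_vector_derivative
      fd (\<lambda>z. fd f z y) x0 y + fd f x0 (- 2 *\<^sub>R spray_coeff B H \<kappa> x0 y)) (at 0)"
    using has_vector_derivative_fd_along[of W f x 0, OF W(1) fW xW[OF I(4)] dx[OF I(4)] dY[OF I(4)]] xY0
    by simp
  have "((\<lambda>s. (f (x s), fd f (x s) (Y s))) has_vector_derivative
      (fd f x0 y, fd (\<lambda>z. fd f z y) x0 y + fd f x0 (- 2 *\<^sub>R spray_coeff B H \<kappa> x0 y))) (at 0)"
    using has_derivative_Pair[OF dfx[unfolded has_vector_derivative_def] dfY[unfolded has_vector_derivative_def]]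
    by (simp add: has_vector_derivative_def)
  then have "((\<lambda>s. snd (tchart A \<mu>) (velocity_lift A (\<pi> \<circ> d) s)) has_vector_derivative
      (fd f x0 y, fd (\<lambda>z. fd f z y) x0 y + fd f x0 (- 2 *\<^sub>R spray_coeff B H \<kappa> x0 y))) (at 0)"
    by (rule has_vector_derivative_transform_within_open[OF _ I(1,4)])
       (simp add: velocity_lift_def tchart_simps pv fx)
  moreover have in_t: "velocity_lift A (\<pi> \<circ> d) 0 \<in> fst (tchart A \<mu>)"
    using velocity_in_tangent_space[OF A pc I(4)] dk[OF I(4)] by (simp add: velocity_lift_def tchart_simps)
  ultimately have "snd (G (velocity_lift A (\<pi> \<circ> d) 0) (tchart A \<mu>))
      = fd (\<lambda>z. fd f z y) x0 y + fd f x0 (- 2 *\<^sub>R spray_coeff B H \<kappa> x0 y)"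
    using velocity_in_chart[OF tA, of "velocity_lift A (\<pi> \<circ> d)" 0, OF in_t] pvel by (simp add: vector_derivative_at)
  moreover have "snd (G (velocity_lift A (\<pi> \<circ> d) 0) (tchart A \<mu>))
      = - 2 *\<^sub>R spray_coeff A G \<mu> (snd \<mu> (\<pi> q)) (fd f x0 y)"
    using spray_in_chart[OF A G ch(3), of "(\<pi> \<circ> d) 0", OF _ velocity_in_tangent_space[OF A pc I(4)] pnz]
      ch(4) pv[OF I(4)] xY0 d0 by (simp add: velocity_lift_def)
  ultimately show ?thesis
    using linear_scale[OF lin[OF x0(1)], of "-2"] by (simp add: x0_def)
qed

section \<open>Projection of covariant derivatives\<close>

lemma tangent_map_eq_iff:
  assumes B: "smooth_atlas B" and A: "smooth_atlas A" and \<pi>: "smooth_map B A \<pi>"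
    and v: "v \<in> tangent_space B q" and u: "u \<in> tangent_space A (\<pi> q)"
    and ch: "\<kappa> \<in> B" "q \<in> fst \<kappa>" "\<mu> \<in> A" "\<pi> q \<in> fst \<mu>"
  shows "tangent_map B A \<pi> q v = u \<longleftrightarrow> fd (local_rep \<kappa> \<mu> \<pi>) (snd \<kappa> q) (v \<kappa>) = u \<mu>"
  using tangent_space_eqI[OF tangent_map_in_tangent_space[OF B A \<pi> v in_ptsI[OF ch(1,2)]] u ch(3,4)]
    tangent_map_in_chart[OF B \<pi> v ch] by metis

text \<open>The projection changes a vector by a vertical one, which the tangent map does not see.\<close>

lemma proj_onto_L_properties:
  assumes B: "smooth_atlas B" and A: "smooth_atlas A" and \<pi>: "smooth_submersion B A \<pi>"
    and L: "horizontal_distribution B A \<pi> L" and q: "q \<in> pts B" and v: "v \<in> tangent_space B q"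
  obtains l where "proj_onto_L B A \<pi> L (q, v) = (q, l)" "(q, l) \<in> L"
    "tangent_map B A \<pi> q l = tangent_map B A \<pi> q v"
proof -
  have sm: "smooth_map B A \<pi>" using \<pi> by (simp add: smooth_submersion_def)
  obtain \<kappa> where k: "\<kappa> \<in> B" "q \<in> fst \<kappa>" using q unfolding pts_def by blast
  have "\<pi> q \<in> pts A" using sm q unfolding smooth_map_def by blast
  then obtain \<mu> where m: "\<mu> \<in> A" "\<pi> q \<in> fst \<mu>" unfolding pts_def by blast
  let ?D = "fd (local_rep \<kappa> \<mu> \<pi>) (snd \<kappa> q)"
  have lin: "linear ?D" by (rule linear_frechet_derivative[OF local_rep_diff[OF sm k(1) m(1) k(2) m(2)]])
  have same: "?D (l \<kappa>) = ?D (v \<kappa>)" if "k' \<in> vertical_space B A \<pi> q" "v = tv_add l k'" for l k'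
  proof -
    have "k' \<in> tangent_space B q" using that(1) by (simp add: vertical_space_def)
    then have "?D (k' \<kappa>) = 0" using vertical_iff_fd_zero[OF B A sm _ k m] that(1) by blast
    then show ?thesis using that(2) by (simp add: tv_add_def linear_add[OF lin])
  qed
  obtain l k' where lk: "(q, l) \<in> L" "k' \<in> vertical_space B A \<pi> q" "v = tv_add l k'"
    using horizontal_decomposition[OF L q v] .
  have uniq: "l' = l" if "l' \<in> L `` {q} \<and> (\<exists>k\<in>vertical_space B A \<pi> q. v = tv_add l' k)" for l'
  proof -
    have l': "(q, l') \<in> L" and "?D (l' \<kappa>) = ?D (l \<kappa>)" using that same lk by auto
    then have "?D (l' \<kappa> - l \<kappa>) = 0" by (simp add: linear_diff[OF lin])
    moreover have "l' \<kappa> - l \<kappa> \<in> fiber_coords \<kappa> L q"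
      by (rule subspace_diff[OF subspace_fiber_coords[OF B L k]]) (use l' lk in \<open>auto simp: fiber_coords_def\<close>)
    ultimately have "l' \<kappa> - l \<kappa> = 0" using fiber_coords_iso(1)[OF B A \<pi> L k m] by blast
    then show "l' = l"
      using tangent_space_eqI[OF horizontal_in_tangent_space[OF L l'] horizontal_in_tangent_space[OF L lk(1)] k]
      by simp
  qed
  have "proj_onto_L B A \<pi> L (q, v) = (q, l)"
    unfolding proj_onto_L_def using lk uniq by (auto intro!: the_equality)
  moreover have "tangent_map B A \<pi> q l = tangent_map B A \<pi> q v"
    using tangent_map_eq_iff[OF B A sm horizontal_in_tangent_space[OF L lk(1)]
        tangent_map_in_tangent_space[OF B A sm v q] k m] tangent_map_in_chart[OF B sm v k m] same[OF lk(2,3)]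
    by simp
  ultimately show ?thesis using that lk(1) by blast
qed

text \<open>In coordinates the lifted field is \<open>h(x(t), X(t))\<close> with the smooth horizontal lift \<open>h\<close>.\<close>

lemma lifted_field_differentiable:
  fixes A :: "('p, real^'n) chart set" and B :: "('q, 'f::euclidean_space) chart set"
  assumes B: "smooth_atlas B" and A: "smooth_atlas A" and \<pi>: "smooth_submersion B A \<pi>"
    and L: "horizontal_distribution B A \<pi> L"
    and d: "smooth_curve B I d" and c: "\<And>s. s \<in> I \<Longrightarrow> \<pi> (d s) = c s"
    and X: "smooth_field_along A I c X" and Y: "field_lifting B A \<pi> L I d X Y"
    and t: "t \<in> I" and \<kappa>: "\<kappa> \<in> B" "d t \<in> fst \<kappa>"
  shows "(\<lambda>s. Y s \<kappa>) differentiable (at t)"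
proof -
  have sm: "smooth_map B A \<pi>" using \<pi> by (simp add: smooth_submersion_def)
  have "\<pi> (d t) \<in> pts A" using sm in_ptsI[OF \<kappa>] unfolding smooth_map_def by blast
  then obtain \<mu> where m: "\<mu> \<in> A" "\<pi> (d t) \<in> fst \<mu>" unfolding pts_def by blast
  obtain W h where W: "open W" "snd \<kappa> (d t) \<in> W" "W \<subseteq> snd \<kappa> ` (fst \<kappa> \<inter> \<pi> -` fst \<mu>)"
    and h: "smooth_on (W \<times> UNIV) (\<lambda>z. h (fst z) (snd z))"
      "\<And>x y. x \<in> W \<Longrightarrow> y \<in> fiber_coords \<kappa> L (chart_inv \<kappa> x) \<Longrightarrow> h x (fd (local_rep \<kappa> \<mu> \<pi>) x y) = y"
    by (rule smooth_horizontal_lift[OF B A \<pi> L \<kappa> m]) (rule that)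
  let ?J = "(I \<inter> d -` fst \<kappa>) \<inter> (\<lambda>s. snd \<kappa> (d s)) -` W"
  have J: "open ?J"
    by (rule continuous_open_preimage[OF smooth_on_continuous_on smooth_curveD(1)[OF d \<kappa>(1)] W(1)])
       (rule smooth_curveD(2)[OF d \<kappa>(1)])
  have inJ: "s \<in> I \<and> d s \<in> fst \<kappa> \<and> c s \<in> fst \<mu> \<and> snd \<kappa> (d s) \<in> W" if s: "s \<in> ?J" for s
  proof -
    obtain p where p: "p \<in> fst \<kappa>" "\<pi> p \<in> fst \<mu>" "snd \<kappa> p = snd \<kappa> (d s)" using s W(3) by force
    then have "p = d s" using s chart_inv_snd[OF B \<kappa>(1)] by (metis IntD1 IntD2 vimageE)
    then show ?thesis using s p c[of s] by simp
  qed
  have "smooth_on (I \<inter> c -` fst \<mu>) (\<lambda>s. X s \<mu>)" using X m(1) by (simp add: smooth_field_along_def)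
  then have sX: "smooth_on ?J (\<lambda>s. X s \<mu>)" by (rule smooth_on_subset) (use inJ in blast)
  have sd: "smooth_on ?J (\<lambda>s. snd \<kappa> (d s))" by (rule smooth_on_subset[OF smooth_curveD(2)[OF d \<kappa>(1)]]) blast
  have oW: "open (W \<times> (UNIV :: (real^'n) set))" using W by (simp add: open_Times)
  have "smooth_on ?J (\<lambda>s. h (snd \<kappa> (d s)) (X s \<mu>))"
    using smooth_on_compose[OF J oW smooth_on_Pair[OF J sd sX] h(1)] by auto
  moreover have tJ: "t \<in> ?J" using t \<kappa> W by simp
  ultimately have "(\<lambda>s. h (snd \<kappa> (d s)) (X s \<mu>)) differentiable (at t)"
    by (rule smooth_on_differentiable)
  then show ?thesis
  proof (rule differentiable_cong_open[OF J tJ, rotated])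
    fix s assume s: "s \<in> ?J"
    have YL: "(d s, Y s) \<in> L" and YX: "tangent_map B A \<pi> (d s) (Y s) = X s"
      using Y inJ[OF s] by (auto simp: field_lifting_def)
    have "X s \<mu> = fd (local_rep \<kappa> \<mu> \<pi>) (snd \<kappa> (d s)) (Y s \<kappa>)"
      using tangent_map_in_chart[OF B sm horizontal_in_tangent_space[OF L YL] \<kappa>(1) _ m(1)] inJ[OF s] c YX by metis
    moreover have "Y s \<kappa> \<in> fiber_coords \<kappa> L (chart_inv \<kappa> (snd \<kappa> (d s)))"
      using YL chart_inv_snd[OF B \<kappa>(1)] inJ[OF s] by (auto simp: fiber_coords_def)
    ultimately show "h (snd \<kappa> (d s)) (X s \<mu>) = Y s \<kappa>" using h(2) inJ[OF s] by metis
  qed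
qed

lemma lifting_regular:
  assumes B: "smooth_atlas B" and A: "smooth_atlas A" and \<pi>: "smooth_map B A \<pi>"
    and d: "smooth_curve B I d" and c: "regular_curve A I c" "\<And>s. s \<in> I \<Longrightarrow> \<pi> (d s) = c s"
  shows "regular_curve B I d"
  unfolding regular_curve_def
proof (intro conjI ballI d)
  fix t assume t: "t \<in> I"
  have "d t \<in> pts B" using d t unfolding smooth_curve_def by blast
  then obtain \<kappa> where k: "\<kappa> \<in> B" "d t \<in> fst \<kappa>" unfolding pts_def by blast
  have sc: "smooth_curve A I c" "velocity A c t \<noteq> tv_zero" using c(1) t by (auto simp: regular_curve_def)
  have "c t \<in> pts A" using sc(1) t unfolding smooth_curve_def by blast
  then obtain \<mu> where m: "\<mu> \<in> A" "c t \<in> fst \<mu>" unfolding pts_def by blast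
  have m': "\<pi> (d t) \<in> fst \<mu>" using m c(2)[OF t] by simp
  have oI: "open I" using d by (simp add: smooth_curve_def)
  have "((\<lambda>t. snd \<mu> (c t)) has_vector_derivative
      fd (local_rep \<kappa> \<mu> \<pi>) (snd \<kappa> (d t)) (velocity B d t \<kappa>)) (at t)"
    by (rule has_vector_derivative_transform_within_open[OF
          has_velocity_image[OF B \<pi> d k(1) t k(2) m(1) m'] oI t]) (simp add: c)
  then have "velocity A c t \<mu> = fd (local_rep \<kappa> \<mu> \<pi>) (snd \<kappa> (d t)) (velocity B d t \<kappa>)"
    by (simp add: velocity_in_chart[OF m(1), of c t, OF m(2)] vector_derivative_at)
  moreover have "velocity A c t \<mu> \<noteq> 0"
    using tv_eq_zero_iff[OF A velocity_in_tangent_space[OF A sc(1) t] m] sc(2) by simp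
  moreover have "linear (fd (local_rep \<kappa> \<mu> \<pi>) (snd \<kappa> (d t)))"
    by (rule linear_frechet_derivative[OF local_rep_diff[OF \<pi> k(1) m(1) k(2) m']])
  ultimately show "velocity B d t \<noteq> tv_zero" by (auto simp: tv_zero_def linear_0)
qed

lemma cov_deriv_projection:
  fixes B :: "('q, real^'m) chart set" and A :: "('p, real^'n) chart set"
  assumes sub: "spray_submersion B H A G \<pi> L" and c: "regular_curve A I c"
    and X: "smooth_field_along A I c X"
    and d: "lifting_tangent_to B \<pi> L I c d" and Y: "field_lifting B A \<pi> L I d X Y" and t: "t \<in> I"
  shows "cov_deriv B H d Y t \<in> tangent_space B (d t)"
    and "tangent_map B A \<pi> (d t) (cov_deriv B H d Y t) = cov_deriv A G c X t"
proof -
  note B = spray_submersionD(1)[OF sub] and A = spray_submersionD(2)[OF sub]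
    and H = spray_submersionD(3)[OF sub] and G = spray_submersionD(4)[OF sub]
    and \<pi>s = spray_submersionD(5)[OF sub]
    and \<pi> = spray_submersionD(6)[OF sub] and L = spray_submersionD(7)[OF sub]
  have dc: "smooth_curve B I d" and cd: "\<And>s. s \<in> I \<Longrightarrow> \<pi> (d s) = c s"
    and vL: "\<And>s. s \<in> I \<Longrightarrow> velocity_lift B d s \<in> L"
    using d by (auto simp: lifting_tangent_to_def)
  have YL: "(d s, Y s) \<in> L" and YX: "tangent_map B A \<pi> (d s) (Y s) = X s" if "s \<in> I" for s
    using Y that by (auto simp: field_lifting_def)
  have sc: "smooth_curve A I c" "velocity A c t \<noteq> tv_zero" using c t by (auto simp: regular_curve_def)
  have dY: "(\<lambda>s. Y s \<kappa>) differentiable (at t)" if "\<kappa> \<in> B" "d t \<in> fst \<kappa>" for \<kappa>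
    by (rule lifted_field_differentiable[OF B A \<pi>s L dc cd X Y t that])
  show DY: "cov_deriv B H d Y t \<in> tangent_space B (d t)"
    by (rule cov_deriv_in_tangent_space[OF B H lifting_regular[OF B A \<pi> dc c cd] t
          horizontal_in_tangent_space[OF L YL] dY])
  have "d t \<in> pts B" using dc t unfolding smooth_curve_def by blast
  then obtain \<kappa> where k: "\<kappa> \<in> B" "d t \<in> fst \<kappa>" unfolding pts_def by blast
  have "c t \<in> pts A" using sc(1) t unfolding smooth_curve_def by blast
  then obtain \<mu> where m: "\<mu> \<in> A" "c t \<in> fst \<mu>" unfolding pts_def by blast
  have m': "\<pi> (d t) \<in> fst \<mu>" using m cd[OF t] by simp
  have DX: "cov_deriv A G c X t \<in> tangent_space A (c t)"
    using smooth_cov_deriv[OF A G c X] t by (simp add: smooth_field_along_def)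
  have "cov_deriv A G c X t \<mu> = fd (local_rep \<kappa> \<mu> \<pi>) (snd \<kappa> (d t)) (cov_deriv B H d Y t \<kappa>)"
  proof (rule cov_deriv_related[where Y = Y and V = "fiber_coords \<kappa> L (d t)",
        OF B H A G \<pi> dc k(1) t k(2) m(1) m' cd dY[OF k] _ subspace_fiber_coords[OF B L k]])
    show "X s \<mu> = fd (local_rep \<kappa> \<mu> \<pi>) (snd \<kappa> (d s)) (Y s \<kappa>)"
      if "s \<in> I" "d s \<in> fst \<kappa>" "c s \<in> fst \<mu>" for s
      using tangent_map_in_chart[OF B \<pi> horizontal_in_tangent_space[OF L YL[OF that(1)]] k(1) that(2) m(1)]
        that cd YX by metis
    show "velocity B d t \<kappa> \<in> fiber_coords \<kappa> L (d t)"
      using vL[OF t] by (auto simp: fiber_coords_def velocity_lift_def)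
    show "Y t \<kappa> \<in> fiber_coords \<kappa> L (d t)" using YL[OF t] by (auto simp: fiber_coords_def)
    show "velocity A c t \<mu> \<noteq> 0"
      using tv_eq_zero_iff[OF A velocity_in_tangent_space[OF A sc(1) t] m] sc(2) by simp
  qed (use horizontal_spray_relation[OF sub k m(1) m'] cd[OF t] in auto)
  then show "tangent_map B A \<pi> (d t) (cov_deriv B H d Y t) = cov_deriv A G c X t"
    using tangent_map_eq_iff[OF B A \<pi> DY _ k m(1) m', of "cov_deriv A G c X t"] DX cd[OF t] by simp
qed

theorem lemma3p5:
  fixes Mbar :: "('q, real^'m) chart set" and M :: "('p, real^'n) chart set"
    and Gbar :: "('q, real^'m) spray_field" and G :: "('p, real^'n) spray_field"
    and \<pi> :: "'q \<Rightarrow> 'p" and L :: "('q \<times> ('q, real^'m) tvec) set"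
    and I :: "real set" and c :: "real \<Rightarrow> 'p" and X :: "real \<Rightarrow> ('p, real^'n) tvec"
    and cbar :: "real \<Rightarrow> 'q" and Xbar :: "real \<Rightarrow> ('q, real^'m) tvec"
  assumes "spray_submersion Mbar Gbar M G \<pi> L"
    and "regular_curve M I c"
    and "smooth_field_along M I c X"
    and "lifting_tangent_to Mbar \<pi> L I c cbar"
    and "field_lifting Mbar M \<pi> L I cbar X Xbar"
  shows "let Y = (\<lambda>t. proj_onto_L Mbar M \<pi> L (cbar t, cov_deriv Mbar Gbar cbar Xbar t)) in
    (\<forall>t\<in>I. L_to_TM Mbar M \<pi> L (Y t) = (c t, cov_deriv M G c X t))
    \<and> smooth_field_along M I c (cov_deriv M G c X)
    \<and> field_lifting Mbar M \<pi> L I cbar (cov_deriv M G c X) (\<lambda>t. snd (Y t))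
    \<and> (linearly_parallel M G I c X \<longleftrightarrow> (\<forall>t\<in>I. Y t = (cbar t, tv_zero)))"
proof -
  note B = spray_submersionD(1)[OF assms(1)] and A = spray_submersionD(2)[OF assms(1)]
    and G = spray_submersionD(4)[OF assms(1)] and \<pi> = spray_submersionD(5)[OF assms(1)]
    and sm = spray_submersionD(6)[OF assms(1)] and L = spray_submersionD(7)[OF assms(1)]
  let ?D = "cov_deriv M G c X" and ?Dbar = "cov_deriv Mbar Gbar cbar Xbar"
  define Y where "Y = (\<lambda>t. proj_onto_L Mbar M \<pi> L (cbar t, ?Dbar t))"
  have q: "cbar t \<in> pts Mbar" and cc: "\<pi> (cbar t) = c t" if "t \<in> I" for t
    using assms(4) that unfolding lifting_tangent_to_def smooth_curve_def by blast+
  have "\<exists>l. Y t = (cbar t, l) \<and> (cbar t, l) \<in> L \<and> tangent_map Mbar M \<pi> (cbar t) l = ?D t" if t: "t \<in> I" for t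
    using proj_onto_L_properties[OF B A \<pi> L q[OF t] cov_deriv_projection(1)[OF assms t]]
      cov_deriv_projection(2)[OF assms t] unfolding Y_def by metis
  then obtain l where l: "\<And>t. t \<in> I \<Longrightarrow> Y t = (cbar t, l t)" "\<And>t. t \<in> I \<Longrightarrow> (cbar t, l t) \<in> L"
    "\<And>t. t \<in> I \<Longrightarrow> tangent_map Mbar M \<pi> (cbar t) (l t) = ?D t" by metis
  have zero: "?D t = tv_zero \<longleftrightarrow> l t = tv_zero" if t: "t \<in> I" for t
  proof
    assume "?D t = tv_zero"
    then have "l t \<in> vertical_space Mbar M \<pi> (cbar t)"
      using l(3)[OF t] horizontal_in_tangent_space[OF L l(2)[OF t]] by (simp add: vertical_space_def)
    then show "l t = tv_zero" by (rule horizontal_vertical_zero[OF L q[OF t] l(2)[OF t]])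
  next
    assume "l t = tv_zero"
    moreover have "tv_zero \<in> vertical_space Mbar M \<pi> (cbar t)"
      using horizontal_complement(1)[OF L q[OF t]] by blast
    ultimately show "?D t = tv_zero" using l(3)[OF t] by (simp add: vertical_space_def)
  qed
  have "\<forall>t\<in>I. L_to_TM Mbar M \<pi> L (Y t) = (c t, ?D t)"
    using l cc by (simp add: L_to_TM_def)
  moreover have "field_lifting Mbar M \<pi> L I cbar ?D (\<lambda>t. snd (Y t))"
    using l by (simp add: field_lifting_def)
  moreover have "linearly_parallel M G I c X \<longleftrightarrow> (\<forall>t\<in>I. Y t = (cbar t, tv_zero))"
    using l(1) zero by (simp add: linearly_parallel_def)
  ultimately show ?thesis
    unfolding Let_def Y_def using smooth_cov_deriv[OF A G assms(2,3)] by blast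
qed

end
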